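(* Consider the two-layer superblock brickwork circuit on $n$ qubits composed of approximate unitary $k$-designs over the orthogonal group with additive error $O(\epsilon)$, each acting on $\Omega(\log(nk/\epsilon))$ qubits. This ensemble, which has depth $O(\log(n/\epsilon)\,\mathrm{poly}(k))$, is (when applied to the state $|0^n\rangle$) an $\epsilon$-approximate additive-error orthogonal state $k$-design.
   Context: $\mathrm{O}(D)$ is the group of real unitary $D\times D$ matrices. Two-layer superblock brickwork: $n$ qubits on a line (with periodic boundary conditions) are divided into $m=n/\xi$ consecutive patches of $\xi$ qubits, $m$ even. In the first layer, independently drawn random unitaries ("superblocks") are applied to the pairs of patches $(1,2),(3,4),\dots,(m-1,m)$; in the second layer, to the pairs $(2,3),(4,5),\dots,(m,1)$. Here $\xi=\Omega(\log(nk/\epsilon))$, and each superblock is drawn from an approximate unitary $k$-design over the orthogonal group on the qubits of that superblock. The depth refers to the superblock designs being implemented by circuits of local gates whose depth is linear in the number of qubits of the superblock (such orthogonal designs, of depth $O(N\,\mathrm{poly}(k)\log(1/\epsilon))$ on $N$ qubits, are known to exist). Twirl: $\Phi^{(k)}_{\mathcal{E}}(A)=\mathbb{E}_{U\sim\mathcal{E}}U^{\otimes k}A\,U^{\dagger,\otimes k}$, and $\Phi^{(k)}_G$ is the same for the Haar measure on a group $G$. An ensemble $\mathcal{E}$ of elements of $G$ is an approximate unitary $k$-design over $G$ with additive error $\delta$ if $\|\Phi^{(k)}_G-\Phi^{(k)}_{\mathcal{E}}\|_\diamond\le\delta$ (diamond norm). An ensemble $\mathcal{E}'$ of pure $n$-qubit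 states is an $\epsilon$-approximate additive-error orthogonal state $k$-design if $\big\|\mathbb{E}_{O\sim\mathrm{O}(2^n)}(O|0^n\rangle\langle0^n|O^T)^{\otimes k}-\mathbb{E}_{\psi\sim\mathcal{E}'}|\psi\rangle\langle\psi|^{\otimes k}\big\|_1\le\epsilon$, with $O$ Haar-random.
   Formalization: The additive errors of all superblocks are required to sum to O(ε), since error O(ε) for each superblock makes the claim false as n grows; the depth bound is stated for ε ≤ 1 and superblocks of size also O(log(nk/ε)), with superblock circuits of depth linear in their size assumed. *)

theory Defs
  imports "HOL-Probability.Probability" "Jordan_Normal_Form.Schur_Decomposition"
begin

hide_const (open) Finite_Cartesian_Product.mat Finite_Cartesian_Product.vec
unbundle no vec_syntax

section \<open>Matrices\<close>

text \<open>Schatten 1-norm: the singular values of \<open>A\<close> are the square roots of the eigenvalues of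
  \<open>A\<^sup>\<dagger>A\<close>, counted with (algebraic) multiplicity.\<close>

definition trace_norm :: "complex mat \<Rightarrow> real" where
  "trace_norm A = (let p = char_poly (mat_adjoint A * A)
     in \<Sum>z | poly p z = 0. real (Polynomial.order z p) * sqrt (Re z))"

text \<open>The \<open>k\<close>-fold tensor power. The basis vectors of the tensor power of a \<open>d\<close>-dimensional space
  are numbered by \<open>i < d ^ k\<close>; the \<open>l\<close>-th base-\<open>d\<close> digit of \<open>i\<close> is the index in the \<open>l\<close>-th factor.\<close>

definition tensor_power :: "nat \<Rightarrow> complex mat \<Rightarrow> complex mat" where
  "tensor_power k A = mat (dim_row A ^ k) (dim_col A ^ k)
     (\<lambda>(i, j). \<Prod>l<k. A $$ (i div dim_row A ^ l mod dim_row A, j div dim_col A ^ l mod dim_col A))"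

text \<open>\<open>|v\<rangle>\<langle>v|\<close>\<close>

definition rank_one :: "complex vec \<Rightarrow> complex mat" where
  "rank_one v = mat (dim_vec v) (dim_vec v) (\<lambda>(i, j). v $ i * cnj (v $ j))"

definition expect_mat :: "nat \<Rightarrow> 'w measure \<Rightarrow> ('w \<Rightarrow> complex mat) \<Rightarrow> complex mat" where
  "expect_mat d M X = mat d d (\<lambda>(i, j). \<integral>\<omega>. X \<omega> $$ (i, j) \<partial>M)"

definition mat_prod :: "nat \<Rightarrow> complex mat list \<Rightarrow> complex mat" where
  "mat_prod d As = foldr (*) As (1\<^sub>m d)"

section \<open>The diamond norm\<close>

text \<open>\<open>\<Phi> \<otimes> id\<close> for a linear map \<open>\<Phi>\<close> on \<open>d \<times> d\<close> matrices and an \<open>r\<close>-dimensional ancilla. The basis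
  vector \<open>|x\<rangle>|a\<rangle>\<close> of the tensor product has number \<open>x * r + a\<close>; the map \<open>\<Phi>\<close> is applied to each of
  the \<open>r \<times> r\<close> many \<open>d \<times> d\<close> blocks \<open>(1 \<otimes> \<langle>a|) X (1 \<otimes> |b\<rangle>)\<close>.\<close>

definition ampliate :: "nat \<Rightarrow> nat \<Rightarrow> (complex mat \<Rightarrow> complex mat) \<Rightarrow> complex mat \<Rightarrow> complex mat" where
  "ampliate d r \<Phi> X = mat (d * r) (d * r) (\<lambda>(i, j).
     \<Phi> (mat d d (\<lambda>(x, y). X $$ (x * r + i mod r, y * r + j mod r))) $$ (i div r, j div r))"

text \<open>The supremum is taken in \<^typ>\<open>ereal\<close>, so that it is meaningful without a boundedness proof.\<close>

definition diamond_norm :: "nat \<Rightarrow> (complex mat \<Rightarrow> complex mat) \<Rightarrow> ereal" where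
  "diamond_norm d \<Phi> =
     (SUP (r, X) \<in> {(r, X). X \<in> carrier_mat (d * r) (d * r) \<and> trace_norm X \<le> 1}.
        ereal (trace_norm (ampliate d r \<Phi> X)))"

section \<open>Designs over the orthogonal group\<close>

definition unitary_group :: "nat \<Rightarrow> complex mat set" where
  "unitary_group D = {U \<in> carrier_mat D D. U * mat_adjoint U = 1\<^sub>m D \<and> mat_adjoint U * U = 1\<^sub>m D}"

definition orthogonal_group :: "nat \<Rightarrow> complex mat set" where
  "orthogonal_group D = {U \<in> unitary_group D. \<forall>i<D. \<forall>j<D. U $$ (i, j) \<in> \<real>}"

text \<open>The Borel sigma-algebra of the orthogonal group, generated by the matrix entries.\<close>

definition orthogonal_borel :: "nat \<Rightarrow> complex mat measure" where
  "orthogonal_borel D = sigma (orthogonal_group D)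
     {{U \<in> orthogonal_group D. U $$ (i, j) \<in> B} | i j B. i < D \<and> j < D \<and> B \<in> sets borel}"

definition orthogonal_ensemble :: "nat \<Rightarrow> complex mat measure \<Rightarrow> bool" where
  "orthogonal_ensemble D E \<longleftrightarrow> prob_space E \<and> sets E = sets (orthogonal_borel D)"

definition haar_orthogonal :: "nat \<Rightarrow> complex mat measure \<Rightarrow> bool" where
  "haar_orthogonal D H \<longleftrightarrow> orthogonal_ensemble D H \<and>
     (\<forall>V \<in> orthogonal_group D. distr H H (\<lambda>U. V * U) = H \<and> distr H H (\<lambda>U. U * V) = H)"

definition twirl :: "nat \<Rightarrow> nat \<Rightarrow> complex mat measure \<Rightarrow> complex mat \<Rightarrow> complex mat" where
  "twirl D k E A =
     expect_mat (D ^ k) E (\<lambda>U. tensor_power k U * A * tensor_power k (mat_adjoint U))"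

text \<open>The parameter \<open>H\<close> of \<open>orthogonal_design\<close> and \<open>orthogonal_state_design\<close> is the Haar measure on
  the orthogonal group in dimension \<open>D\<close> and \<open>2 ^ n\<close>, respectively.\<close>

definition orthogonal_design ::
    "complex mat measure \<Rightarrow> nat \<Rightarrow> nat \<Rightarrow> real \<Rightarrow> complex mat measure \<Rightarrow> bool" where
  "orthogonal_design H D k \<delta> E \<longleftrightarrow> orthogonal_ensemble D E \<and>
     diamond_norm (D ^ k) (\<lambda>A. twirl D k H A - twirl D k E A) \<le> ereal \<delta>"

definition zero_state :: "nat \<Rightarrow> complex vec" where
  "zero_state n = unit_vec (2 ^ n) 0"

text \<open>An ensemble of pure states is given by a random state vector \<open>\<psi>\<close> on a probability space \<open>M\<close>.\<close>

definition pure_state_ensemble :: "nat \<Rightarrow> 'w measure \<Rightarrow> ('w \<Rightarrow> complex vec) \<Rightarrow> bool" where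
  "pure_state_ensemble n M \<psi> \<longleftrightarrow> prob_space M \<and>
     (\<forall>\<omega> \<in> space M. \<psi> \<omega> \<in> carrier_vec (2 ^ n) \<and> \<psi> \<omega> \<bullet>c \<psi> \<omega> = 1) \<and>
     (\<forall>i < 2 ^ n. (\<lambda>\<omega>. \<psi> \<omega> $ i) \<in> borel_measurable M)"

definition orthogonal_state_design ::
    "complex mat measure \<Rightarrow> nat \<Rightarrow> nat \<Rightarrow> real \<Rightarrow> 'w measure \<Rightarrow> ('w \<Rightarrow> complex vec) \<Rightarrow> bool" where
  "orthogonal_state_design H n k \<epsilon> M \<psi> \<longleftrightarrow> pure_state_ensemble n M \<psi> \<and>
     trace_norm
       (expect_mat ((2 ^ n) ^ k) H
          (\<lambda>U. tensor_power k (U * rank_one (zero_state n) * transpose_mat U))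
        - expect_mat ((2 ^ n) ^ k) M (\<lambda>\<omega>. tensor_power k (rank_one (\<psi> \<omega>)))) \<le> \<epsilon>"

section \<open>Circuits\<close>

text \<open>Basis states of \<open>n\<close> qubits are numbered by \<open>i < 2 ^ n\<close>, and \<open>bit i q\<close> is the value of qubit
  \<open>q < n\<close>. The operator \<open>on_qubits n N f A\<close> on \<open>n\<close> qubits is the \<open>N\<close>-qubit operator \<open>A\<close> with its
  \<open>j\<close>-th qubit placed on qubit \<open>f j\<close>, tensored with the identity on the remaining qubits (for
  \<open>f\<close> injective from \<open>{..<N}\<close> to \<open>{..<n}\<close>).\<close>

definition sub_index :: "nat \<Rightarrow> (nat \<Rightarrow> nat) \<Rightarrow> nat \<Rightarrow> nat" where
  "sub_index N f i = (\<Sum>j<N. of_bool (bit i (f j)) * 2 ^ j)"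

definition on_qubits :: "nat \<Rightarrow> nat \<Rightarrow> (nat \<Rightarrow> nat) \<Rightarrow> complex mat \<Rightarrow> complex mat" where
  "on_qubits n N f A = mat (2 ^ n) (2 ^ n) (\<lambda>(i, j).
     if \<forall>q<n. q \<notin> f ` {..<N} \<longrightarrow> bit i q = bit j q
     then A $$ (sub_index N f i, sub_index N f j) else 0)"

text \<open>A layer of two-qubit gates with pairwise disjoint supports. A pair \<open>(q, g)\<close> is a gate \<open>g\<close> on
  the neighbouring qubits \<open>q\<close> and \<open>(q + 1) mod n\<close>; the position \<open>q\<close> has to belong to \<open>S\<close>.\<close>

definition gate_layer :: "nat \<Rightarrow> nat set \<Rightarrow> complex mat \<Rightarrow> bool" where
  "gate_layer n S L \<longleftrightarrow> (\<exists>gs :: (nat \<times> complex mat) list.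
     (\<forall>(q, g) \<in> set gs. q \<in> S \<and> g \<in> unitary_group 4) \<and>
     distinct (concat (map (\<lambda>(q, g). [q, (q + 1) mod n]) gs)) \<and>
     L = mat_prod (2 ^ n) (map (\<lambda>(q, g). on_qubits n 2 (\<lambda>j. (q + j) mod n) g) gs))"

definition local_circuit :: "nat \<Rightarrow> nat set \<Rightarrow> nat \<Rightarrow> complex mat \<Rightarrow> bool" where
  "local_circuit n S d U \<longleftrightarrow>
     (\<exists>Ls. length Ls \<le> d \<and> (\<forall>L \<in> set Ls. gate_layer n S L) \<and> U = mat_prod (2 ^ n) Ls)"

text \<open>Circuits on \<open>n\<close> qubits on an open line, and on a line with periodic boundary conditions.\<close>

definition line_circuit :: "nat \<Rightarrow> nat \<Rightarrow> complex mat \<Rightarrow> bool" where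
  "line_circuit n = local_circuit n {q. q + 1 < n}"

definition ring_circuit :: "nat \<Rightarrow> nat \<Rightarrow> complex mat \<Rightarrow> bool" where
  "ring_circuit n = local_circuit n {..<n}"

text \<open>The two-layer superblock brickwork circuit on \<open>n = m * \<xi>\<close> qubits. Patches are numbered from
  \<open>0\<close>; patch \<open>s\<close> consists of the qubits \<open>s * \<xi>, \<dots>, s * \<xi> + \<xi> - 1\<close>, and the superblock \<open>U s\<close> acts on
  the patches \<open>s\<close> and \<open>(s + 1) mod m\<close>. So the first layer consists of the superblocks with even
  \<open>s\<close>, and the second one of those with odd \<open>s\<close>, the last of which acts on the patches \<open>m - 1\<close> and
  \<open>0\<close>, in this order.\<close>

definition superblock :: "nat \<Rightarrow> nat \<Rightarrow> nat \<Rightarrow> complex mat \<Rightarrow> complex mat" where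
  "superblock m \<xi> s = on_qubits (m * \<xi>) (2 * \<xi>) (\<lambda>j. (s * \<xi> + j) mod (m * \<xi>))"

definition brickwork :: "nat \<Rightarrow> nat \<Rightarrow> (nat \<Rightarrow> complex mat) \<Rightarrow> complex mat" where
  "brickwork m \<xi> U =
     mat_prod (2 ^ (m * \<xi>)) (map (\<lambda>s. superblock m \<xi> s (U s)) (filter odd [0..<m])) *
     mat_prod (2 ^ (m * \<xi>)) (map (\<lambda>s. superblock m \<xi> s (U s)) (filter even [0..<m]))"

end

theory Submission
  imports Defs "Jordan_Normal_Form.Spectral_Radius"
begin

text \<open>
All matrices involved are real, so by duality the trace distance of the two \<open>k\<close>-th moments is the largest
difference of the expectations of \<open>w (\<psi>\<^sup>\<otimes>\<^sup>k)\<close> over the real quadratic forms \<open>w\<close> of norm at most 1. With all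
other superblocks fixed, this expectation is a pairing of \<open>w\<close> with an ampliated twirl of the remaining
one, so replacing the superblocks by Haar-random ones, one at a time, costs the sum of the design errors.

For Haar-random superblocks, call a \<open>k\<close>-tuple of basis states good if its entries differ pairwise on every
patch. Flipping the sign of a single basis state of a superblock leaves the Haar measure invariant. Hence
the moment of a good tuple \<open>x\<close> and a tuple \<open>y\<close> produced by the first layer vanishes unless \<open>x\<close> and \<open>y\<close> have
the same set of entries on every superblock of that layer, and \<open>w\<close> conjugated with the second layer has
the same property for the superblocks of the second layer. Consecutive superblocks share a patch, on which
the entries of a good tuple differ, so the permutations matching \<open>x\<close> with \<open>y\<close> on the single superblocks are
all equal, and \<open>y\<close> is a permutation of \<open>x\<close>. The moments of a global Haar-random state have the same shape, up
to the value on the diagonal, which is controlled by the trace. The tuples that are not good have mass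
at most \<open>3 k (k - 1) m / 2\<^sup>\<xi>\<close> by a bound on the fourth moments of a Haar-random column.
\<close>

section \<open>Real quadratic forms and the trace norm\<close>

text \<open>The moments of the orthogonal group also contain Brauer pairings, which match entries of
  a tuple with each other instead of with entries of the second tuple. Such terms need a repeated
  entry, so they only meet tuples that are not good; for good tuples the group behaves like the
  unitary one. This keeps exact moment formulas out of the proof: sign flips and permutation
  matrices fix the pattern of the moments, and one plane reflection together with the norm of a
  column fixes the fourth moments. Neither layer determines the permutation alone: the first one
  allows a different permutation on every even block, the second one on every odd block. Only the
  product of the first-layer moment with the pullback of \<open>w\<close>, averaged over the second
  layer, forces a common one. The global Haar state can be tested with the same averaged pullback,
  because it is invariant under every fixed second layer.\<close>

definition quad_form :: "'i set \<Rightarrow> ('i \<Rightarrow> 'i \<Rightarrow> real) \<Rightarrow> ('i \<Rightarrow> real) \<Rightarrow> real" where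
  "quad_form X w v = (\<Sum>x\<in>X. \<Sum>y\<in>X. w x y * v x * v y)"

text \<open>For symmetric \<open>w\<close> this is the unit ball of the operator norm, dual to the
  trace norm. An antisymmetric part of \<open>w\<close> is seen neither by the quadratic form nor by
  a pairing with a symmetric matrix.\<close>

definition form_bounded :: "'i set \<Rightarrow> ('i \<Rightarrow> 'i \<Rightarrow> real) \<Rightarrow> bool" where
  "form_bounded X w \<longleftrightarrow> (\<forall>v. \<bar>quad_form X w v\<bar> \<le> (\<Sum>x\<in>X. (v x)\<^sup>2))"

definition orthonormal_columns :: "nat \<Rightarrow> (nat \<Rightarrow> nat \<Rightarrow> real) \<Rightarrow> bool" where
  "orthonormal_columns n V \<longleftrightarrow> (\<forall>j<n. \<forall>l<n. (\<Sum>i<n. V i j * V i l) = of_bool (j = l))"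

section \<open>Diagonalization of real symmetric matrices\<close>

lemma sum_swap_pairs:
  "(\<Sum>a\<in>A. \<Sum>b\<in>B. \<Sum>c\<in>C. \<Sum>d\<in>D. g a b c d) = (\<Sum>c\<in>C. \<Sum>d\<in>D. \<Sum>a\<in>A. \<Sum>b\<in>B. g a b c d)"
proof -
  have "(\<Sum>p\<in>A \<times> B. \<Sum>q\<in>C \<times> D. g (fst p) (snd p) (fst q) (snd q))
      = (\<Sum>q\<in>C \<times> D. \<Sum>p\<in>A \<times> B. g (fst p) (snd p) (fst q) (snd q))"
    by (rule sum.swap)
  thus ?thesis by (simp add: sum.cartesian_product')
qed

lemma sum_product_middle:
  fixes f :: "'a \<Rightarrow> real"
  shows "(\<Sum>a\<in>A. \<Sum>b\<in>B. f a * c * g b) = (\<Sum>a\<in>A. f a) * c * (\<Sum>b\<in>B. g b)"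
proof -
  have "(\<Sum>a\<in>A. f a) * c = (\<Sum>a\<in>A. f a * c)" by (rule sum_distrib_right)
  thus ?thesis by (simp only: sum_product)
qed

lemma sum_of_bool_both:
  fixes y :: "'a \<Rightarrow> 'a \<Rightarrow> real"
  assumes "finite A" "i \<in> A" "j \<in> A"
  shows "(\<Sum>a\<in>A. \<Sum>b\<in>A. of_bool (i = a) * y a b * of_bool (b = j)) = y i j"
proof -
  have "(\<Sum>a\<in>A. \<Sum>b\<in>A. of_bool (i = a) * y a b * of_bool (b = j))
      = (\<Sum>a\<in>A. \<Sum>b\<in>A. if b = j then (if a = i then y a j else 0) else 0)"
    by (intro sum.cong) auto
  thus ?thesis using assms by simp
qed

text \<open>The spectrum over the complex numbers is not empty. For an eigenvector
  \<open>z = a + i b\<close>, symmetry makes the eigenvalue real; then \<open>a\<close> and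
  \<open>b\<close> separately satisfy the eigenvalue equation, and one of them is not zero.\<close>

lemma real_symmetric_eigenvector:
  fixes Y :: "nat \<Rightarrow> nat \<Rightarrow> real"
  assumes sym: "\<And>i j. i < n \<Longrightarrow> j < n \<Longrightarrow> Y i j = Y j i" and n: "n > 0"
  shows "\<exists>v r. (\<Sum>i<n. (v i)\<^sup>2) = 1 \<and> (\<forall>i<n. (\<Sum>j<n. Y i j * v j) = r * v i)"
proof -
  define A where "A = mat n n (\<lambda>(i, j). complex_of_real (Y i j))"
  have A: "A \<in> carrier_mat n n" by (simp add: A_def)
  have "spectrum A \<noteq> {}" using spectrum_non_empty[OF A] n by simp
  then obtain \<mu> where "eigenvalue A \<mu>" unfolding spectrum_def by auto
  then obtain z where z: "z \<in> carrier_vec n" "z \<noteq> 0\<^sub>v n" "A *\<^sub>v z = \<mu> \<cdot>\<^sub>v z"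
    unfolding eigenvalue_def eigenvector_def using A by auto
  have eq: "(\<Sum>j<n. complex_of_real (Y i j) * z $ j) = \<mu> * z $ i" if "i < n" for i
  proof -
    have "(A *\<^sub>v z) $ i = (\<mu> \<cdot>\<^sub>v z) $ i" using z by simp
    thus ?thesis using that z
      by (simp add: A_def scalar_prod_def atLeast0LessThan)
  qed
  define a b where "a i = Re (z $ i)" and "b i = Im (z $ i)" for i
  define p q where "p = Re \<mu>" and "q = Im \<mu>"
  have ea: "(\<Sum>j<n. Y i j * a j) = p * a i - q * b i" if "i < n" for i
    using arg_cong[OF eq[OF that], of Re] by (simp add: a_def b_def p_def q_def)
  have eb: "(\<Sum>j<n. Y i j * b j) = p * b i + q * a i" if "i < n" for i
    using arg_cong[OF eq[OF that], of Im] by (simp add: a_def b_def p_def q_def)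
  \<comment> \<open>The bilinear form of \<open>Y\<close> at \<open>(b, a)\<close> equals the one at
    \<open>(a, b)\<close>. By \<open>ea\<close> and \<open>eb\<close> their difference is, up to
    sign, the imaginary part \<open>q\<close> times the squared norm of \<open>z\<close>.\<close>
  have "(\<Sum>i<n. b i * (\<Sum>j<n. Y i j * a j)) = (\<Sum>i<n. a i * (\<Sum>j<n. Y i j * b j))"
    unfolding sum_distrib_left
    by (subst sum.swap) (intro sum.cong refl, simp add: sym mult.assoc mult.left_commute)
  hence "(\<Sum>i<n. b i * (p * a i - q * b i)) = (\<Sum>i<n. a i * (p * b i + q * a i))"
    by (simp add: ea eb)
  hence "q * (\<Sum>i<n. (a i)\<^sup>2 + (b i)\<^sup>2) = 0"
    by (simp add: algebra_simps sum.distrib sum_subtractf sum_distrib_left power2_eq_square)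
  moreover have "(\<Sum>i<n. (a i)\<^sup>2 + (b i)\<^sup>2) \<noteq> 0"
  proof
    assume "(\<Sum>i<n. (a i)\<^sup>2 + (b i)\<^sup>2) = 0"
    hence "\<forall>i<n. (a i)\<^sup>2 + (b i)\<^sup>2 = 0"
      by (subst (asm) sum_nonneg_eq_0_iff) auto
    hence "\<forall>i<n. z $ i = 0" by (simp add: a_def b_def complex_eq_iff sum_power2_eq_zero_iff)
    hence "z = 0\<^sub>v n" using z by auto
    thus False using z by simp
  qed
  ultimately have q: "q = 0" by simp
  obtain c :: "nat \<Rightarrow> real" where c: "(\<Sum>i<n. (c i)\<^sup>2) \<noteq> 0" "\<forall>i<n. (\<Sum>j<n. Y i j * c j) = p * c i"
  proof (cases "(\<Sum>i<n. (a i)\<^sup>2) = 0")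
    case False thus ?thesis using that[of a] ea q by simp
  next
    case True
    hence "(\<Sum>i<n. (b i)\<^sup>2) \<noteq> 0"
      using \<open>(\<Sum>i<n. (a i)\<^sup>2 + (b i)\<^sup>2) \<noteq> 0\<close> by (simp add: sum.distrib)
    thus ?thesis using that[of b] eb q by simp
  qed
  define N where "N = (\<Sum>i<n. (c i)\<^sup>2)"
  have N: "N > 0" using c(1) sum_nonneg[of "{..<n}" "\<lambda>i. (c i)\<^sup>2"] unfolding N_def by simp
  define v where "v i = c i / sqrt N" for i
  have "(\<Sum>i<n. (v i)\<^sup>2) = 1"
    using N by (simp add: v_def power_divide flip: sum_divide_distrib N_def)
  moreover have "(\<Sum>j<n. Y i j * v j) = p * v i" if "i < n" for i
    using c(2) that by (simp add: v_def flip: sum_divide_distrib)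
  ultimately show ?thesis by blast
qed

text \<open>The Householder reflection \<open>1 - 2 u u^T / |u|^2\<close> along
  \<open>u = v - e_p\<close> exchanges \<open>e_p\<close> and \<open>v\<close>. Here
  \<open>|u|^2 = 2 - 2 * v p\<close>, whence the factor \<open>c\<close>. For \<open>v p = 1\<close>
  the vector \<open>u\<close> vanishes and the identity takes its place.\<close>

lemma householder_reflection:
  fixes v :: "nat \<Rightarrow> real"
  assumes v: "(\<Sum>i<n. (v i)\<^sup>2) = 1" and p: "p < n"
  shows "\<exists>T. (\<forall>i j. T i j = T j i) \<and>
    (\<forall>i<n. \<forall>j<n. (\<Sum>k<n. T i k * T k j) = of_bool (i = j)) \<and> (\<forall>i<n. T i p = v i)"
proof (cases "v p = 1")
  case True
  have "(\<Sum>i\<in>{..<n} - {p}. (v i)\<^sup>2) = 0"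
    using v True p by (simp add: sum.remove[of "{..<n}" p])
  hence "\<forall>i<n. i \<noteq> p \<longrightarrow> v i = 0"
    by (subst (asm) sum_nonneg_eq_0_iff) auto
  thus ?thesis using True p
    by (intro exI[of _ "\<lambda>i j. of_bool (i = j)"]) (auto simp: of_bool_def if_distrib cong: if_cong)
next
  case False
  define u where "u i = v i - of_bool (i = p)" for i
  define c where "c = 1 / (1 - v p)"
  have uu: "(\<Sum>i<n. u i * u i) = 2 - 2 * v p"
  proof -
    have "(\<Sum>i<n. u i * u i) = (\<Sum>i<n. (v i)\<^sup>2 - 2 * (if i = p then v i else 0) + (if i = p then 1 else 0))"
      by (intro sum.cong) (auto simp: u_def power2_eq_square algebra_simps)
    also have "\<dots> = 2 - 2 * v p"
      using v p by (simp add: sum.distrib sum_subtractf flip: sum_distrib_left)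
    finally show ?thesis .
  qed
  define T where "T i j = of_bool (i = j) - c * u i * u j" for i j
  have 1: "(\<Sum>k<n. T i k * T k j) = of_bool (i = j)" if "i < n" "j < n" for i j
  proof -
    have "(\<Sum>k<n. T i k * T k j) = (\<Sum>k<n. (if k = i then of_bool (i = j) else 0)
        - (if k = i then c * u i * u j else 0) - (if k = j then c * u i * u j else 0)
        + c * c * u i * u j * (u k * u k))"
      by (intro sum.cong) (auto simp: T_def algebra_simps)
    also have "\<dots> = of_bool (i = j) - 2 * (c * u i * u j) + c * c * u i * u j * (2 - 2 * v p)"
      using that by (simp add: sum.distrib sum_subtractf flip: sum_distrib_left uu)
    also have "\<dots> = of_bool (i = j) - 2 * (c * u i * u j) + 2 * (c * u i * u j) * (c * (1 - v p))"
      by (simp add: algebra_simps)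
    also have "c * (1 - v p) = 1" using False by (simp add: c_def)
    finally show ?thesis by simp
  qed
  have 2: "T i p = v i" if "i < n" for i
    using False by (auto simp: T_def u_def c_def field_simps)
  show ?thesis using 1 2 by (intro exI[of _ T]) (auto simp: T_def)
qed

text \<open>Deflation: the reflection \<open>T\<close> carries the last basis vector to a unit
  eigenvector. Then the last column of \<open>T Y T\<close>, and by symmetry its last row, is
  \<open>r\<close> times a basis vector, and the induction hypothesis applies to the leading
  \<open>n\<close> by \<open>n\<close> block. As \<open>T\<close> is its own inverse, the columns of
  \<open>W = T V'\<close> diagonalize \<open>Y\<close>.\<close>

lemma real_symmetric_diagonalization:
  fixes Y :: "nat \<Rightarrow> nat \<Rightarrow> real"
  assumes "\<And>i j. i < n \<Longrightarrow> j < n \<Longrightarrow> Y i j = Y j i"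
  shows "\<exists>V d. orthonormal_columns n V \<and> (\<forall>i<n. \<forall>j<n. Y i j = (\<Sum>l<n. d l * V i l * V j l))"
  using assms
proof (induction n arbitrary: Y)
  case 0
  thus ?case by (simp add: orthonormal_columns_def)
next
  case (Suc n)
  obtain v r where v: "(\<Sum>i<Suc n. (v i)\<^sup>2) = 1" "\<And>i. i < Suc n \<Longrightarrow> (\<Sum>j<Suc n. Y i j * v j) = r * v i"
    using real_symmetric_eigenvector[of "Suc n" Y] Suc.prems by blast
  obtain T where Tsym: "\<And>i j. T i j = T j i"
    and TT: "\<And>i j. i < Suc n \<Longrightarrow> j < Suc n \<Longrightarrow> (\<Sum>k<Suc n. T i k * T k j) = of_bool (i = j)"
    and Tn: "\<And>i. i < Suc n \<Longrightarrow> T i n = v i"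
    using householder_reflection[OF v(1), of n] by blast
  define Z where "Z i j = (\<Sum>a<Suc n. \<Sum>b<Suc n. T i a * Y a b * T b j)" for i j
  have Zsym: "Z i j = Z j i" for i j
    unfolding Z_def by (subst sum.swap) (intro sum.cong refl, simp add: Tsym Suc.prems ac_simps)
  have Zn: "Z i n = r * of_bool (i = n)" if "i < Suc n" for i
  proof -
    have "Z i n = (\<Sum>a<Suc n. T i a * (\<Sum>b<Suc n. Y a b * v b))"
      unfolding Z_def sum_distrib_left by (intro sum.cong refl) (simp add: Tn)
    also have "\<dots> = (\<Sum>a<Suc n. T i a * (r * T a n))"
      by (intro sum.cong refl) (simp add: v(2) Tn del: sum.lessThan_Suc)
    also have "\<dots> = r * (\<Sum>a<Suc n. T i a * T a n)"
      by (simp add: sum_distrib_left algebra_simps del: sum.lessThan_Suc)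
    finally show ?thesis using TT[OF that, of n] by simp
  qed
  obtain V d where V: "orthonormal_columns n V"
    and Vd: "\<And>i j. i < n \<Longrightarrow> j < n \<Longrightarrow> Z i j = (\<Sum>l<n. d l * V i l * V j l)"
    using Suc.IH[of Z] Zsym by blast
  define V' where "V' i l = (if i < n \<and> l < n then V i l else of_bool (i = l))" for i l
  define d' where "d' l = (if l < n then d l else r)" for l
  have V': "(\<Sum>i<Suc n. V' i j * V' i l) = of_bool (j = l)" if "j < Suc n" "l < Suc n" for j l
    using that V by (auto simp: V'_def orthonormal_columns_def less_Suc_eq)
  have Z': "Z i j = (\<Sum>l<Suc n. d' l * V' i l * V' j l)" if "i < Suc n" "j < Suc n" for i j
  proof (cases "i < n \<and> j < n")
    case True thus ?thesis by (simp add: Vd d'_def V'_def)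
  next
    case False
    hence ij: "i = n \<or> j = n" using that by auto
    have "Z i j = r * of_bool (i = j)" using ij Zn[of i] Zn[of j] Zsym[of i j] that by auto
    moreover have "(\<Sum>l<n. d' l * V' i l * V' j l) = 0"
      using ij by (intro sum.neutral) (auto simp: V'_def)
    ultimately show ?thesis using ij that by (auto simp: d'_def V'_def)
  qed
  define W where "W i l = (\<Sum>a<Suc n. T i a * V' a l)" for i l
  have "(\<Sum>i<Suc n. W i j * W i l) = of_bool (j = l)" if "j < Suc n" "l < Suc n" for j l
  proof -
    have "(\<Sum>i<Suc n. W i j * W i l)
        = (\<Sum>i<Suc n. \<Sum>a<Suc n. \<Sum>b<Suc n. V' a j * V' b l * (T a i * T i b))"
      unfolding W_def sum_product by (intro sum.cong refl) (simp add: Tsym ac_simps)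
    also have "\<dots> = (\<Sum>a<Suc n. \<Sum>b<Suc n. \<Sum>i<Suc n. V' a j * V' b l * (T a i * T i b))"
      by (subst sum.swap, rule sum.cong[OF refl], rule sum.swap)
    also have "\<dots> = (\<Sum>a<Suc n. \<Sum>b<Suc n. V' a j * V' b l * of_bool (a = b))"
      unfolding sum_distrib_left[symmetric] by (intro sum.cong refl) (simp add: TT del: sum.lessThan_Suc)
    also have "\<dots> = (\<Sum>a<Suc n. V' a j * V' a l)"
      by (intro sum.cong refl) (simp add: of_bool_def if_distrib cong: if_cong del: sum.lessThan_Suc)
    finally show ?thesis using V' that by simp
  qed
  hence W: "orthonormal_columns (Suc n) W" by (simp add: orthonormal_columns_def)
  have "Y i j = (\<Sum>l<Suc n. d' l * W i l * W j l)" if ij: "i < Suc n" "j < Suc n" for i j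
  proof -
    have "(\<Sum>l<Suc n. d' l * W i l * W j l)
        = (\<Sum>l<Suc n. \<Sum>a<Suc n. \<Sum>b<Suc n. T i a * T b j * (d' l * V' a l * V' b l))"
      unfolding W_def mult.assoc sum_product unfolding sum_distrib_left
      by (intro sum.cong refl) (simp add: Tsym ac_simps)
    also have "\<dots> = (\<Sum>a<Suc n. \<Sum>b<Suc n. \<Sum>l<Suc n. T i a * T b j * (d' l * V' a l * V' b l))"
      by (subst sum.swap, rule sum.cong[OF refl], rule sum.swap)
    also have "\<dots> = (\<Sum>a<Suc n. \<Sum>b<Suc n. T i a * T b j * Z a b)"
      unfolding sum_distrib_left[symmetric] by (intro sum.cong refl) (simp add: Z' del: sum.lessThan_Suc)
    also have "\<dots> = (\<Sum>a<Suc n. \<Sum>b<Suc n. \<Sum>e<Suc n. \<Sum>f<Suc n. (T i a * T a e) * Y e f * (T f b * T b j))"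
      unfolding Z_def sum_distrib_left by (intro sum.cong refl) (simp add: ac_simps)
    also have "\<dots> = (\<Sum>e<Suc n. \<Sum>f<Suc n. \<Sum>a<Suc n. \<Sum>b<Suc n. (T i a * T a e) * Y e f * (T f b * T b j))"
      by (rule sum_swap_pairs)
    also have "\<dots> = (\<Sum>e<Suc n. \<Sum>f<Suc n. (\<Sum>a<Suc n. T i a * T a e) * Y e f * (\<Sum>b<Suc n. T f b * T b j))"
      by (simp only: sum_product_middle)
    also have "\<dots> = (\<Sum>e<Suc n. \<Sum>f<Suc n. of_bool (i = e) * Y e f * of_bool (f = j))"
      using ij by (intro sum.cong refl) (simp add: TT del: sum.lessThan_Suc)
    also have "\<dots> = Y i j"
      using ij by (intro sum_of_bool_both) auto
    finally show ?thesis ..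
  qed
  thus ?case using W by blast
qed

section \<open>The trace norm of a real symmetric matrix and its dual description\<close>

lemma mat_adjoint_index:
  "i < dim_col A \<Longrightarrow> j < dim_row A \<Longrightarrow> mat_adjoint A $$ (i, j) = conjugate (A $$ (j, i))"
  by (simp add: mat_adjoint_def mat_of_rows_index)

lemma mat_adjoint_dims [simp]:
  "dim_row (mat_adjoint A) = dim_col A" "dim_col (mat_adjoint A) = dim_row A"
  by (simp_all add: mat_adjoint_def)

text \<open>\<open>trace_norm\<close> sums over the distinct roots, weighted by multiplicity. For a
  split polynomial the order of a root counts the linear factors that have it, so the weighted sum
  is a plain sum over the factors.\<close>

lemma sum_order_prod_linear:
  fixes a :: "nat \<Rightarrow> complex"
  assumes p: "p = (\<Prod>l<n. [:- a l, 1:])"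
  shows "(\<Sum>z | poly p z = 0. real (Polynomial.order z p) * g z) = (\<Sum>l<n. g (a l))"
proof -
  have p0: "p \<noteq> 0" unfolding p by simp
  have "proots p = (\<Sum>l<n. {#a l#})"
    unfolding p by (subst proots_prod) auto
  hence "Polynomial.order z p = count (\<Sum>l<n. {#a l#}) z" for z
    using count_proots[OF p0, of z] by simp
  hence ord: "Polynomial.order z p = card {l \<in> {..<n}. a l = z}" for z
    by (simp add: count_sum sum.If_cases Int_def)
  have roots: "{z. poly p z = 0} = a ` {..<n}"
    unfolding p by (auto simp: poly_prod)
  have "(\<Sum>z | poly p z = 0. real (Polynomial.order z p) * g z)
      = (\<Sum>z\<in>a ` {..<n}. \<Sum>l\<in>{l \<in> {..<n}. a l = z}. g (a l))"
    unfolding roots ord by (intro sum.cong refl) simp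
  also have "\<dots> = (\<Sum>l<n. g (a l))"
    by (rule sum.group) auto
  finally show ?thesis .
qed

text \<open>The matrix of eigenvectors makes \<open>Y^T Y\<close> similar to the diagonal matrix
  with entries \<open>(d l) ^ 2\<close>. So its characteristic polynomial splits, and the factor
  number \<open>l\<close> contributes the square root of \<open>(d l) ^ 2\<close>.\<close>

lemma trace_norm_real_symmetric:
  fixes Y :: "nat \<Rightarrow> nat \<Rightarrow> real"
  assumes V: "orthonormal_columns n V"
    and Y: "\<And>i j. i < n \<Longrightarrow> j < n \<Longrightarrow> Y i j = (\<Sum>l<n. d l * V i l * V j l)"
  shows "trace_norm (mat n n (\<lambda>(i, j). complex_of_real (Y i j))) = (\<Sum>l<n. \<bar>d l\<bar>)"
proof -
  let ?Y = "mat n n (\<lambda>(i, j). complex_of_real (Y i j))"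
  define P Q B where "P = mat n n (\<lambda>(i, j). complex_of_real (V i j))"
    and "Q = mat n n (\<lambda>(i, j). complex_of_real (V j i))"
    and "B = mat n n (\<lambda>(i, j). if i = j then complex_of_real ((d i)\<^sup>2) else 0)"
  have carr: "P \<in> carrier_mat n n" "Q \<in> carrier_mat n n" "B \<in> carrier_mat n n"
    by (simp_all add: P_def Q_def B_def)
  have QP: "Q * P = 1\<^sub>m n"
  proof (rule eq_matI)
    fix i j assume "i < dim_row (1\<^sub>m n :: complex mat)" "j < dim_col (1\<^sub>m n :: complex mat)"
    hence ij: "i < n" "j < n" by auto
    have "(Q * P) $$ (i, j) = complex_of_real (\<Sum>k<n. V k i * V k j)"
      using ij by (simp add: P_def Q_def scalar_prod_def atLeast0LessThan)
    also have "(\<Sum>k<n. V k i * V k j) = of_bool (i = j)"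
      using ij V by (simp add: orthonormal_columns_def)
    finally show "(Q * P) $$ (i, j) = 1\<^sub>m n $$ (i, j)"
      using ij by simp
  qed (simp_all add: P_def Q_def)
  have PQ: "P * Q = 1\<^sub>m n" using mat_mult_left_right_inverse[OF carr(2,1) QP] .
  have YY: "(\<Sum>k<n. Y k i * Y k j) = (\<Sum>l<n. (d l)\<^sup>2 * V i l * V j l)" if ij: "i < n" "j < n" for i j
  proof -
    have "(\<Sum>k<n. Y k i * Y k j)
        = (\<Sum>k<n. \<Sum>l<n. \<Sum>h<n. d l * V i l * d h * V j h * (V k l * V k h))"
      by (intro sum.cong refl) (simp add: Y ij sum_product ac_simps)
    also have "\<dots> = (\<Sum>l<n. \<Sum>h<n. \<Sum>k<n. d l * V i l * d h * V j h * (V k l * V k h))"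
      by (subst sum.swap, rule sum.cong[OF refl], rule sum.swap)
    also have "\<dots> = (\<Sum>l<n. \<Sum>h<n. d l * V i l * d h * V j h * of_bool (l = h))"
      unfolding sum_distrib_left[symmetric] using V
      by (intro sum.cong refl) (simp add: orthonormal_columns_def)
    also have "\<dots> = (\<Sum>l<n. (d l)\<^sup>2 * V i l * V j l)"
      by (intro sum.cong refl)
        (simp add: of_bool_def if_distrib power2_eq_square ac_simps cong: if_cong)
    finally show ?thesis .
  qed
  have "mat_adjoint ?Y * ?Y = P * B * Q"
  proof (rule eq_matI)
    fix i j assume "i < dim_row (P * B * Q)" "j < dim_col (P * B * Q)"
    hence ij: "i < n" "j < n" by (auto simp: P_def Q_def)
    have "(mat_adjoint ?Y * ?Y) $$ (i, j) = complex_of_real (\<Sum>k<n. Y k i * Y k j)"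
      using ij by (simp add: scalar_prod_def atLeast0LessThan mat_adjoint_index)
    also have "\<dots> = complex_of_real (\<Sum>l<n. (d l)\<^sup>2 * V i l * V j l)"
      using YY[OF ij] by simp
    also have "\<dots> = (\<Sum>l<n. (\<Sum>h<n. P $$ (i, h) * B $$ (h, l)) * Q $$ (l, j))"
      using ij by (simp add: P_def Q_def B_def if_distrib ac_simps cong: if_cong)
    also have "\<dots> = (P * B * Q) $$ (i, j)"
      using ij carr by (simp add: scalar_prod_def atLeast0LessThan del: assoc_mult_mat)
    finally show "(mat_adjoint ?Y * ?Y) $$ (i, j) = (P * B * Q) $$ (i, j)" .
  qed (simp_all add: P_def Q_def)
  hence "similar_mat (mat_adjoint ?Y * ?Y) B"
    using PQ QP carr unfolding similar_mat_def similar_mat_wit_def Let_def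
    by (intro exI[of _ P] exI[of _ Q]) auto
  hence "char_poly (mat_adjoint ?Y * ?Y) = char_poly B" by (rule char_poly_similar)
  also have "\<dots> = (\<Prod>a\<leftarrow>diag_mat B. [:- a, 1:])"
    by (rule char_poly_upper_triangular[OF carr(3)]) (auto simp: B_def)
  also have "\<dots> = (\<Prod>l<n. [:- complex_of_real ((d l)\<^sup>2), 1:])"
    by (simp add: diag_mat_def B_def comp_def prod.list_conv_set_nth atLeast0LessThan)
  finally have "trace_norm ?Y = (\<Sum>l<n. sqrt (Re (complex_of_real ((d l)\<^sup>2))))"
    unfolding trace_norm_def Let_def by (rule sum_order_prod_linear)
  thus ?thesis by simp
qed

lemma sum_quadratic_diagonalization:
  fixes Y w :: "nat \<Rightarrow> nat \<Rightarrow> real"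
  assumes Y: "\<And>i j. i < n \<Longrightarrow> j < n \<Longrightarrow> Y i j = (\<Sum>l<n. d l * V i l * V j l)"
  shows "(\<Sum>i<n. \<Sum>j<n. w i j * Y i j) = (\<Sum>l<n. d l * quad_form {..<n} w (\<lambda>i. V i l))"
proof -
  have "(\<Sum>i<n. \<Sum>j<n. w i j * Y i j) = (\<Sum>i<n. \<Sum>j<n. \<Sum>l<n. d l * (w i j * V i l * V j l))"
    by (intro sum.cong refl) (simp add: Y sum_distrib_left ac_simps)
  also have "\<dots> = (\<Sum>i<n. \<Sum>l<n. \<Sum>j<n. d l * (w i j * V i l * V j l))"
    by (intro sum.cong refl sum.swap)
  also have "\<dots> = (\<Sum>l<n. \<Sum>i<n. \<Sum>j<n. d l * (w i j * V i l * V j l))"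
    by (rule sum.swap)
  finally show ?thesis by (simp add: quad_form_def sum_distrib_left)
qed

text \<open>The form that attains the trace norm is the sign of \<open>Y\<close>: it has the
  eigenvectors of \<open>Y\<close> and the eigenvalues \<open>sgn (d l)\<close>, so its pairing with
  \<open>Y\<close> is the sum of the \<open>\<bar>d l\<bar>\<close>.\<close>

lemma trace_norm_le_if_forms_le:
  fixes Y :: "nat \<Rightarrow> nat \<Rightarrow> real"
  assumes sym: "\<And>i j. i < n \<Longrightarrow> j < n \<Longrightarrow> Y i j = Y j i"
    and le: "\<And>w. form_bounded {..<n} w \<Longrightarrow> (\<Sum>i<n. \<Sum>j<n. w i j * Y i j) \<le> b"
  shows "trace_norm (mat n n (\<lambda>(i, j). complex_of_real (Y i j))) \<le> b"
proof -
  obtain V d where V: "orthonormal_columns n V"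
    and Y: "\<And>i j. i < n \<Longrightarrow> j < n \<Longrightarrow> Y i j = (\<Sum>l<n. d l * V i l * V j l)"
    using real_symmetric_diagonalization[of n Y] sym by blast
  define w where "w i j = (\<Sum>l<n. sgn (d l) * V i l * V j l)" for i j
  have quad: "quad_form {..<n} w v = (\<Sum>l<n. sgn (d l) * (\<Sum>i<n. V i l * v i)\<^sup>2)" for v
  proof -
    have "quad_form {..<n} w v = (\<Sum>i<n. \<Sum>j<n. v i * v j * w i j)"
      by (simp add: quad_form_def ac_simps)
    also have "\<dots> = (\<Sum>l<n. sgn (d l) * quad_form {..<n} (\<lambda>i j. v i * v j) (\<lambda>i. V i l))"
      by (rule sum_quadratic_diagonalization) (simp add: w_def)
    finally show ?thesis
      by (simp add: quad_form_def power2_eq_square sum_product ac_simps)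
  qed
  \<comment> \<open>That the sign is a bounded form needs orthonormal rows of \<open>V\<close>, not
    only columns; for a square matrix the left inverse is also a right inverse.\<close>
  have parseval: "(\<Sum>l<n. (\<Sum>i<n. V i l * v i)\<^sup>2) = (\<Sum>i<n. (v i)\<^sup>2)" for v :: "nat \<Rightarrow> real"
  proof -
    define P Q where "P = mat n n (\<lambda>(i, j). V i j)" and "Q = mat n n (\<lambda>(i, j). V j i)"
    have carr: "P \<in> carrier_mat n n" "Q \<in> carrier_mat n n" by (simp_all add: P_def Q_def)
    have "Q * P = 1\<^sub>m n"
      using V by (intro eq_matI)
        (auto simp: P_def Q_def scalar_prod_def atLeast0LessThan orthonormal_columns_def)
    hence PQ: "P * Q = 1\<^sub>m n" using mat_mult_left_right_inverse[OF carr(2,1)] by simp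
    have rows: "(\<Sum>l<n. V i l * V j l) = of_bool (i = j)" if "i < n" "j < n" for i j
      using arg_cong[OF PQ, of "\<lambda>M. M $$ (i, j)"] that
      by (simp add: P_def Q_def scalar_prod_def atLeast0LessThan)
    have "(\<Sum>l<n. (\<Sum>i<n. V i l * v i)\<^sup>2) = (\<Sum>l<n. \<Sum>i<n. \<Sum>j<n. v i * v j * (V i l * V j l))"
      by (simp add: power2_eq_square sum_product ac_simps)
    also have "\<dots> = (\<Sum>i<n. \<Sum>j<n. \<Sum>l<n. v i * v j * (V i l * V j l))"
      by (subst sum.swap, rule sum.cong[OF refl], rule sum.swap)
    also have "\<dots> = (\<Sum>i<n. \<Sum>j<n. v i * v j * of_bool (i = j))"
      unfolding sum_distrib_left[symmetric] by (intro sum.cong refl) (simp add: rows)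
    finally show ?thesis
      by (simp add: of_bool_def if_distrib power2_eq_square cong: if_cong)
  qed
  have "\<bar>quad_form {..<n} w v\<bar> \<le> (\<Sum>i<n. (v i)\<^sup>2)" for v
  proof -
    have "\<bar>quad_form {..<n} w v\<bar> \<le> (\<Sum>l<n. \<bar>sgn (d l) * (\<Sum>i<n. V i l * v i)\<^sup>2\<bar>)"
      unfolding quad by (rule sum_abs)
    also have "\<dots> \<le> (\<Sum>l<n. (\<Sum>i<n. V i l * v i)\<^sup>2)"
      by (intro sum_mono) (auto simp: abs_mult sgn_if)
    finally show ?thesis using parseval by simp
  qed
  hence "form_bounded {..<n} w" by (simp add: form_bounded_def)
  hence "(\<Sum>i<n. \<Sum>j<n. w i j * Y i j) \<le> b" by (rule le)
  moreover have "(\<Sum>i<n. \<Sum>j<n. w i j * Y i j) = (\<Sum>l<n. \<bar>d l\<bar>)"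
  proof -
    have "quad_form {..<n} w (\<lambda>i. V i l) = sgn (d l)" if "l < n" for l
    proof -
      have "quad_form {..<n} w (\<lambda>i. V i l) = (\<Sum>h<n. if h = l then sgn (d l) else 0)"
        unfolding quad using V that by (intro sum.cong refl) (simp add: orthonormal_columns_def)
      thus ?thesis using that by simp
    qed
    thus ?thesis
      by (subst sum_quadratic_diagonalization[OF Y]) (simp_all add: abs_sgn)
  qed
  moreover have "trace_norm (mat n n (\<lambda>(i, j). complex_of_real (Y i j))) = (\<Sum>l<n. \<bar>d l\<bar>)"
    by (rule trace_norm_real_symmetric[OF V Y])
  ultimately show ?thesis by simp
qed

text \<open>In an eigenbasis of \<open>Y\<close> the pairing is the sum of the eigenvalues weighted
  with the values of \<open>w\<close> at unit vectors, and these values are at most 1 in absolute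
  value.\<close>

lemma form_le_trace_norm:
  fixes Y w :: "nat \<Rightarrow> nat \<Rightarrow> real"
  assumes sym: "\<And>i j. i < n \<Longrightarrow> j < n \<Longrightarrow> Y i j = Y j i" and w: "form_bounded {..<n} w"
  shows "\<bar>\<Sum>i<n. \<Sum>j<n. w i j * Y i j\<bar> \<le> trace_norm (mat n n (\<lambda>(i, j). complex_of_real (Y i j)))"
proof -
  obtain V d where V: "orthonormal_columns n V"
    and Y: "\<And>i j. i < n \<Longrightarrow> j < n \<Longrightarrow> Y i j = (\<Sum>l<n. d l * V i l * V j l)"
    using real_symmetric_diagonalization[of n Y] sym by blast
  have "\<bar>\<Sum>i<n. \<Sum>j<n. w i j * Y i j\<bar> \<le> (\<Sum>l<n. \<bar>d l * quad_form {..<n} w (\<lambda>i. V i l)\<bar>)"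
    by (subst sum_quadratic_diagonalization[OF Y]) (simp_all add: sum_abs)
  also have "\<dots> \<le> (\<Sum>l<n. \<bar>d l\<bar>)"
  proof (rule sum_mono)
    fix l assume "l \<in> {..<n}"
    hence "(\<Sum>i<n. (V i l)\<^sup>2) = 1"
      using V by (simp add: orthonormal_columns_def power2_eq_square)
    hence "\<bar>quad_form {..<n} w (\<lambda>i. V i l)\<bar> \<le> 1"
      using w unfolding form_bounded_def by metis
    thus "\<bar>d l * quad_form {..<n} w (\<lambda>i. V i l)\<bar> \<le> \<bar>d l\<bar>"
      by (simp add: abs_mult mult_left_le)
  qed
  finally show ?thesis by (simp add: trace_norm_real_symmetric[OF V Y])
qed

lemma trace_norm_rank_one_le:
  fixes v :: "nat \<Rightarrow> real"
  assumes v: "(\<Sum>i<n. (v i)\<^sup>2) \<le> 1"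
  shows "trace_norm (mat n n (\<lambda>(i, j). complex_of_real (v i * v j))) \<le> 1"
proof (rule trace_norm_le_if_forms_le)
  fix w assume "form_bounded {..<n} w"
  hence "\<bar>quad_form {..<n} w v\<bar> \<le> (\<Sum>i<n. (v i)\<^sup>2)" by (simp add: form_bounded_def)
  moreover have "quad_form {..<n} w v = (\<Sum>i<n. \<Sum>j<n. w i j * (v i * v j))"
    by (simp add: quad_form_def mult.assoc)
  ultimately show "(\<Sum>i<n. \<Sum>j<n. w i j * (v i * v j)) \<le> 1" using v by simp
qed simp

section \<open>Operators on subsets of the qubits\<close>

definition from_bits :: "nat \<Rightarrow> (nat \<Rightarrow> bool) \<Rightarrow> nat" where
  "from_bits n P = (\<Sum>q<n. of_bool (P q) * 2 ^ q)"

definition agree_on :: "nat set \<Rightarrow> nat \<Rightarrow> nat \<Rightarrow> bool" where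
  "agree_on S i j \<longleftrightarrow> (\<forall>q\<in>S. bit i q = bit j q)"

lemma from_bits_horner_sum: "from_bits n P = horner_sum of_bool 2 (map P [0..<n])"
  by (simp add: from_bits_def horner_sum_eq_sum atLeast0LessThan)

lemma bit_from_bits: "bit (from_bits n P) q \<longleftrightarrow> q < n \<and> P q"
  by (auto simp: from_bits_horner_sum bit_horner_sum_bit_iff)

lemma from_bits_less: "from_bits n P < 2 ^ n"
  using horner_sum_of_bool_2_less[of "map P [0..<n]"] by (simp add: from_bits_horner_sum)

lemma not_bit_if_less: "(i :: nat) < 2 ^ n \<Longrightarrow> n \<le> q \<Longrightarrow> \<not> bit i q"
  by (metis bit_take_bit_iff leD take_bit_nat_eq_self)

lemma agree_on_all_imp_eq:
  assumes "i < 2 ^ n" "j < 2 ^ n" "agree_on {..<n} i j"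
  shows "i = j"
proof (rule bit_eqI)
  fix q show "bit i q = bit j q"
    using assms not_bit_if_less[of i n q] not_bit_if_less[of j n q]
    by (cases "q < n") (auto simp: agree_on_def)
qed

lemma sub_index_from_bits: "sub_index N f i = from_bits N (\<lambda>j. bit i (f j))"
  by (simp add: sub_index_def from_bits_def)

lemma bit_sub_index: "bit (sub_index N f i) q \<longleftrightarrow> q < N \<and> bit i (f q)"
  by (simp add: sub_index_from_bits bit_from_bits)

lemma sub_index_less: "sub_index N f i < 2 ^ N"
  by (simp add: sub_index_from_bits from_bits_less)

lemma sub_index_eq_iff: "sub_index N f i = sub_index N f j \<longleftrightarrow> agree_on (f ` {..<N}) i j"
proof
  assume "sub_index N f i = sub_index N f j"
  hence "bit (sub_index N f i) q = bit (sub_index N f j) q" for q by simp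
  thus "agree_on (f ` {..<N}) i j" by (auto simp: agree_on_def bit_sub_index)
qed (auto simp: sub_index_def agree_on_def)

lemma agree_on_refl [simp]: "agree_on S i i"
  and agree_on_sym: "agree_on S i j \<Longrightarrow> agree_on S j i"
  and agree_on_trans: "agree_on S i j \<Longrightarrow> agree_on S j l \<Longrightarrow> agree_on S i l"
  and agree_on_mono: "agree_on S i j \<Longrightarrow> T \<subseteq> S \<Longrightarrow> agree_on T i j"
  and agree_on_Un: "agree_on (S \<union> T) i j \<longleftrightarrow> agree_on S i j \<and> agree_on T i j"
  by (auto simp: agree_on_def)

lemma on_qubits_carrier [simp]: "on_qubits n N f A \<in> carrier_mat (2 ^ n) (2 ^ n)"
  by (simp add: on_qubits_def)

lemma on_qubits_dims [simp]:
  "dim_row (on_qubits n N f A) = 2 ^ n" "dim_col (on_qubits n N f A) = 2 ^ n"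
  by (simp_all add: on_qubits_def)

lemma on_qubits_index:
  assumes "i < 2 ^ n" "j < 2 ^ n"
  shows "on_qubits n N f A $$ (i, j) =
    (if agree_on ({..<n} - f ` {..<N}) i j then A $$ (sub_index N f i, sub_index N f j) else 0)"
proof -
  have "(\<forall>q<n. q \<notin> f ` {..<N} \<longrightarrow> bit i q = bit j q) \<longleftrightarrow> agree_on ({..<n} - f ` {..<N}) i j"
    by (auto simp: agree_on_def)
  thus ?thesis using assms by (simp add: on_qubits_def)
qed

lemma on_qubits_cong:
  assumes "\<And>j. j < N \<Longrightarrow> f j = g j"
  shows "on_qubits n N f A = on_qubits n N g A"
proof -
  have "f ` {..<N} = g ` {..<N}" "sub_index N f = sub_index N g"
    using assms by (auto simp: sub_index_def fun_eq_iff intro!: image_cong)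
  thus ?thesis unfolding on_qubits_def by presburger
qed

text \<open>In a product of two placed operators the intermediate state agrees with \<open>i\<close>
  off the support. This bijection turns the sum over such states into the sum over all
  \<open>N\<close>-qubit states. Its inverse overwrites the supported bits of \<open>i\<close> with
  the bits of \<open>p\<close>.\<close>

lemma bij_betw_sub_index:
  assumes f: "inj_on f {..<N}" "f ` {..<N} \<subseteq> {..<n}" and i: "i < 2 ^ n"
  shows "bij_betw (sub_index N f) {t. t < 2 ^ n \<and> agree_on ({..<n} - f ` {..<N}) i t} {..<2 ^ N}"
proof (rule bij_betw_byWitness[where f' =
    "\<lambda>p. from_bits n (\<lambda>q. if q \<in> f ` {..<N} then bit p (inv_into {..<N} f q) else bit i q)"], goal_cases)
  case 1
  show ?case
  proof (intro ballI, elim CollectE conjE)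
    fix t assume t: "t < 2 ^ n" "agree_on ({..<n} - f ` {..<N}) i t"
    show "from_bits n (\<lambda>q. if q \<in> f ` {..<N} then bit (sub_index N f t) (inv_into {..<N} f q) else bit i q) = t"
    proof (rule agree_on_all_imp_eq[OF from_bits_less t(1)], unfold agree_on_def, intro ballI)
      fix q assume q: "q \<in> {..<n}"
      show "bit (from_bits n (\<lambda>q. if q \<in> f ` {..<N} then bit (sub_index N f t) (inv_into {..<N} f q)
          else bit i q)) q = bit t q"
      proof (cases "q \<in> f ` {..<N}")
        case True
        have "inv_into {..<N} f q < N" using inv_into_into[OF True] by simp
        thus ?thesis using q True f_inv_into_f[OF True] by (simp add: bit_from_bits bit_sub_index)
      next
        case False
        thus ?thesis using q t by (auto simp: bit_from_bits agree_on_def)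
      qed
    qed
  qed
next
  case 2
  show ?case
  proof
    fix p assume p: "p \<in> {..<2 ^ N :: nat}"
    show "sub_index N f (from_bits n (\<lambda>q. if q \<in> f ` {..<N} then bit p (inv_into {..<N} f q) else bit i q)) = p"
    proof (rule agree_on_all_imp_eq[OF sub_index_less], use p in simp, unfold agree_on_def, intro ballI)
      fix q assume q: "q \<in> {..<N}"
      hence "f q \<in> f ` {..<N}" "f q < n" using f by auto
      thus "bit (sub_index N f (from_bits n (\<lambda>q. if q \<in> f ` {..<N} then bit p (inv_into {..<N} f q) else bit i q))) q
          = bit p q"
        using q f(1) by (simp add: bit_from_bits bit_sub_index inv_into_f_f)
    qed
  qed
next
  case 3
  show ?case by (auto simp: sub_index_less)
next
  case 4
  show ?case by (auto simp: from_bits_less agree_on_def bit_from_bits)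
qed

lemma on_qubits_mult:
  assumes f: "inj_on f {..<N}" "f ` {..<N} \<subseteq> {..<n}"
    and A: "A \<in> carrier_mat (2 ^ N) (2 ^ N)" and B: "B \<in> carrier_mat (2 ^ N) (2 ^ N)"
  shows "on_qubits n N f (A * B) = on_qubits n N f A * on_qubits n N f B"
proof (rule eq_matI)
  fix i j assume "i < dim_row (on_qubits n N f A * on_qubits n N f B)"
    "j < dim_col (on_qubits n N f A * on_qubits n N f B)"
  hence ij: "i < 2 ^ n" "j < 2 ^ n" by simp_all
  let ?S = "{..<n} - f ` {..<N}"
  have "(on_qubits n N f A * on_qubits n N f B) $$ (i, j)
      = (\<Sum>t<2 ^ n. on_qubits n N f A $$ (i, t) * on_qubits n N f B $$ (t, j))"
    using ij by (simp add: scalar_prod_def atLeast0LessThan)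
  also have "\<dots> = (\<Sum>t<2 ^ n. if agree_on ?S i t then (if agree_on ?S i j
      then A $$ (sub_index N f i, sub_index N f t) * B $$ (sub_index N f t, sub_index N f j) else 0) else 0)"
    using ij by (intro sum.cong refl)
      (auto simp: on_qubits_index intro: agree_on_trans agree_on_sym)
  also have "\<dots> = (\<Sum>t\<in>{t \<in> {..<2 ^ n}. agree_on ?S i t}. if agree_on ?S i j
      then A $$ (sub_index N f i, sub_index N f t) * B $$ (sub_index N f t, sub_index N f j) else 0)"
    by (rule sum.inter_filter[symmetric]) simp
  also have "{t \<in> {..<2 ^ n}. agree_on ?S i t} = {t. t < 2 ^ n \<and> agree_on ?S i t}"
    by auto
  also have "(\<Sum>t\<in>\<dots>. if agree_on ?S i j
      then A $$ (sub_index N f i, sub_index N f t) * B $$ (sub_index N f t, sub_index N f j) else 0)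
    = (\<Sum>p<2 ^ N. if agree_on ?S i j
      then A $$ (sub_index N f i, p) * B $$ (p, sub_index N f j) else 0)"
    by (rule sum.reindex_bij_betw[OF bij_betw_sub_index[OF f ij(1)]])
  also have "\<dots> = (if agree_on ?S i j then (A * B) $$ (sub_index N f i, sub_index N f j) else 0)"
    using A B by (simp add: scalar_prod_def atLeast0LessThan sub_index_less)
  finally show "on_qubits n N f (A * B) $$ (i, j) = (on_qubits n N f A * on_qubits n N f B) $$ (i, j)"
    using ij by (simp add: on_qubits_index)
qed simp_all

lemma on_qubits_one:
  assumes "f ` {..<N} \<subseteq> {..<n}"
  shows "on_qubits n N f (1\<^sub>m (2 ^ N)) = 1\<^sub>m (2 ^ n)"
proof (rule eq_matI)
  fix i j assume "i < dim_row (1\<^sub>m (2 ^ n) :: complex mat)" "j < dim_col (1\<^sub>m (2 ^ n) :: complex mat)"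
  hence ij: "i < 2 ^ n" "j < 2 ^ n" by auto
  have "{..<n} = ({..<n} - f ` {..<N}) \<union> f ` {..<N}" using assms by auto
  hence "agree_on {..<n} i j \<longleftrightarrow> agree_on ({..<n} - f ` {..<N}) i j \<and> agree_on (f ` {..<N}) i j"
    by (metis agree_on_Un)
  moreover have "agree_on {..<n} i j \<longleftrightarrow> i = j" using agree_on_all_imp_eq[OF ij] by auto
  ultimately show "on_qubits n N f (1\<^sub>m (2 ^ N)) $$ (i, j) = 1\<^sub>m (2 ^ n) $$ (i, j)"
    using ij by (auto simp: on_qubits_index sub_index_less sub_index_eq_iff)
qed auto

lemma on_qubits_adjoint:
  assumes "A \<in> carrier_mat (2 ^ N) (2 ^ N)"
  shows "mat_adjoint (on_qubits n N f A) = on_qubits n N f (mat_adjoint A)"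
  using assms
  by (intro eq_matI) (auto simp: mat_adjoint_index on_qubits_index sub_index_less intro: agree_on_sym)

text \<open>The qubits on which the composed placement acts trivially split into those outside the
  image of \<open>f\<close> and those inside it that \<open>g\<close> leaves out; each of the two
  nested placements checks the agreement on one of these sets.\<close>

lemma on_qubits_comp:
  assumes f: "inj_on f {..<N}" "f ` {..<N} \<subseteq> {..<n}" and g: "g ` {..<M} \<subseteq> {..<N}"
  shows "on_qubits n N f (on_qubits N M g A) = on_qubits n M (f \<circ> g) A"
proof (rule eq_matI)
  fix i j assume "i < dim_row (on_qubits n M (f \<circ> g) A)" "j < dim_col (on_qubits n M (f \<circ> g) A)"
  hence ij: "i < 2 ^ n" "j < 2 ^ n" by simp_all
  have "sub_index M g (sub_index N f l) = sub_index M (f \<circ> g) l" for l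
    using g by (auto simp: sub_index_def[of M] bit_sub_index intro!: sum.cong)
  moreover have "agree_on ({..<N} - g ` {..<M}) (sub_index N f i) (sub_index N f j)
      \<longleftrightarrow> agree_on (f ` ({..<N} - g ` {..<M})) i j"
    by (auto simp: agree_on_def bit_sub_index)
  moreover have "{..<n} - (f \<circ> g) ` {..<M} = ({..<n} - f ` {..<N}) \<union> f ` ({..<N} - g ` {..<M})"
    using f g by (auto simp: inj_on_def)
  hence "agree_on ({..<n} - (f \<circ> g) ` {..<M}) i j
      \<longleftrightarrow> agree_on ({..<n} - f ` {..<N}) i j \<and> agree_on (f ` ({..<N} - g ` {..<M})) i j"
    by (metis agree_on_Un)
  ultimately show "on_qubits n N f (on_qubits N M g A) $$ (i, j) = on_qubits n M (f \<circ> g) A $$ (i, j)"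
    using ij by (simp add: on_qubits_index sub_index_less)
qed simp_all

text \<open>The kernel \<open>h\<close> reads global indices instead of those of a small matrix, so
  no order of the qubits in \<open>S\<close> has to be chosen. Under \<open>depends_on\<close>,
  products of operators with disjoint supports keep this form, and their kernels simply
  multiply.\<close>

definition local_op :: "nat \<Rightarrow> nat set \<Rightarrow> (nat \<Rightarrow> nat \<Rightarrow> complex) \<Rightarrow> complex mat" where
  "local_op n S h = mat (2 ^ n) (2 ^ n) (\<lambda>(i, j). if agree_on ({..<n} - S) i j then h i j else 0)"

definition depends_on :: "nat set \<Rightarrow> (nat \<Rightarrow> nat \<Rightarrow> complex) \<Rightarrow> bool" where
  "depends_on S h \<longleftrightarrow> (\<forall>i i' j j'. agree_on S i i' \<longrightarrow> agree_on S j j' \<longrightarrow> h i j = h i' j')"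

lemma on_qubits_local_op:
  "on_qubits n N f A = local_op n (f ` {..<N}) (\<lambda>i j. A $$ (sub_index N f i, sub_index N f j))"
  by (rule eq_matI) (auto simp: local_op_def on_qubits_index)

lemma depends_on_sub_index:
  "depends_on (f ` {..<N}) (\<lambda>i j. A $$ (sub_index N f i, sub_index N f j))"
  unfolding depends_on_def by (metis sub_index_eq_iff)

lemma local_op_mult:
  assumes S: "S \<subseteq> {..<n}" "depends_on S h" and T: "T \<subseteq> {..<n}" "depends_on T g" and disj: "S \<inter> T = {}"
  shows "local_op n S h * local_op n T g = local_op n (S \<union> T) (\<lambda>i j. h i j * g i j)"
proof (rule eq_matI)
  fix i j assume "i < dim_row (local_op n (S \<union> T) (\<lambda>i j. h i j * g i j))"
    "j < dim_col (local_op n (S \<union> T) (\<lambda>i j. h i j * g i j))"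
  hence ij: "i < 2 ^ n" "j < 2 ^ n" by (simp_all add: local_op_def)
  \<comment> \<open>The only intermediate state that can contribute: the first operator fixes it to
    \<open>i\<close> off \<open>S\<close>, and the second one fixes it to \<open>j\<close> off
    \<open>T\<close>, in particular on \<open>S\<close>.\<close>
  define t where "t = from_bits n (\<lambda>q. if q \<in> S then bit j q else bit i q)"
  have t: "t < 2 ^ n" by (simp add: t_def from_bits_less)
  have tj: "agree_on S t j" and ti: "agree_on ({..<n} - S) i t"
    using S by (auto simp: t_def agree_on_def bit_from_bits)
  have uniq: "s = t" if "s < 2 ^ n" "agree_on ({..<n} - S) i s" "agree_on ({..<n} - T) s j" for s
  proof (rule agree_on_all_imp_eq[OF that(1) t])
    have "bit s q = bit t q" if q: "q < n" for q
    proof (cases "q \<in> S")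
      case True
      hence "q \<in> {..<n} - T" using q disj by auto
      thus ?thesis using \<open>agree_on ({..<n} - T) s j\<close> tj True by (simp add: agree_on_def)
    next
      case False
      thus ?thesis using \<open>agree_on ({..<n} - S) i s\<close> ti q by (simp add: agree_on_def)
    qed
    thus "agree_on {..<n} s t" by (simp add: agree_on_def)
  qed
  have h: "h i t = h i j" using S(2) tj by (auto simp: depends_on_def)
  have g: "g t j = g i j"
  proof -
    have "agree_on T t i" using T(1) disj by (intro agree_on_sym[OF agree_on_mono[OF ti]]) auto
    thus ?thesis using T(2) agree_on_refl unfolding depends_on_def by blast
  qed
  have agr: "agree_on ({..<n} - T) t j \<longleftrightarrow> agree_on ({..<n} - (S \<union> T)) i j"
    using tj ti S T disj by (auto simp: agree_on_def)
  have "(local_op n S h * local_op n T g) $$ (i, j)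
      = (\<Sum>s<2 ^ n. local_op n S h $$ (i, s) * local_op n T g $$ (s, j))"
    using ij by (simp add: local_op_def scalar_prod_def atLeast0LessThan)
  also have "\<dots> = (\<Sum>s<2 ^ n. if s = t then (if agree_on ({..<n} - T) t j then h i t * g t j else 0) else 0)"
  proof (intro sum.cong refl)
    fix s assume "s \<in> {..<2 ^ n :: nat}"
    hence s: "s < 2 ^ n" by simp
    show "local_op n S h $$ (i, s) * local_op n T g $$ (s, j)
        = (if s = t then (if agree_on ({..<n} - T) t j then h i t * g t j else 0) else 0)"
    proof (cases "s = t")
      case True
      thus ?thesis using s ij ti by (simp add: local_op_def)
    next
      case False
      hence "\<not> (agree_on ({..<n} - S) i s \<and> agree_on ({..<n} - T) s j)" using uniq[OF s] by blast
      thus ?thesis using s ij False by (auto simp: local_op_def)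
    qed
  qed
  also have "\<dots> = local_op n (S \<union> T) (\<lambda>i j. h i j * g i j) $$ (i, j)"
    using t ij by (simp add: agr h g local_op_def)
  finally show "(local_op n S h * local_op n T g) $$ (i, j)
      = local_op n (S \<union> T) (\<lambda>i j. h i j * g i j) $$ (i, j)" .
qed (simp_all add: local_op_def)

lemma local_op_commute:
  assumes S: "S \<subseteq> {..<n}" "depends_on S h" and T: "T \<subseteq> {..<n}" "depends_on T g" and disj: "S \<inter> T = {}"
  shows "local_op n S h * local_op n T g = local_op n T g * local_op n S h"
proof -
  have "T \<inter> S = {}" using disj by auto
  thus ?thesis
    unfolding local_op_mult[OF S T disj] local_op_mult[OF T S \<open>T \<inter> S = {}\<close>]
    by (simp add: Un_commute mult.commute)
qed

lemma mat_prod_Nil [simp]: "mat_prod d [] = 1\<^sub>m d"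
  and mat_prod_Cons [simp]: "mat_prod d (A # As) = A * mat_prod d As"
  by (simp_all add: mat_prod_def)

lemma mat_prod_carrier [simp]: "set As \<subseteq> carrier_mat d d \<Longrightarrow> mat_prod d As \<in> carrier_mat d d"
  by (induction As) auto

lemma mat_prod_append:
  "set As \<subseteq> carrier_mat d d \<Longrightarrow> set Bs \<subseteq> carrier_mat d d \<Longrightarrow>
    mat_prod d (As @ Bs) = mat_prod d As * mat_prod d Bs"
proof (induction As)
  case Nil
  thus ?case using left_mult_one_mat[of "mat_prod d Bs" d d] by simp
next
  case (Cons A As)
  thus ?case by (simp add: assoc_mult_mat[of _ d d _ d _ d])
qed

lemma mat_prod_local_op:
  assumes "\<And>s. s \<in> set ss \<Longrightarrow> S s \<subseteq> {..<n} \<and> depends_on (S s) (h s)"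
    and "distinct ss" and "\<And>s t. s \<in> set ss \<Longrightarrow> t \<in> set ss \<Longrightarrow> s \<noteq> t \<Longrightarrow> S s \<inter> S t = {}"
  shows "mat_prod (2 ^ n) (map (\<lambda>s. local_op n (S s) (h s)) ss)
    = local_op n (\<Union>s\<in>set ss. S s) (\<lambda>i j. \<Prod>s\<in>set ss. h s i j)"
  using assms
proof (induction ss)
  case Nil
  show ?case
    by (rule eq_matI) (auto simp: local_op_def dest: agree_on_all_imp_eq)
next
  case (Cons s ss)
  have "depends_on (\<Union>s\<in>set ss. S s) (\<lambda>i j. \<Prod>s\<in>set ss. h s i j)"
    unfolding depends_on_def
  proof (intro allI impI prod.cong refl)
    fix i i' j j' t
    assume *: "agree_on (\<Union>s\<in>set ss. S s) i i'" "agree_on (\<Union>s\<in>set ss. S s) j j'" "t \<in> set ss"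
    have "agree_on (S t) i i'" "agree_on (S t) j j'"
      using * by (auto intro!: agree_on_mono[of "\<Union>s\<in>set ss. S s"])
    thus "h t i j = h t i' j'" using Cons.prems(1)[of t] * by (auto simp: depends_on_def)
  qed
  moreover have "S s \<inter> (\<Union>t\<in>set ss. S t) = {}"
  proof -
    have "S s \<inter> S t = {}" if "t \<in> set ss" for t
      using that Cons.prems(2) by (intro Cons.prems(3)) auto
    thus ?thesis by blast
  qed
  ultimately have "local_op n (S s) (h s) * local_op n (\<Union>s\<in>set ss. S s) (\<lambda>i j. \<Prod>s\<in>set ss. h s i j)
     = local_op n (S s \<union> (\<Union>s\<in>set ss. S s)) (\<lambda>i j. h s i j * (\<Prod>s\<in>set ss. h s i j))"
    using Cons.prems(1) by (intro local_op_mult) auto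
  moreover have "mat_prod (2 ^ n) (map (\<lambda>s. local_op n (S s) (h s)) ss)
    = local_op n (\<Union>s\<in>set ss. S s) (\<lambda>i j. \<Prod>s\<in>set ss. h s i j)"
  proof (rule Cons.IH)
    show "distinct ss" using Cons.prems(2) by simp
  next
    fix t assume "t \<in> set ss"
    thus "S t \<subseteq> {..<n} \<and> depends_on (S t) (h t)" by (intro Cons.prems(1)) simp
  next
    fix t u assume "t \<in> set ss" "u \<in> set ss" "t \<noteq> u"
    thus "S t \<inter> S u = {}" by (intro Cons.prems(3)) simp_all
  qed
  moreover have "s \<notin> set ss" using Cons.prems(2) by simp
  ultimately show ?case by simp
qed

section \<open>Blocks and layers on the ring\<close>

definition block_map :: "nat \<Rightarrow> nat \<Rightarrow> nat \<Rightarrow> nat \<Rightarrow> nat" where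
  "block_map m \<xi> s j = (s * \<xi> + j) mod (m * \<xi>)"

definition block_qubits :: "nat \<Rightarrow> nat \<Rightarrow> nat \<Rightarrow> nat set" where
  "block_qubits m \<xi> s = block_map m \<xi> s ` {..<2 * \<xi>}"

lemma superblock_on_qubits: "superblock m \<xi> s = on_qubits (m * \<xi>) (2 * \<xi>) (block_map m \<xi> s)"
  by (simp add: superblock_def block_map_def[abs_def])

lemma inj_on_add_mod: "inj_on (\<lambda>j. (a + j) mod n) {..<n :: nat}"
proof (rule inj_onI)
  have le: "i = j" if "i \<le> j" "j < n" "(a + i) mod n = (a + j) mod n" for i j
  proof -
    have "n dvd (a + j) - (a + i)" using that by (subst mod_eq_dvd_iff_nat[symmetric]) simp_all
    hence "n dvd j - i" by simp
    thus "i = j" using that by (metis dvd_imp_le diff_is_0_eq le_antisym less_imp_diff_less not_less zero_less_diff)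
  qed
  fix i j assume "i \<in> {..<n}" "j \<in> {..<n}" "(a + i) mod n = (a + j) mod n"
  thus "i = j" using le[of i j] le[of j i] by (cases "i \<le> j") simp_all
qed

lemma inj_on_block_map: "2 \<le> m \<Longrightarrow> inj_on (block_map m \<xi> s) {..<2 * \<xi>}"
  unfolding block_map_def[abs_def] by (rule inj_on_subset[OF inj_on_add_mod]) auto

lemma block_qubits_eq:
  assumes "\<xi> > 0" "s < m"
  shows "block_qubits m \<xi> s = {q. q < m * \<xi> \<and> q div \<xi> \<in> {s, (s + 1) mod m}}"
proof (intro equalityI subsetI)
  fix q assume "q \<in> block_qubits m \<xi> s"
  then obtain j where j: "j < 2 * \<xi>" "q = (s * \<xi> + j) mod (m * \<xi>)"
    by (auto simp: block_qubits_def block_map_def)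
  have "q = \<xi> * ((s * \<xi> + j) div \<xi> mod m) + (s * \<xi> + j) mod \<xi>"
    unfolding j(2) by (metis mod_mult2_eq mult.commute)
  hence "q div \<xi> = (s * \<xi> + j) div \<xi> mod m" using assms(1) by simp
  moreover have "(s * \<xi> + j) div \<xi> = s + j div \<xi>" using assms(1) by simp
  moreover have "j div \<xi> = 0 \<or> j div \<xi> = 1"
    using j(1) assms(1) by (metis One_nat_def less_2_cases less_mult_imp_div_less)
  ultimately have "q div \<xi> \<in> {s, (s + 1) mod m}" using assms(2) by auto
  moreover have "q < m * \<xi>" using assms j(2) by simp
  ultimately show "q \<in> {q. q < m * \<xi> \<and> q div \<xi> \<in> {s, (s + 1) mod m}}" by simp
next
  fix q assume "q \<in> {q. q < m * \<xi> \<and> q div \<xi> \<in> {s, (s + 1) mod m}}"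
  hence q: "q < m * \<xi>" "q div \<xi> = s \<or> q div \<xi> = (s + 1) mod m" by auto
  have r: "q mod \<xi> < \<xi>" using assms(1) by simp
  from q(2) show "q \<in> block_qubits m \<xi> s"
  proof
    assume "q div \<xi> = s"
    hence "s * \<xi> + q mod \<xi> = q" by (metis div_mult_mod_eq)
    hence "q = block_map m \<xi> s (q mod \<xi>)" using q(1) by (simp add: block_map_def)
    thus ?thesis using r by (auto simp: block_qubits_def)
  next
    assume d: "q div \<xi> = (s + 1) mod m"
    have "(s * \<xi> + (\<xi> + q mod \<xi>)) mod (m * \<xi>)
        = \<xi> * ((s * \<xi> + (\<xi> + q mod \<xi>)) div \<xi> mod m) + (s * \<xi> + (\<xi> + q mod \<xi>)) mod \<xi>"
      by (metis mod_mult2_eq mult.commute)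
    also have "(s * \<xi> + (\<xi> + q mod \<xi>)) div \<xi> = s + 1"
      using assms(1) by simp
    also have "(s * \<xi> + (\<xi> + q mod \<xi>)) mod \<xi> = q mod \<xi>" by simp
    also have "\<xi> * ((s + 1) mod m) + q mod \<xi> = q"
      unfolding d[symmetric] by simp
    finally have "q = block_map m \<xi> s (\<xi> + q mod \<xi>)" by (simp add: block_map_def)
    thus ?thesis using r by (auto simp: block_qubits_def)
  qed
qed

lemma block_qubits_subset: "\<xi> > 0 \<Longrightarrow> s < m \<Longrightarrow> block_qubits m \<xi> s \<subseteq> {..<m * \<xi>}"
  by (auto simp: block_qubits_eq)

text \<open>For even \<open>m\<close> the parity keeps alternating across the wrap-around from
  \<open>m - 1\<close> to 0. Disjointness and coverage of the blocks of a layer both rest on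
  this.\<close>

lemma Suc_mod_parity:
  fixes m s :: nat
  assumes "even m" "s < m"
  shows "even ((s + 1) mod m) \<longleftrightarrow> odd s"
proof (cases "s + 1 = m")
  case True
  have "(s + 1) mod m = 0" unfolding True by (rule mod_self)
  moreover have "odd s" using assms(1) True by auto
  ultimately show ?thesis by (metis even_zero)
next
  case False
  hence "(s + 1) mod m = s + 1" using assms(2) by simp
  thus ?thesis by simp
qed

lemma block_qubits_disjoint:
  assumes "even m" "\<xi> > 0" "s < m" "t < m" "s \<noteq> t" "even s = even t"
  shows "block_qubits m \<xi> s \<inter> block_qubits m \<xi> t = {}"
proof -
  have "(s + 1) mod m \<noteq> (t + 1) mod m"
    using inj_on_eq_iff[OF inj_on_add_mod[of 1 m], of s t] assms(3-5) by (simp add: add.commute)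
  moreover have "(s + 1) mod m \<noteq> t" "(t + 1) mod m \<noteq> s"
    using Suc_mod_parity[OF assms(1,3)] Suc_mod_parity[OF assms(1,4)] assms(6) by metis+
  ultimately show ?thesis
    using assms(5) unfolding block_qubits_eq[OF assms(2,3)] block_qubits_eq[OF assms(2,4)] by auto
qed

lemma UN_block_qubits:
  assumes m: "even m" "\<xi> > 0"
  shows "(\<Union>s\<in>{s. s < m \<and> even s = b}. block_qubits m \<xi> s) = {..<m * \<xi>}"
proof (intro equalityI subsetI)
  fix q assume "q \<in> {..<m * \<xi>}"
  hence q: "q < m * \<xi>" by simp
  define t where "t = q div \<xi>"
  have t: "t < m" using q by (simp add: t_def less_mult_imp_div_less)
  show "q \<in> (\<Union>s\<in>{s. s < m \<and> even s = b}. block_qubits m \<xi> s)"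
  proof (cases "even t = b")
    case True
    have "q \<in> block_qubits m \<xi> t" using block_qubits_eq[OF m(2) t] q by (simp add: t_def)
    thus ?thesis using t True by blast
  next
    case False
    \<comment> \<open>The predecessor of \<open>t\<close> on the ring; adding \<open>m - 1\<close>
      avoids the truncated subtraction at \<open>t = 0\<close>. The block \<open>s\<close> contains
      patch \<open>t\<close> as its second patch and has the other parity.\<close>
    define s where "s = (t + (m - 1)) mod m"
    have s: "s < m" using t by (simp add: s_def)
    have "(s + 1) mod m = t" using t by (simp add: s_def mod_Suc_eq)
    moreover from this have "even s = b" using Suc_mod_parity[OF m(1) s] False by auto
    moreover have "q \<in> block_qubits m \<xi> s"
      using block_qubits_eq[OF m(2) s] q \<open>(s + 1) mod m = t\<close> by (simp add: t_def)
    ultimately show ?thesis using s by blast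
  qed
next
  fix q assume "q \<in> (\<Union>s\<in>{s. s < m \<and> even s = b}. block_qubits m \<xi> s)"
  thus "q \<in> {..<m * \<xi>}" using block_qubits_subset[OF m(2)] by blast
qed

definition layer :: "nat \<Rightarrow> nat \<Rightarrow> nat list \<Rightarrow> (nat \<Rightarrow> complex mat) \<Rightarrow> complex mat" where
  "layer m \<xi> ss U = mat_prod (2 ^ (m * \<xi>)) (map (\<lambda>s. superblock m \<xi> s (U s)) ss)"

text \<open>\<open>b = True\<close> selects the first layer, \<open>b = False\<close> the second
  one. A Boolean parameter lets both layers share all lemmas.\<close>

definition layer_blocks :: "nat \<Rightarrow> bool \<Rightarrow> nat list" where
  "layer_blocks m b = filter (\<lambda>s. even s = b) [0..<m]"

lemma set_layer_blocks [simp]: "set (layer_blocks m b) = {s. s < m \<and> even s = b}"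
  and distinct_layer_blocks [simp]: "distinct (layer_blocks m b)"
  by (auto simp: layer_blocks_def)

lemma brickwork_layers:
  "brickwork m \<xi> U = layer m \<xi> (layer_blocks m False) U * layer m \<xi> (layer_blocks m True) U"
  by (simp add: brickwork_def layer_def layer_blocks_def)

lemma superblock_carrier [simp]: "superblock m \<xi> s A \<in> carrier_mat (2 ^ (m * \<xi>)) (2 ^ (m * \<xi>))"
  by (simp add: superblock_on_qubits)

lemma layer_carrier [simp]: "layer m \<xi> ss U \<in> carrier_mat (2 ^ (m * \<xi>)) (2 ^ (m * \<xi>))"
  by (auto simp: layer_def intro!: mat_prod_carrier)

lemma mat_prod_commute:
  assumes "set As \<subseteq> carrier_mat d d" "B \<in> carrier_mat d d" "\<And>A. A \<in> set As \<Longrightarrow> A * B = B * A"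
  shows "mat_prod d As * B = B * mat_prod d As"
  using assms
proof (induction As)
  case Nil
  thus ?case by simp
next
  case (Cons A As)
  have carr: "A \<in> carrier_mat d d" "mat_prod d As \<in> carrier_mat d d" using Cons.prems by auto
  have "mat_prod d (A # As) * B = A * (mat_prod d As * B)"
    using carr Cons.prems(2) by (simp add: assoc_mult_mat[of _ d d _ d _ d])
  also have "mat_prod d As * B = B * mat_prod d As" using Cons by simp
  also have "A * (B * mat_prod d As) = (A * B) * mat_prod d As"
    using carr Cons.prems(2) by (simp add: assoc_mult_mat[of _ d d _ d _ d])
  also have "A * B = B * A" by (rule Cons.prems(3)) simp
  also have "B * A * mat_prod d As = B * mat_prod d (A # As)"
    using carr Cons.prems(2) by (simp add: assoc_mult_mat[of _ d d _ d _ d])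
  finally show ?case .
qed

text \<open>In the regrouping, \<open>B s\<close> has to pass the \<open>A t\<close> of all later
  positions. Commutation is required between different positions only, so that \<open>A s\<close>
  and \<open>B s\<close> may be two arbitrary operators on the same block.\<close>

lemma mat_prod_mult_commuting:
  assumes "\<And>s. s \<in> set ss \<Longrightarrow> A s \<in> carrier_mat d d \<and> B s \<in> carrier_mat d d" "distinct ss"
    "\<And>s t. s \<in> set ss \<Longrightarrow> t \<in> set ss \<Longrightarrow> s \<noteq> t \<Longrightarrow> A s * B t = B t * A s"
  shows "mat_prod d (map (\<lambda>s. A s * B s) ss) = mat_prod d (map A ss) * mat_prod d (map B ss)"
  using assms
proof (induction ss)
  case Nil
  show ?case by simp
next
  case (Cons s ss)
  let ?P = "mat_prod d (map A ss)" and ?Q = "mat_prod d (map B ss)"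
  have carr: "A s \<in> carrier_mat d d" "B s \<in> carrier_mat d d" "?P \<in> carrier_mat d d" "?Q \<in> carrier_mat d d"
    using Cons.prems(1) by (auto intro!: mat_prod_carrier)
  have IH: "mat_prod d (map (\<lambda>s. A s * B s) ss) = ?P * ?Q"
  proof (rule Cons.IH)
    fix t u assume "t \<in> set ss" "u \<in> set ss" "t \<noteq> u"
    thus "A t * B u = B u * A t" by (intro Cons.prems(3)) simp_all
  qed (use Cons.prems in auto)
  have comm: "?P * B s = B s * ?P"
  proof (rule mat_prod_commute)
    fix X assume "X \<in> set (map A ss)"
    then obtain t where t: "t \<in> set ss" "X = A t" by auto
    moreover have "t \<noteq> s" using t(1) Cons.prems(2) by auto
    ultimately show "X * B s = B s * X" using Cons.prems(3)[of t s] by simp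
  qed (use Cons.prems(1) in auto)
  have "A s * B s * (?P * ?Q) = A s * (B s * ?P) * ?Q"
    using carr by (simp add: assoc_mult_mat[of _ d d _ d _ d])
  also have "\<dots> = A s * ?P * (B s * ?Q)"
    unfolding comm[symmetric] using carr by (simp add: assoc_mult_mat[of _ d d _ d _ d])
  finally show ?case by (simp add: IH)
qed

lemma superblock_commute:
  assumes "even m" "\<xi> > 0" "s < m" "t < m" "s \<noteq> t" "even s = even t"
  shows "superblock m \<xi> s A * superblock m \<xi> t B = superblock m \<xi> t B * superblock m \<xi> s A"
  unfolding superblock_on_qubits on_qubits_local_op
proof (rule local_op_commute)
  show "block_map m \<xi> s ` {..<2 * \<xi>} \<subseteq> {..<m * \<xi>}" "block_map m \<xi> t ` {..<2 * \<xi>} \<subseteq> {..<m * \<xi>}"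
    using block_qubits_subset assms unfolding block_qubits_def by blast+
  show "block_map m \<xi> s ` {..<2 * \<xi>} \<inter> block_map m \<xi> t ` {..<2 * \<xi>} = {}"
    using block_qubits_disjoint[OF assms] unfolding block_qubits_def .
qed (rule depends_on_sub_index)+

lemma superblock_mult:
  assumes "2 \<le> m" "\<xi> > 0" "s < m" "A \<in> carrier_mat (2 ^ (2 * \<xi>)) (2 ^ (2 * \<xi>))"
    "B \<in> carrier_mat (2 ^ (2 * \<xi>)) (2 ^ (2 * \<xi>))"
  shows "superblock m \<xi> s (A * B) = superblock m \<xi> s A * superblock m \<xi> s B"
  unfolding superblock_on_qubits
  using block_qubits_subset[OF assms(2,3)] inj_on_block_map[OF assms(1)] assms(4,5)
  unfolding block_qubits_def by (intro on_qubits_mult)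

lemma superblock_one:
  assumes "\<xi> > 0" "s < m"
  shows "superblock m \<xi> s (1\<^sub>m (2 ^ (2 * \<xi>))) = 1\<^sub>m (2 ^ (m * \<xi>))"
  unfolding superblock_on_qubits
  using block_qubits_subset[OF assms] unfolding block_qubits_def by (rule on_qubits_one)

lemma even_pos_ge_2: "even (m :: nat) \<Longrightarrow> s < m \<Longrightarrow> 2 \<le> m"
  by presburger

text \<open>Operators on different blocks of a layer commute, so a layer of products is a product of
  layers. For the depth this means that the time slices of all blocks of a layer can run in
  parallel.\<close>

lemma layer_mult:
  assumes m: "even m" "\<xi> > 0"
    and U: "\<And>s. s < m \<Longrightarrow> even s = b \<Longrightarrow> U s \<in> carrier_mat (2 ^ (2 * \<xi>)) (2 ^ (2 * \<xi>))"
    and V: "\<And>s. s < m \<Longrightarrow> even s = b \<Longrightarrow> V s \<in> carrier_mat (2 ^ (2 * \<xi>)) (2 ^ (2 * \<xi>))"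
  shows "layer m \<xi> (layer_blocks m b) (\<lambda>s. U s * V s)
    = layer m \<xi> (layer_blocks m b) U * layer m \<xi> (layer_blocks m b) V"
proof -
  have *: "map (\<lambda>s. superblock m \<xi> s (U s * V s)) (layer_blocks m b)
      = map (\<lambda>s. superblock m \<xi> s (U s) * superblock m \<xi> s (V s)) (layer_blocks m b)"
  proof (intro map_cong refl superblock_mult m)
    fix s assume "s \<in> set (layer_blocks m b)"
    hence s: "s < m" "even s = b" by simp_all
    show "2 \<le> m" by (rule even_pos_ge_2[OF m(1) s(1)])
    show "s < m" by (rule s)
    show "U s \<in> carrier_mat (2 ^ (2 * \<xi>)) (2 ^ (2 * \<xi>))" by (rule U[OF s])
    show "V s \<in> carrier_mat (2 ^ (2 * \<xi>)) (2 ^ (2 * \<xi>))" by (rule V[OF s])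
  qed
  show ?thesis
    unfolding layer_def * by (rule mat_prod_mult_commuting) (simp_all add: superblock_commute[OF m])
qed

text \<open>The blocks of one layer cover the ring, so the condition that \<open>i\<close> and
  \<open>j\<close> agree off the supports is empty, and the entry is a plain product over the
  blocks.\<close>

lemma layer_index:
  assumes m: "even m" "\<xi> > 0" and ij: "i < 2 ^ (m * \<xi>)" "j < 2 ^ (m * \<xi>)"
  shows "layer m \<xi> (layer_blocks m b) U $$ (i, j) = (\<Prod>s | s < m \<and> even s = b.
    U s $$ (sub_index (2 * \<xi>) (block_map m \<xi> s) i, sub_index (2 * \<xi>) (block_map m \<xi> s) j))"
proof -
  have "layer m \<xi> (layer_blocks m b) U = local_op (m * \<xi>) (\<Union>s\<in>set (layer_blocks m b). block_qubits m \<xi> s)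
    (\<lambda>i j. \<Prod>s\<in>set (layer_blocks m b). U s $$ (sub_index (2 * \<xi>) (block_map m \<xi> s) i, sub_index (2 * \<xi>) (block_map m \<xi> s) j))"
    unfolding layer_def superblock_on_qubits on_qubits_local_op block_qubits_def
  proof (rule mat_prod_local_op)
    fix s assume "s \<in> set (layer_blocks m b)"
    thus "block_map m \<xi> s ` {..<2 * \<xi>} \<subseteq> {..<m * \<xi>} \<and> depends_on (block_map m \<xi> s ` {..<2 * \<xi>})
      (\<lambda>i j. U s $$ (sub_index (2 * \<xi>) (block_map m \<xi> s) i, sub_index (2 * \<xi>) (block_map m \<xi> s) j))"
      using block_qubits_subset[OF m(2), of s] depends_on_sub_index by (simp add: block_qubits_def)
  next
    fix s t assume "s \<in> set (layer_blocks m b)" "t \<in> set (layer_blocks m b)" "s \<noteq> t"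
    thus "block_map m \<xi> s ` {..<2 * \<xi>} \<inter> block_map m \<xi> t ` {..<2 * \<xi>} = {}"
      using block_qubits_disjoint[OF m, of s t] by (simp add: block_qubits_def)
  qed simp
  thus ?thesis using ij UN_block_qubits[OF m, of b] by (simp add: local_op_def agree_on_def)
qed

section \<open>Circuit depth\<close>

lemma superblock_mat_prod:
  assumes m: "2 \<le> m" "\<xi> > 0" "s < m" and As: "set As \<subseteq> carrier_mat (2 ^ (2 * \<xi>)) (2 ^ (2 * \<xi>))"
  shows "superblock m \<xi> s (mat_prod (2 ^ (2 * \<xi>)) As) = mat_prod (2 ^ (m * \<xi>)) (map (superblock m \<xi> s) As)"
  using As
proof (induction As)
  case Nil
  thus ?case using superblock_one[OF m(2,3)] by simp
next
  case (Cons A As)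
  hence "A \<in> carrier_mat (2 ^ (2 * \<xi>)) (2 ^ (2 * \<xi>))"
    "mat_prod (2 ^ (2 * \<xi>)) As \<in> carrier_mat (2 ^ (2 * \<xi>)) (2 ^ (2 * \<xi>))"
    by (auto intro!: mat_prod_carrier)
  thus ?case using Cons superblock_mult[OF m] by simp
qed

lemma mat_prod_concat:
  assumes "\<And>As. As \<in> set Ass \<Longrightarrow> set As \<subseteq> carrier_mat d d"
  shows "mat_prod d (concat Ass) = mat_prod d (map (mat_prod d) Ass)"
  using assms
proof (induction Ass)
  case Nil
  show ?case by simp
next
  case (Cons As Ass)
  have "set (concat Ass) \<subseteq> carrier_mat d d" using Cons.prems by fastforce
  thus ?case using Cons by (simp add: mat_prod_append)
qed

lemma gate_layer_carrier: "gate_layer n S L \<Longrightarrow> L \<in> carrier_mat (2 ^ n) (2 ^ n)"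
  unfolding gate_layer_def by (auto intro!: mat_prod_carrier)

lemma gate_layer_one: "gate_layer n S (1\<^sub>m (2 ^ n))"
  unfolding gate_layer_def by (rule exI[of _ "[]"]) simp

lemma distinct_concat_map_inj:
  assumes "distinct ss" "\<And>s. s \<in> set ss \<Longrightarrow> distinct (c s)" "\<And>s. s \<in> set ss \<Longrightarrow> inj_on (f s) (set (c s))"
    and "\<And>s t. s \<in> set ss \<Longrightarrow> t \<in> set ss \<Longrightarrow> s \<noteq> t \<Longrightarrow> f s ` set (c s) \<inter> f t ` set (c t) = {}"
  shows "distinct (concat (map (\<lambda>s. map (f s) (c s)) ss))"
  using assms
proof (induction ss)
  case Nil
  show ?case by simp
next
  case (Cons s ss)
  have "distinct (concat (map (\<lambda>s. map (f s) (c s)) ss))"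
  proof (rule Cons.IH)
    fix t u assume "t \<in> set ss" "u \<in> set ss" "t \<noteq> u"
    thus "f t ` set (c t) \<inter> f u ` set (c u) = {}" by (intro Cons.prems(4)) simp_all
  qed (use Cons.prems in auto)
  moreover have "f s ` set (c s) \<inter> f t ` set (c t) = {}" if "t \<in> set ss" for t
    using that Cons.prems(1) by (intro Cons.prems(4)) auto
  moreover have "distinct (map (f s) (c s))"
    using Cons.prems(2)[of s] Cons.prems(3)[of s] by (simp add: distinct_map)
  ultimately show ?case by auto
qed

lemma block_map_Suc: "(block_map m \<xi> s q + 1) mod (m * \<xi>) = block_map m \<xi> s (q + 1)"
  by (simp add: block_map_def mod_Suc_eq)

text \<open>A gate on an open line has \<open>q + 1 < 2 * \<xi>\<close>, so it never wraps around
  inside the block, and its two qubits are neighbours on the ring. The block itself may wrap around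
  the ring.\<close>

lemma superblock_gate:
  assumes m: "2 \<le> m" "\<xi> > 0" "s < m" and q: "q + 1 < 2 * \<xi>"
  shows "superblock m \<xi> s (on_qubits (2 * \<xi>) 2 (\<lambda>j. (q + j) mod (2 * \<xi>)) g)
    = on_qubits (m * \<xi>) 2 (\<lambda>j. (block_map m \<xi> s q + j) mod (m * \<xi>)) g"
proof -
  have "superblock m \<xi> s (on_qubits (2 * \<xi>) 2 (\<lambda>j. (q + j) mod (2 * \<xi>)) g)
      = on_qubits (m * \<xi>) 2 (block_map m \<xi> s \<circ> (\<lambda>j. (q + j) mod (2 * \<xi>))) g"
    unfolding superblock_on_qubits
  proof (rule on_qubits_comp)
    show "(\<lambda>j. (q + j) mod (2 * \<xi>)) ` {..<2} \<subseteq> {..<2 * \<xi>}"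
      using m(2) by (intro image_subsetI) simp
  qed (use block_qubits_subset[OF m(2,3)] inj_on_block_map[OF m(1)] in \<open>simp_all add: block_qubits_def\<close>)
  also have "\<dots> = on_qubits (m * \<xi>) 2 (\<lambda>j. (block_map m \<xi> s q + j) mod (m * \<xi>)) g"
  proof (rule on_qubits_cong)
    fix j :: nat assume "j < 2"
    hence "(q + j) mod (2 * \<xi>) = q + j" using q by auto
    thus "(block_map m \<xi> s \<circ> (\<lambda>j. (q + j) mod (2 * \<xi>))) j = (block_map m \<xi> s q + j) mod (m * \<xi>)"
      by (simp add: block_map_def mod_add_left_eq add.assoc)
  qed
  finally show ?thesis .
qed

text \<open>One gate layer in every block gives a single gate layer on the ring. The gates stay
  disjoint: inside a block because \<open>block_map\<close> is injective, across blocks because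
  blocks of equal parity share no qubit.\<close>

lemma layer_of_gate_layers:
  assumes m: "even m" "\<xi> > 0"
    and L: "\<And>s. s < m \<Longrightarrow> even s = b \<Longrightarrow> gate_layer (2 * \<xi>) {q. q + 1 < 2 * \<xi>} (L s)"
  shows "gate_layer (m * \<xi>) {..<m * \<xi>} (layer m \<xi> (layer_blocks m b) L)"
proof -
  define gate where "gate n = (\<lambda>(q, g). on_qubits n 2 (\<lambda>j. (q + j) mod n) g)" for n
  define qubits where "qubits n = (\<lambda>(q, g :: complex mat). [q, (q + 1) mod n])" for n :: nat
  have ex: "\<exists>gs. s < m \<and> even s = b \<longrightarrow> (\<forall>(q, g)\<in>set gs. q + 1 < 2 * \<xi> \<and> g \<in> unitary_group 4) \<and>
      distinct (concat (map (qubits (2 * \<xi>)) gs)) \<and> L s = mat_prod (2 ^ (2 * \<xi>)) (map (gate (2 * \<xi>)) gs)" for s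
  proof (cases "s < m \<and> even s = b")
    case True
    hence "gate_layer (2 * \<xi>) {q. q + 1 < 2 * \<xi>} (L s)" using L by simp
    thus ?thesis unfolding gate_layer_def gate_def qubits_def mem_Collect_eq by (rule ex_forward) simp
  next
    case False
    thus ?thesis by blast
  qed
  obtain gs where *: "\<forall>s. s < m \<and> even s = b \<longrightarrow> (\<forall>(q, g)\<in>set (gs s). q + 1 < 2 * \<xi> \<and> g \<in> unitary_group 4) \<and>
      distinct (concat (map (qubits (2 * \<xi>)) (gs s))) \<and> L s = mat_prod (2 ^ (2 * \<xi>)) (map (gate (2 * \<xi>)) (gs s))"
    using choice[of "\<lambda>s gs. s < m \<and> even s = b \<longrightarrow> (\<forall>(q, g)\<in>set gs. q + 1 < 2 * \<xi> \<and> g \<in> unitary_group 4) \<and>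
      distinct (concat (map (qubits (2 * \<xi>)) gs)) \<and> L s = mat_prod (2 ^ (2 * \<xi>)) (map (gate (2 * \<xi>)) gs)", OF allI[OF ex]]
    by (elim exE)
  have gs: "q + 1 < 2 * \<xi> \<and> g \<in> unitary_group 4" if "s < m" "even s = b" "(q, g) \<in> set (gs s)" for s q g
    using *[rule_format, of s] that by blast
  have dist: "distinct (concat (map (qubits (2 * \<xi>)) (gs s)))"
    and prod: "L s = mat_prod (2 ^ (2 * \<xi>)) (map (gate (2 * \<xi>)) (gs s))" if "s < m" "even s = b" for s
    using *[rule_format, of s] that by blast+
  define shift where "shift s = (\<lambda>(q, g :: complex mat). (block_map m \<xi> s q, g))" for s
  define hs where "hs = concat (map (\<lambda>s. map (shift s) (gs s)) (layer_blocks m b))"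
  have gate_carrier: "gate n x \<in> carrier_mat (2 ^ n) (2 ^ n)" for n x
    by (simp add: gate_def split: prod.split)
  have small: "block_map m \<xi> s q < m * \<xi>" if "s < m" for s q
    using that m by (simp add: block_map_def)
  have "\<forall>(q, g)\<in>set hs. q \<in> {..<m * \<xi>} \<and> g \<in> unitary_group 4"
    unfolding hs_def shift_def using gs small by fastforce
  moreover have "distinct (concat (map (qubits (m * \<xi>)) hs))"
  proof -
    have step: "map (qubits (m * \<xi>) \<circ> shift s) (gs s) = map (map (block_map m \<xi> s) \<circ> qubits (2 * \<xi>)) (gs s)"
      if s: "s < m" "even s = b" for s
    proof (rule map_cong[OF refl])
      fix x assume "x \<in> set (gs s)"
      then obtain q g where qg: "(q, g) \<in> set (gs s)" "x = (q, g)" by (metis surj_pair)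
      hence x: "x = (q, g)" "q + 1 < 2 * \<xi>" using gs[OF s qg(1)] by simp_all
      show "(qubits (m * \<xi>) \<circ> shift s) x = (map (block_map m \<xi> s) \<circ> qubits (2 * \<xi>)) x"
          using block_map_Suc[of m \<xi> s q] x by (simp add: qubits_def shift_def)
    qed
    have block: "concat (map (qubits (m * \<xi>)) (map (shift s) (gs s)))
        = map (block_map m \<xi> s) (concat (map (qubits (2 * \<xi>)) (gs s)))" if "s < m" "even s = b" for s
      using arg_cong[OF step[OF that], of concat] by (simp add: map_concat)
    have "concat (map (qubits (m * \<xi>)) (concat (map (\<lambda>s. map (shift s) (gs s)) ss)))
        = concat (map (\<lambda>s. map (block_map m \<xi> s) (concat (map (qubits (2 * \<xi>)) (gs s)))) ss)"
      if "\<forall>s\<in>set ss. s < m \<and> even s = b" for ss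
      using that
    proof (induction ss)
      case (Cons s ss)
      thus ?case using block[of s] by (simp del: map_map)
    qed simp
    hence "concat (map (qubits (m * \<xi>)) hs)
        = concat (map (\<lambda>s. map (block_map m \<xi> s) (concat (map (qubits (2 * \<xi>)) (gs s)))) (layer_blocks m b))"
      unfolding hs_def by simp
    moreover have sub: "set (concat (map (qubits (2 * \<xi>)) (gs s))) \<subseteq> {..<2 * \<xi>}" if s: "s < m" "even s = b" for s
    proof
      fix y assume "y \<in> set (concat (map (qubits (2 * \<xi>)) (gs s)))"
      then obtain q g where "(q, g) \<in> set (gs s)" "y = q \<or> y = (q + 1) mod (2 * \<xi>)"
        by (auto simp: qubits_def)
      thus "y \<in> {..<2 * \<xi>}" using gs[OF s, of q g] by auto
    qed
    have "distinct (concat (map (\<lambda>s. map (block_map m \<xi> s) (concat (map (qubits (2 * \<xi>)) (gs s)))) (layer_blocks m b)))"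
    proof (rule distinct_concat_map_inj)
      fix s assume "s \<in> set (layer_blocks m b)"
      hence s: "s < m" "even s = b" by simp_all
      show "distinct (concat (map (qubits (2 * \<xi>)) (gs s)))" by (rule dist[OF s])
      show "inj_on (block_map m \<xi> s) (set (concat (map (qubits (2 * \<xi>)) (gs s))))"
        by (rule inj_on_subset[OF inj_on_block_map[OF even_pos_ge_2[OF m(1) s(1)]] sub[OF s]])
    next
      fix s t assume "s \<in> set (layer_blocks m b)" "t \<in> set (layer_blocks m b)" and neq: "s \<noteq> t"
      hence s: "s < m" "even s = b" and t: "t < m" "even t = b" by simp_all
      have "block_qubits m \<xi> s \<inter> block_qubits m \<xi> t = {}"
        by (rule block_qubits_disjoint[OF m s(1) t(1) neq]) (simp add: s t)
      moreover have "block_map m \<xi> s ` set (concat (map (qubits (2 * \<xi>)) (gs s))) \<subseteq> block_qubits m \<xi> s"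
        unfolding block_qubits_def by (rule image_mono[OF sub[OF s]])
      moreover have "block_map m \<xi> t ` set (concat (map (qubits (2 * \<xi>)) (gs t))) \<subseteq> block_qubits m \<xi> t"
        unfolding block_qubits_def by (rule image_mono[OF sub[OF t]])
      ultimately show "block_map m \<xi> s ` set (concat (map (qubits (2 * \<xi>)) (gs s)))
          \<inter> block_map m \<xi> t ` set (concat (map (qubits (2 * \<xi>)) (gs t))) = {}" by blast
    qed simp
    ultimately show ?thesis by simp
  qed
  moreover have "layer m \<xi> (layer_blocks m b) L = mat_prod (2 ^ (m * \<xi>)) (map (gate (m * \<xi>)) hs)"
  proof -
    have "superblock m \<xi> s (L s) = mat_prod (2 ^ (m * \<xi>)) (map (gate (m * \<xi>)) (map (shift s) (gs s)))"
      if "s \<in> set (layer_blocks m b)" for s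
    proof -
      have s: "s < m" "even s = b" using that by simp_all
      have m2: "2 \<le> m" by (rule even_pos_ge_2[OF m(1) s(1)])
      have "superblock m \<xi> s (L s) = mat_prod (2 ^ (m * \<xi>)) (map (superblock m \<xi> s) (map (gate (2 * \<xi>)) (gs s)))"
        unfolding prod[OF s] by (rule superblock_mat_prod[OF m2 m(2) s(1)]) (auto simp: gate_carrier)
      also have "map (superblock m \<xi> s) (map (gate (2 * \<xi>)) (gs s)) = map (gate (m * \<xi>)) (map (shift s) (gs s))"
        unfolding map_map
      proof (rule map_cong[OF refl])
        fix x assume "x \<in> set (gs s)"
        then obtain q g where qg: "(q, g) \<in> set (gs s)" "x = (q, g)" by (metis surj_pair)
        hence x: "x = (q, g)" "q + 1 < 2 * \<xi>" using gs[OF s qg(1)] by simp_all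
        show "(superblock m \<xi> s \<circ> gate (2 * \<xi>)) x = (gate (m * \<xi>) \<circ> shift s) x"
          using superblock_gate[OF m2 m(2) s(1) x(2)] unfolding x(1) by (simp add: gate_def shift_def)
      qed
      finally show ?thesis .
    qed
    hence "layer m \<xi> (layer_blocks m b) L = mat_prod (2 ^ (m * \<xi>))
        (map (mat_prod (2 ^ (m * \<xi>))) (map (\<lambda>s. map (gate (m * \<xi>)) (map (shift s) (gs s))) (layer_blocks m b)))"
      unfolding layer_def map_map comp_def by (intro arg_cong[of _ _ "mat_prod _"] map_cong refl) simp
    also have "\<dots> = mat_prod (2 ^ (m * \<xi>)) (concat (map (\<lambda>s. map (gate (m * \<xi>)) (map (shift s) (gs s))) (layer_blocks m b)))"
      by (rule mat_prod_concat[symmetric]) (auto simp: gate_carrier)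
    also have "concat (map (\<lambda>s. map (gate (m * \<xi>)) (map (shift s) (gs s))) (layer_blocks m b)) = map (gate (m * \<xi>)) hs"
      by (simp add: hs_def map_concat comp_def)
    finally show ?thesis .
  qed
  ultimately show ?thesis
    unfolding gate_layer_def gate_def qubits_def by blast
qed

text \<open>The induction peels the first gate layer off all blocks simultaneously, so the circuits
  of all blocks must have exactly the same length.\<close>

lemma layer_depth:
  assumes m: "even m" "\<xi> > 0"
  shows "(\<And>s. s < m \<Longrightarrow> even s = b \<Longrightarrow> length (Ls s) = d \<and>
      (\<forall>L\<in>set (Ls s). gate_layer (2 * \<xi>) {q. q + 1 < 2 * \<xi>} L) \<and> U s = mat_prod (2 ^ (2 * \<xi>)) (Ls s)) \<Longrightarrow>
    \<exists>Ks. length Ks = d \<and> (\<forall>K\<in>set Ks. gate_layer (m * \<xi>) {..<m * \<xi>} K) \<and>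
      layer m \<xi> (layer_blocks m b) U = mat_prod (2 ^ (m * \<xi>)) Ks"
proof (induction d arbitrary: Ls U)
  case 0
  have "superblock m \<xi> s (U s) = 1\<^sub>m (2 ^ (m * \<xi>))" if "s \<in> set (layer_blocks m b)" for s
    using that 0[of s] superblock_one[OF m(2), of s m] by simp
  hence "layer m \<xi> (layer_blocks m b) U = mat_prod (2 ^ (m * \<xi>)) (map (\<lambda>s. 1\<^sub>m (2 ^ (m * \<xi>))) (layer_blocks m b))"
    unfolding layer_def by (intro arg_cong[of _ _ "mat_prod _"] map_cong refl)
  also have "mat_prod (2 ^ (m * \<xi>)) (map (\<lambda>s. 1\<^sub>m (2 ^ (m * \<xi>))) ss) = 1\<^sub>m (2 ^ (m * \<xi>))" for ss :: "nat list"
    by (induction ss) auto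
  finally show ?case by (intro exI[of _ "[]"]) simp
next
  case (Suc d)
  define L where "L s = hd (Ls s)" for s
  define V where "V s = mat_prod (2 ^ (2 * \<xi>)) (tl (Ls s))" for s
  have *: "Ls s = L s # tl (Ls s)" "gate_layer (2 * \<xi>) {q. q + 1 < 2 * \<xi>} (L s)"
    "\<forall>L\<in>set (tl (Ls s)). gate_layer (2 * \<xi>) {q. q + 1 < 2 * \<xi>} L" "length (tl (Ls s)) = d"
    "U s = L s * V s" if s: "s < m" "even s = b" for s
  proof -
    obtain A As where A: "Ls s = A # As" using Suc.prems[OF s] by (cases "Ls s") auto
    thus "Ls s = L s # tl (Ls s)" "gate_layer (2 * \<xi>) {q. q + 1 < 2 * \<xi>} (L s)"
      "\<forall>L\<in>set (tl (Ls s)). gate_layer (2 * \<xi>) {q. q + 1 < 2 * \<xi>} L" "length (tl (Ls s)) = d"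
      "U s = L s * V s"
      using Suc.prems[OF s] by (simp_all add: L_def V_def)
  qed
  have "\<exists>Ks. length Ks = d \<and> (\<forall>K\<in>set Ks. gate_layer (m * \<xi>) {..<m * \<xi>} K) \<and>
      layer m \<xi> (layer_blocks m b) V = mat_prod (2 ^ (m * \<xi>)) Ks"
  proof (rule Suc.IH)
    fix s assume s: "s < m" "even s = b"
    show "length (tl (Ls s)) = d \<and> (\<forall>L\<in>set (tl (Ls s)). gate_layer (2 * \<xi>) {q. q + 1 < 2 * \<xi>} L) \<and>
        V s = mat_prod (2 ^ (2 * \<xi>)) (tl (Ls s))"
      using *(3,4)[OF s] by (simp add: V_def)
  qed
  then obtain Ks where Ks: "length Ks = d" "\<forall>K\<in>set Ks. gate_layer (m * \<xi>) {..<m * \<xi>} K"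
    "layer m \<xi> (layer_blocks m b) V = mat_prod (2 ^ (m * \<xi>)) Ks" by blast
  have "layer m \<xi> (layer_blocks m b) U = layer m \<xi> (layer_blocks m b) (\<lambda>s. L s * V s)"
    unfolding layer_def by (intro arg_cong[of _ _ "mat_prod _"] map_cong refl) (simp add: *(5))
  also have "\<dots> = layer m \<xi> (layer_blocks m b) L * layer m \<xi> (layer_blocks m b) V"
  proof (rule layer_mult[OF m])
    fix s assume s: "s < m" "even s = b"
    show "L s \<in> carrier_mat (2 ^ (2 * \<xi>)) (2 ^ (2 * \<xi>))"
      by (rule gate_layer_carrier[OF *(2)[OF s]])
    show "V s \<in> carrier_mat (2 ^ (2 * \<xi>)) (2 ^ (2 * \<xi>))"
      unfolding V_def using *(3)[OF s] gate_layer_carrier by (intro mat_prod_carrier subsetI) blast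
  qed
  finally have "layer m \<xi> (layer_blocks m b) U
      = mat_prod (2 ^ (m * \<xi>)) (layer m \<xi> (layer_blocks m b) L # Ks)"
    using Ks(3) by simp
  moreover have "gate_layer (m * \<xi>) {..<m * \<xi>} (layer m \<xi> (layer_blocks m b) L)"
    by (rule layer_of_gate_layers[OF m *(2)])
  ultimately show ?case
    using Ks by (intro exI[of _ "layer m \<xi> (layer_blocks m b) L # Ks"]) auto
qed

text \<open>\<open>local_circuit\<close> only bounds the depth. Padding with empty gate layers,
  which are identities, gives all blocks the common length that \<open>layer_depth\<close>
  requires.\<close>

lemma line_circuit_exact_length:
  assumes "line_circuit n d U"
  shows "\<exists>Ls. length Ls = d \<and> (\<forall>L\<in>set Ls. gate_layer n {q. q + 1 < n} L) \<and> U = mat_prod (2 ^ n) Ls"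
proof -
  obtain Ls where Ls: "length Ls \<le> d" "\<forall>L\<in>set Ls. gate_layer n {q. q + 1 < n} L" "U = mat_prod (2 ^ n) Ls"
    using assms unfolding line_circuit_def local_circuit_def by blast
  define Ks where "Ks = Ls @ replicate (d - length Ls) (1\<^sub>m (2 ^ n))"
  have "mat_prod (2 ^ n) (replicate l (1\<^sub>m (2 ^ n))) = 1\<^sub>m (2 ^ n)" for l
    by (induction l) auto
  moreover have carr: "set Ls \<subseteq> carrier_mat (2 ^ n) (2 ^ n)"
    using Ls(2) gate_layer_carrier by blast
  ultimately have "mat_prod (2 ^ n) Ks = U"
    unfolding Ks_def Ls(3)
    by (subst mat_prod_append) (auto intro: right_mult_one_mat[OF mat_prod_carrier[OF carr]])
  moreover have "\<forall>L\<in>set Ks. gate_layer n {q. q + 1 < n} L"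
    using Ls(2) gate_layer_one by (auto simp: Ks_def)
  moreover have "length Ks = d" using Ls(1) by (simp add: Ks_def)
  ultimately show ?thesis by blast
qed

lemma brickwork_depth:
  assumes m: "even m" "\<xi> > 0" and U: "\<And>s. s < m \<Longrightarrow> line_circuit (2 * \<xi>) d (U s)"
  shows "ring_circuit (m * \<xi>) (2 * d) (brickwork m \<xi> U)"
proof -
  define Ls where "Ls s = (SOME Ls. length Ls = d \<and> (\<forall>L\<in>set Ls. gate_layer (2 * \<xi>) {q. q + 1 < 2 * \<xi>} L) \<and>
      U s = mat_prod (2 ^ (2 * \<xi>)) Ls)" for s
  have Ls: "length (Ls s) = d \<and> (\<forall>L\<in>set (Ls s). gate_layer (2 * \<xi>) {q. q + 1 < 2 * \<xi>} L) \<and>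
      U s = mat_prod (2 ^ (2 * \<xi>)) (Ls s)" if "s < m" for s
    unfolding Ls_def by (rule someI_ex[OF line_circuit_exact_length[OF U[OF that]]])
  have "\<exists>Ks. length Ks = d \<and> (\<forall>K\<in>set Ks. gate_layer (m * \<xi>) {..<m * \<xi>} K) \<and>
      layer m \<xi> (layer_blocks m b) U = mat_prod (2 ^ (m * \<xi>)) Ks" for b
    by (rule layer_depth[OF m, where Ls = Ls]) (rule Ls)
  from this[of False] this[of True] obtain K1 K2 where
    K1: "length K1 = d" "\<forall>K\<in>set K1. gate_layer (m * \<xi>) {..<m * \<xi>} K"
      "layer m \<xi> (layer_blocks m False) U = mat_prod (2 ^ (m * \<xi>)) K1" and
    K2: "length K2 = d" "\<forall>K\<in>set K2. gate_layer (m * \<xi>) {..<m * \<xi>} K"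
      "layer m \<xi> (layer_blocks m True) U = mat_prod (2 ^ (m * \<xi>)) K2" by blast
  have "set K1 \<subseteq> carrier_mat (2 ^ (m * \<xi>)) (2 ^ (m * \<xi>))" "set K2 \<subseteq> carrier_mat (2 ^ (m * \<xi>)) (2 ^ (m * \<xi>))"
    using K1 K2 gate_layer_carrier by blast+
  hence "brickwork m \<xi> U = mat_prod (2 ^ (m * \<xi>)) (K1 @ K2)"
    by (simp add: brickwork_layers K1 K2 mat_prod_append)
  thus ?thesis
    unfolding ring_circuit_def local_circuit_def using K1 K2
    by (intro exI[of _ "K1 @ K2"]) auto
qed

section \<open>Tensor powers of real vectors\<close>

text \<open>The basis of the \<open>k\<close>-fold tensor power is kept as a set of extensional
  functions, on which sums of products factorize over the \<open>k\<close> positions.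
  \<open>digits\<close> later translates to the numbering used by
  \<open>tensor_power\<close>.\<close>

definition copies :: "nat \<Rightarrow> nat \<Rightarrow> (nat \<Rightarrow> nat) set" where
  "copies k N = {..<k} \<rightarrow>\<^sub>E {..<N}"

definition tensor_vec :: "nat \<Rightarrow> (nat \<Rightarrow> real) \<Rightarrow> (nat \<Rightarrow> nat) \<Rightarrow> real" where
  "tensor_vec k \<psi> x = (\<Prod>l<k. \<psi> (x l))"

definition tensor_op :: "nat \<Rightarrow> (nat \<Rightarrow> nat \<Rightarrow> real) \<Rightarrow> (nat \<Rightarrow> nat) \<Rightarrow> (nat \<Rightarrow> nat) \<Rightarrow> real" where
  "tensor_op k A x y = (\<Prod>l<k. A (x l) (y l))"

definition apply_op :: "nat \<Rightarrow> nat \<Rightarrow> (nat \<Rightarrow> nat \<Rightarrow> real) \<Rightarrow> ((nat \<Rightarrow> nat) \<Rightarrow> real) \<Rightarrow> (nat \<Rightarrow> nat) \<Rightarrow> real" where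
  "apply_op k N A v x = (\<Sum>y\<in>copies k N. tensor_op k A x y * v y)"

text \<open>The matrix \<open>T^T w T\<close>, where \<open>T\<close> is the \<open>k\<close>-th
  tensor power of \<open>A\<close>: the observable \<open>w\<close> pulled back through
  \<open>A\<close>.\<close>

definition conj_form :: "nat \<Rightarrow> nat \<Rightarrow> (nat \<Rightarrow> nat \<Rightarrow> real) \<Rightarrow> ((nat \<Rightarrow> nat) \<Rightarrow> (nat \<Rightarrow> nat) \<Rightarrow> real) \<Rightarrow>
    (nat \<Rightarrow> nat) \<Rightarrow> (nat \<Rightarrow> nat) \<Rightarrow> real" where
  "conj_form k N A w p q = (\<Sum>x\<in>copies k N. \<Sum>y\<in>copies k N. w x y * tensor_op k A x p * tensor_op k A y q)"

lemma finite_copies [simp]: "finite (copies k N)"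
  by (simp add: copies_def finite_PiE)

lemma copies_less: "x \<in> copies k N \<Longrightarrow> l < k \<Longrightarrow> x l < N"
  by (auto simp: copies_def)

lemma copies_eqI: "x \<in> copies k N \<Longrightarrow> y \<in> copies k N \<Longrightarrow> (\<And>l. l < k \<Longrightarrow> x l = y l) \<Longrightarrow> x = y"
  unfolding copies_def by (rule PiE_ext) auto

lemma card_copies: "card (copies k N) = N ^ k"
  by (simp add: copies_def card_PiE)

lemma sum_copies_prod:
  fixes f :: "nat \<Rightarrow> nat \<Rightarrow> 'a :: comm_semiring_1"
  shows "(\<Sum>x\<in>copies k N. \<Prod>l<k. f l (x l)) = (\<Prod>l<k. \<Sum>i<N. f l i)"
  unfolding copies_def by (rule prod_sum_PiE[symmetric]) auto

lemma sum_tensor_vec_square: "(\<Sum>x\<in>copies k N. (tensor_vec k \<psi> x)\<^sup>2) = (\<Sum>i<N. (\<psi> i)\<^sup>2) ^ k"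
  unfolding tensor_vec_def prod_power_distrib
  by (subst sum_copies_prod[of "\<lambda>_ i. (\<psi> i)\<^sup>2"]) simp

lemma apply_op_tensor_vec:
  "apply_op k N A (tensor_vec k \<psi>) x = tensor_vec k (\<lambda>i. \<Sum>j<N. A i j * \<psi> j) x"
  unfolding apply_op_def tensor_op_def tensor_vec_def prod.distrib[symmetric] by (rule sum_copies_prod)

lemma sum_tensor_op_columns:
  assumes A: "orthonormal_columns N A" and "p \<in> copies k N" "q \<in> copies k N"
  shows "(\<Sum>x\<in>copies k N. tensor_op k A x p * tensor_op k A x q) = of_bool (p = q)"
proof -
  have "(\<Sum>x\<in>copies k N. tensor_op k A x p * tensor_op k A x q) = (\<Prod>l<k. \<Sum>i<N. A i (p l) * A i (q l))"
    unfolding tensor_op_def prod.distrib[symmetric] by (rule sum_copies_prod)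
  also have "\<dots> = (\<Prod>l<k. of_bool (p l = q l))"
    using assms by (intro prod.cong refl) (simp add: orthonormal_columns_def copies_less)
  also have "\<dots> = of_bool (p = q)"
  proof (cases "p = q")
    case False
    then obtain l where "l < k" "p l \<noteq> q l" using copies_eqI assms(2,3) by metis
    thus ?thesis using False by (auto simp: prod_zero_iff intro!: bexI[of _ l])
  qed simp
  finally show ?thesis .
qed

lemma apply_op_norm:
  assumes A: "orthonormal_columns N A"
  shows "(\<Sum>x\<in>copies k N. (apply_op k N A v x)\<^sup>2) = (\<Sum>x\<in>copies k N. (v x)\<^sup>2)"
proof -
  have "(\<Sum>x\<in>copies k N. (apply_op k N A v x)\<^sup>2)
      = (\<Sum>x\<in>copies k N. \<Sum>p\<in>copies k N. \<Sum>q\<in>copies k N. v p * v q * (tensor_op k A x p * tensor_op k A x q))"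
    unfolding apply_op_def power2_eq_square sum_product by (intro sum.cong refl) (simp add: ac_simps)
  also have "\<dots> = (\<Sum>p\<in>copies k N. \<Sum>q\<in>copies k N. \<Sum>x\<in>copies k N. v p * v q * (tensor_op k A x p * tensor_op k A x q))"
    by (subst sum.swap, rule sum.cong[OF refl], rule sum.swap)
  also have "\<dots> = (\<Sum>p\<in>copies k N. \<Sum>q\<in>copies k N. if q = p then v p * v p else 0)"
    unfolding sum_distrib_left[symmetric]
    by (intro sum.cong refl) (simp add: sum_tensor_op_columns[OF A])
  finally show ?thesis by (simp add: power2_eq_square)
qed

lemma quad_form_apply_op:
  "quad_form (copies k N) w (apply_op k N A v) = quad_form (copies k N) (conj_form k N A w) v"
proof -
  let ?X = "copies k N" and ?T = "tensor_op k A"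
  have "quad_form ?X w (apply_op k N A v)
      = (\<Sum>x\<in>?X. \<Sum>y\<in>?X. \<Sum>p\<in>?X. \<Sum>q\<in>?X. w x y * ?T x p * ?T y q * v p * v q)"
    unfolding quad_form_def apply_op_def mult.assoc[of "w _ _"] sum_product
    unfolding sum_distrib_left by (intro sum.cong refl) (simp add: ac_simps)
  also have "\<dots> = (\<Sum>p\<in>?X. \<Sum>q\<in>?X. \<Sum>x\<in>?X. \<Sum>y\<in>?X. w x y * ?T x p * ?T y q * v p * v q)"
    by (rule sum_swap_pairs)
  also have "\<dots> = quad_form ?X (conj_form k N A w) v"
    unfolding quad_form_def conj_form_def sum_distrib_right by (rule refl)
  finally show ?thesis .
qed

lemma form_bounded_conj_form:
  assumes "orthonormal_columns N A" "form_bounded (copies k N) w"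
  shows "form_bounded (copies k N) (conj_form k N A w)"
  using assms unfolding form_bounded_def quad_form_apply_op[symmetric] by (metis apply_op_norm)

lemma form_bounded_reindex:
  assumes b: "bij_betw b I X" and w: "form_bounded X w"
  shows "form_bounded I (\<lambda>i j. w (b i) (b j))"
  unfolding form_bounded_def
proof
  fix v :: "'a \<Rightarrow> real"
  define u where "u x = v (inv_into I b x)" for x
  have u: "u (b i) = v i" if "i \<in> I" for i
    using that b by (simp add: u_def bij_betw_inv_into_left)
  have "quad_form X w u = (\<Sum>i\<in>I. \<Sum>j\<in>I. w (b i) (b j) * u (b i) * u (b j))"
    unfolding quad_form_def by (simp add: sum.reindex_bij_betw[OF b, symmetric])
  also have "\<dots> = quad_form I (\<lambda>i j. w (b i) (b j)) v"
    unfolding quad_form_def by (intro sum.cong refl) (simp add: u)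
  finally have "quad_form I (\<lambda>i j. w (b i) (b j)) v = quad_form X w u" ..
  moreover have "(\<Sum>x\<in>X. (u x)\<^sup>2) = (\<Sum>i\<in>I. (u (b i))\<^sup>2)"
    by (rule sum.reindex_bij_betw[OF b, symmetric])
  moreover have "\<dots> = (\<Sum>i\<in>I. (v i)\<^sup>2)" by (intro sum.cong refl) (simp add: u)
  ultimately show "\<bar>quad_form I (\<lambda>i j. w (b i) (b j)) v\<bar> \<le> (\<Sum>i\<in>I. (v i)\<^sup>2)"
    using w unfolding form_bounded_def by metis
qed

section \<open>Numbering of the tensor basis by digits\<close>

lemma digits_inj:
  fixes N :: nat
  assumes "N > 0" "i < N ^ k" "j < N ^ k" "\<And>l. l < k \<Longrightarrow> i div N ^ l mod N = j div N ^ l mod N"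
  shows "i = j"
  using assms(2-)
proof (induction k arbitrary: i j)
  case 0
  thus ?case by simp
next
  case (Suc k)
  have "i div N = j div N"
  proof (rule Suc.IH)
    show "i div N < N ^ k" "j div N < N ^ k"
      using Suc.prems(1,2) assms(1) by (simp_all add: less_mult_imp_div_less mult.commute)
    fix l assume "l < k"
    thus "i div N div N ^ l mod N = j div N div N ^ l mod N"
      using Suc.prems(3)[of "Suc l"] by (simp add: div_mult2_eq)
  qed
  moreover have "i mod N = j mod N" using Suc.prems(3)[of 0] by simp
  ultimately show ?case by (metis div_mult_mod_eq)
qed

definition digits :: "nat \<Rightarrow> nat \<Rightarrow> nat \<Rightarrow> nat \<Rightarrow> nat" where
  "digits k N i = (\<lambda>l\<in>{..<k}. i div N ^ l mod N)"

lemma bij_betw_digits: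
  assumes "N > 0"
  shows "bij_betw (digits k N) {..<N ^ k} (copies k N)"
proof -
  have inj: "inj_on (digits k N) {..<N ^ k}"
  proof (rule inj_onI)
    fix i j assume ij: "i \<in> {..<N ^ k}" "j \<in> {..<N ^ k}" "digits k N i = digits k N j"
    have "i div N ^ l mod N = j div N ^ l mod N" if "l < k" for l
      using fun_cong[OF ij(3), of l] that by (simp add: digits_def)
    thus "i = j" using digits_inj[OF assms] ij by simp
  qed
  have "digits k N ` {..<N ^ k} \<subseteq> copies k N"
    using assms by (intro image_subsetI) (simp add: digits_def copies_def PiE_iff)
  hence "digits k N ` {..<N ^ k} = copies k N"
    by (rule card_subset_eq[OF finite_copies]) (simp add: card_image[OF inj] card_copies)
  thus ?thesis using inj by (simp add: bij_betw_def)
qed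

text \<open>Setting \<open>v\<close> to 0 outside of \<open>S\<close> reduces the restricted pairing
  to a value of the full quadratic form. The good and the bad tuples can therefore be bounded
  separately.\<close>

lemma form_pairing_PSD:
  assumes w: "form_bounded X w" and X: "finite X" "S \<subseteq> X"
  shows "\<bar>\<Sum>x\<in>S. \<Sum>y\<in>S. w x y * (v x * v y)\<bar> \<le> (\<Sum>x\<in>S. (v x)\<^sup>2)"
proof -
  define u where "u x = (if x \<in> S then v x else 0)" for x
  have "quad_form X w u = (\<Sum>x\<in>S. \<Sum>y\<in>X. w x y * u x * u y)"
    unfolding quad_form_def using X by (intro sum.mono_neutral_right) (auto simp: u_def)
  also have "\<dots> = (\<Sum>x\<in>S. \<Sum>y\<in>S. w x y * u x * u y)"
    using X by (intro sum.cong refl sum.mono_neutral_right) (auto simp: u_def)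
  also have "\<dots> = (\<Sum>x\<in>S. \<Sum>y\<in>S. w x y * (v x * v y))"
    by (intro sum.cong refl) (simp add: u_def)
  finally have "quad_form X w u = (\<Sum>x\<in>S. \<Sum>y\<in>S. w x y * (v x * v y))" .
  moreover have "(\<Sum>x\<in>X. (u x)\<^sup>2) = (\<Sum>x\<in>S. (u x)\<^sup>2)"
    using X by (intro sum.mono_neutral_right) (auto simp: u_def)
  moreover have "\<dots> = (\<Sum>x\<in>S. (v x)\<^sup>2)" by (intro sum.cong refl) (simp add: u_def)
  ultimately show ?thesis using w unfolding form_bounded_def by metis
qed

text \<open>\<open>M\<close> and \<open>M'\<close> are second moments of two random vectors. On the good indices \<open>S\<close> both are multiples
  of the same pattern \<open>R\<close>, as far as the form \<open>g\<close> can see; so the traces of the two multiples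
  control their distance.\<close>

lemma pairing_difference_le:
  fixes g M M' :: "'i \<Rightarrow> 'i \<Rightarrow> real"
  assumes X: "finite X" "S \<subseteq> X"
    and psd: "\<And>S. S \<subseteq> X \<Longrightarrow> \<bar>\<Sum>x\<in>S. \<Sum>y\<in>S. g x y * M x y\<bar> \<le> (\<Sum>x\<in>S. M x x)"
    and psd': "\<And>S. S \<subseteq> X \<Longrightarrow> \<bar>\<Sum>x\<in>S. \<Sum>y\<in>S. g x y * M' x y\<bar> \<le> (\<Sum>x\<in>S. M' x x)"
    and off: "\<And>x y. x \<in> S \<Longrightarrow> y \<in> X - S \<Longrightarrow> M x y = 0 \<and> M y x = 0 \<and> M' x y = 0 \<and> M' y x = 0"
    and diag: "\<And>x. x \<in> S \<Longrightarrow> M x x = c \<and> M' x x = c'"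
    and pat: "\<And>x y. x \<in> S \<Longrightarrow> y \<in> S \<Longrightarrow> g x y * M x y = c * (g x y * of_bool (R x y)) \<and>
      g x y * M' x y = c' * (g x y * of_bool (R x y))"
    and tr: "(\<Sum>x\<in>X. M x x) = 1" "(\<Sum>x\<in>X. M' x x) = 1"
    and bad: "(\<Sum>x\<in>X - S. M x x) \<le> \<eta>" "(\<Sum>x\<in>X - S. M' x x) \<le> \<eta>'"
  shows "\<bar>(\<Sum>x\<in>X. \<Sum>y\<in>X. g x y * M x y) - (\<Sum>x\<in>X. \<Sum>y\<in>X. g x y * M' x y)\<bar> \<le> 2 * \<eta> + 2 * \<eta>'"
proof -
  define T where "T = (\<Sum>x\<in>S. \<Sum>y\<in>S. g x y * of_bool (R x y))"
  have S: "finite S" using X finite_subset by auto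
  have split: "(\<Sum>x\<in>X. \<Sum>y\<in>X. g x y * P x y) = (\<Sum>x\<in>S. \<Sum>y\<in>S. g x y * P x y) + (\<Sum>x\<in>X - S. \<Sum>y\<in>X - S. g x y * P x y)"
    if "\<And>x y. x \<in> S \<Longrightarrow> y \<in> X - S \<Longrightarrow> P x y = 0 \<and> P y x = 0" for P :: "'i \<Rightarrow> 'i \<Rightarrow> real"
  proof -
    have "(\<Sum>y\<in>X. g x y * P x y) = (\<Sum>y\<in>S. g x y * P x y)" if "x \<in> S" for x
      using X \<open>\<And>x y. x \<in> S \<Longrightarrow> y \<in> X - S \<Longrightarrow> P x y = 0 \<and> P y x = 0\<close>[OF that]
      by (intro sum.mono_neutral_right) auto
    moreover have "(\<Sum>y\<in>X. g x y * P x y) = (\<Sum>y\<in>X - S. g x y * P x y)" if x: "x \<in> X - S" for x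
    proof (rule sum.mono_neutral_right)
      show "\<forall>y\<in>X - (X - S). g x y * P x y = 0"
        using \<open>\<And>x y. x \<in> S \<Longrightarrow> y \<in> X - S \<Longrightarrow> P x y = 0 \<and> P y x = 0\<close>[OF _ x] by auto
    qed (use X in auto)
    ultimately show ?thesis using X by (simp add: sum.subset_diff[of S X])
  qed
  have 1: "(\<Sum>x\<in>S. \<Sum>y\<in>S. g x y * M x y) = c * T"
    unfolding T_def sum_distrib_left by (intro sum.cong refl) (simp add: pat)
  have 2: "(\<Sum>x\<in>S. \<Sum>y\<in>S. g x y * M' x y) = c' * T"
    unfolding T_def sum_distrib_left by (intro sum.cong refl) (simp add: pat)
  have c: "(\<Sum>x\<in>S. M x x) = c * card S" and c': "(\<Sum>x\<in>S. M' x x) = c' * card S"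
    using diag by simp_all
  have s1: "c * card S + (\<Sum>x\<in>X - S. M x x) = 1" and s2: "c' * card S + (\<Sum>x\<in>X - S. M' x x) = 1"
    using tr X c c' by (simp_all add: sum.subset_diff[of S X])
  have r1: "\<bar>\<Sum>x\<in>X - S. \<Sum>y\<in>X - S. g x y * M x y\<bar> \<le> (\<Sum>x\<in>X - S. M x x)"
    and r2: "\<bar>\<Sum>x\<in>X - S. \<Sum>y\<in>X - S. g x y * M' x y\<bar> \<le> (\<Sum>x\<in>X - S. M' x x)"
    by (intro psd psd'; simp)+
  have T1: "\<bar>c * T\<bar> \<le> c * card S" and T2: "\<bar>c' * T\<bar> \<le> c' * card S"
    using psd[OF X(2)] psd'[OF X(2)] by (simp_all add: 1 2 c c')
  \<comment> \<open>Whichever of \<open>c\<close> and \<open>c'\<close> is positive yields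
    \<open>\<bar>T\<bar> \<le> card S\<close> from its own bound \<open>T1\<close> or
    \<open>T2\<close>. If both are 0, or \<open>S\<close> is empty, both sides vanish.\<close>
  have d: "\<bar>(c - c') * T\<bar> \<le> \<bar>c - c'\<bar> * card S"
  proof (cases "card S = 0 \<or> c = 0 \<and> c' = 0")
    case True
    thus ?thesis using T1 T2 by (auto simp: left_diff_distrib)
  next
    case False
    hence K: "real (card S) > 0" by simp
    have "0 \<le> c * card S" "0 \<le> c' * card S" using T1 T2 by linarith+
    hence nonneg: "0 \<le> c" "0 \<le> c'" using K by (simp_all add: zero_le_mult_iff)
    have "c * \<bar>T\<bar> \<le> c * card S" "c' * \<bar>T\<bar> \<le> c' * card S"
      using T1 T2 nonneg by (simp_all add: abs_mult)
    moreover have "c > 0 \<or> c' > 0" using False nonneg by auto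
    ultimately have "\<bar>T\<bar> \<le> card S" by (auto simp: mult_le_cancel_left_pos)
    thus ?thesis by (simp add: abs_mult mult_left_mono)
  qed
  \<comment> \<open>Both traces are 1, so the difference of the two good masses is the opposite of
    the difference of the bad ones. Each bad mass is thus paid once here and once in
    \<open>r1\<close> or \<open>r2\<close>.\<close>
  have "(c - c') * card S = (\<Sum>x\<in>X - S. M' x x) - (\<Sum>x\<in>X - S. M x x)"
    using s1 s2 by (simp add: algebra_simps)
  hence "\<bar>c - c'\<bar> * card S = \<bar>(\<Sum>x\<in>X - S. M' x x) - (\<Sum>x\<in>X - S. M x x)\<bar>"
    by (metis abs_mult abs_of_nat)
  hence d': "\<bar>c * T - c' * T\<bar> \<le> \<bar>(\<Sum>x\<in>X - S. M' x x) - (\<Sum>x\<in>X - S. M x x)\<bar>"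
    using d by (simp add: left_diff_distrib)
  have nonneg: "0 \<le> (\<Sum>x\<in>X - S. M x x)" "0 \<le> (\<Sum>x\<in>X - S. M' x x)" using r1 r2 by linarith+
  have e1: "(\<Sum>x\<in>X. \<Sum>y\<in>X. g x y * M x y) = c * T + (\<Sum>x\<in>X - S. \<Sum>y\<in>X - S. g x y * M x y)"
    using split[of M] off 1 by simp
  have e2: "(\<Sum>x\<in>X. \<Sum>y\<in>X. g x y * M' x y) = c' * T + (\<Sum>x\<in>X - S. \<Sum>y\<in>X - S. g x y * M' x y)"
    using split[of M'] off 2 by simp
  have "\<bar>c * T - c' * T\<bar> \<le> (\<Sum>x\<in>X - S. M x x) + (\<Sum>x\<in>X - S. M' x x)"
    using d' nonneg by linarith
  moreover have "\<bar>A + B - (A' + B')\<bar> \<le> 2 * \<eta> + 2 * \<eta>'"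
    if "\<bar>A - A'\<bar> \<le> b + b'" "\<bar>B\<bar> \<le> b" "\<bar>B'\<bar> \<le> b'" "b \<le> \<eta>" "b' \<le> \<eta>'" for A A' B B' b b' :: real
    using that by linarith
  ultimately show ?thesis unfolding e1 e2 using r1 r2 bad by blast
qed

section \<open>Moments of the Haar measure on the orthogonal group\<close>

definition re_entry :: "complex mat \<Rightarrow> nat \<Rightarrow> nat \<Rightarrow> real" where
  "re_entry U i j = Re (U $$ (i, j))"

lemma orthogonal_group_carrier: "U \<in> orthogonal_group D \<Longrightarrow> U \<in> carrier_mat D D"
  by (simp add: orthogonal_group_def unitary_group_def)

lemma orthogonal_entry:
  "U \<in> orthogonal_group D \<Longrightarrow> i < D \<Longrightarrow> j < D \<Longrightarrow> U $$ (i, j) = complex_of_real (re_entry U i j)"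
  by (simp add: orthogonal_group_def re_entry_def)

lemma orthonormal_columns_re_entry:
  assumes "U \<in> orthogonal_group D"
  shows "orthonormal_columns D (re_entry U)"
  unfolding orthonormal_columns_def
proof (intro allI impI)
  fix j l assume jl: "j < D" "l < D"
  have U: "U \<in> carrier_mat D D" "mat_adjoint U * U = 1\<^sub>m D"
    using assms by (simp_all add: orthogonal_group_def unitary_group_def)
  have "complex_of_real (\<Sum>i<D. re_entry U i j * re_entry U i l) = (mat_adjoint U * U) $$ (j, l)"
    using U(1) jl by (simp add: scalar_prod_def atLeast0LessThan mat_adjoint_index orthogonal_entry[OF assms])
  also have "\<dots> = complex_of_real (of_bool (j = l))" using jl by (simp add: U(2))
  finally show "(\<Sum>i<D. re_entry U i j * re_entry U i l) = of_bool (j = l)" by (simp only: of_real_eq_iff)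
qed

lemma real_mat_orthogonal:
  assumes "orthonormal_columns D f"
  shows "mat D D (\<lambda>(i, j). complex_of_real (f i j)) \<in> orthogonal_group D"
proof -
  let ?U = "mat D D (\<lambda>(i, j). complex_of_real (f i j))"
  have carr: "?U \<in> carrier_mat D D" "mat_adjoint ?U \<in> carrier_mat D D" by auto
  have "mat_adjoint ?U * ?U = 1\<^sub>m D"
  proof (rule eq_matI)
    fix j l assume "j < dim_row (1\<^sub>m D :: complex mat)" "l < dim_col (1\<^sub>m D :: complex mat)"
    hence jl: "j < D" "l < D" by auto
    have "(mat_adjoint ?U * ?U) $$ (j, l) = complex_of_real (\<Sum>i<D. f i j * f i l)"
      using jl by (simp add: scalar_prod_def atLeast0LessThan mat_adjoint_index)
    also have "(\<Sum>i<D. f i j * f i l) = of_bool (j = l)"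
      using assms jl by (simp add: orthonormal_columns_def)
    finally show "(mat_adjoint ?U * ?U) $$ (j, l) = 1\<^sub>m D $$ (j, l)" using jl by simp
  qed auto
  moreover from this have "?U * mat_adjoint ?U = 1\<^sub>m D"
    by (rule mat_mult_left_right_inverse[OF carr(2,1)])
  ultimately show ?thesis
    using carr by (simp add: orthogonal_group_def unitary_group_def)
qed

lemma re_entry_mat: "i < D \<Longrightarrow> j < D \<Longrightarrow> re_entry (mat D D (\<lambda>(i, j). complex_of_real (f i j))) i j = f i j"
  by (simp add: re_entry_def)

lemma mult_entry_orthogonal:
  assumes U: "U \<in> orthogonal_group D" and V: "V \<in> orthogonal_group D" and ij: "i < D" "j < D"
  shows "(U * V) $$ (i, j) = complex_of_real (\<Sum>l<D. re_entry U i l * re_entry V l j)"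
  using orthogonal_group_carrier[OF U] orthogonal_group_carrier[OF V] ij
  by (simp add: scalar_prod_def atLeast0LessThan orthogonal_entry[OF U] orthogonal_entry[OF V])

lemma re_entry_mult:
  assumes "U \<in> orthogonal_group D" "V \<in> orthogonal_group D" "i < D" "j < D"
  shows "re_entry (U * V) i j = (\<Sum>l<D. re_entry U i l * re_entry V l j)"
  unfolding re_entry_def[of "U * V"] mult_entry_orthogonal[OF assms] by simp

lemma orthonormal_columns_mult:
  assumes A: "orthonormal_columns D A" and B: "orthonormal_columns D B"
  shows "orthonormal_columns D (\<lambda>i j. \<Sum>l<D. A i l * B l j)"
  unfolding orthonormal_columns_def
proof (intro allI impI)
  fix j l assume jl: "j < D" "l < D"
  have "(\<Sum>i<D. (\<Sum>p<D. A i p * B p j) * (\<Sum>q<D. A i q * B q l))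
      = (\<Sum>i<D. \<Sum>p<D. \<Sum>q<D. B p j * B q l * (A i p * A i q))"
    unfolding sum_product by (intro sum.cong refl) (simp add: ac_simps)
  also have "\<dots> = (\<Sum>p<D. \<Sum>q<D. \<Sum>i<D. B p j * B q l * (A i p * A i q))"
    by (subst sum.swap, rule sum.cong[OF refl], rule sum.swap)
  also have "\<dots> = (\<Sum>p<D. \<Sum>q<D. if q = p then B p j * B p l else 0)"
    unfolding sum_distrib_left[symmetric] using A
    by (intro sum.cong refl) (simp add: orthonormal_columns_def)
  also have "\<dots> = of_bool (j = l)" using B jl by (simp add: orthonormal_columns_def)
  finally show "(\<Sum>i<D. (\<Sum>p<D. A i p * B p j) * (\<Sum>q<D. A i q * B q l)) = of_bool (j = l)" .
qed

lemma orthogonal_group_mult: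
  assumes U: "U \<in> orthogonal_group D" and V: "V \<in> orthogonal_group D"
  shows "U * V \<in> orthogonal_group D"
proof -
  have "U * V = mat D D (\<lambda>(i, j). complex_of_real (\<Sum>l<D. re_entry U i l * re_entry V l j))"
    using orthogonal_group_carrier[OF U] orthogonal_group_carrier[OF V]
    by (intro eq_matI) (simp_all add: mult_entry_orthogonal[OF U V] del: of_real_sum of_real_mult index_mult_mat(1))
  thus ?thesis
    using real_mat_orthogonal[OF orthonormal_columns_mult[OF orthonormal_columns_re_entry[OF U] orthonormal_columns_re_entry[OF V]]]
    by (simp only:)
qed

lemma orthonormal_columns_entry_le:
  assumes "orthonormal_columns D A" "i < D" "j < D"
  shows "\<bar>A i j\<bar> \<le> 1"
proof -
  have "(A i j)\<^sup>2 \<le> (\<Sum>i<D. (A i j)\<^sup>2)" using assms(2) by (intro member_le_sum) auto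
  also have "\<dots> = 1" using assms by (simp add: orthonormal_columns_def power2_eq_square)
  finally show ?thesis by (simp add: abs_square_le_1)
qed

lemma sets_orthogonal_borel: "sets (orthogonal_borel D) = sigma_sets (orthogonal_group D)
     {{U \<in> orthogonal_group D. U $$ (i, j) \<in> B} | i j B. i < D \<and> j < D \<and> B \<in> sets borel}"
  unfolding orthogonal_borel_def by (rule sets_measure_of) auto

lemma space_orthogonal_borel: "space (orthogonal_borel D) = orthogonal_group D"
  unfolding orthogonal_borel_def by (rule space_measure_of) auto

lemma space_ensemble: "orthogonal_ensemble D E \<Longrightarrow> space E = orthogonal_group D"
  using sets_eq_imp_space_eq[of E "orthogonal_borel D"]
  by (simp add: orthogonal_ensemble_def space_orthogonal_borel)

lemma entry_measurable:
  assumes E: "orthogonal_ensemble D E" and ij: "i < D" "j < D"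
  shows "(\<lambda>U. U $$ (i, j)) \<in> borel_measurable E"
proof (rule measurableI)
  fix B :: "complex set" assume "B \<in> sets borel"
  hence "{U \<in> orthogonal_group D. U $$ (i, j) \<in> B} \<in> sets E"
    using E ij unfolding orthogonal_ensemble_def
    by (auto simp: sets_orthogonal_borel intro!: sigma_sets.Basic)
  moreover have "(\<lambda>U. U $$ (i, j)) -` B \<inter> space E = {U \<in> orthogonal_group D. U $$ (i, j) \<in> B}"
    by (auto simp: space_ensemble[OF E])
  ultimately show "(\<lambda>U. U $$ (i, j)) -` B \<inter> space E \<in> sets E" by simp
qed simp

lemma re_entry_measurable:
  assumes "orthogonal_ensemble D E" "i < D" "j < D"
  shows "(\<lambda>U. re_entry U i j) \<in> borel_measurable E"
  unfolding re_entry_def using entry_measurable[OF assms] by measurable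

lemma ensemble_measurableI:
  assumes E: "orthogonal_ensemble D E" and f: "\<And>U. U \<in> space M \<Longrightarrow> f U \<in> orthogonal_group D"
    and meas: "\<And>i j. i < D \<Longrightarrow> j < D \<Longrightarrow> (\<lambda>U. f U $$ (i, j)) \<in> borel_measurable M"
  shows "f \<in> measurable M E"
proof -
  have "f \<in> measurable M (orthogonal_borel D)"
    unfolding orthogonal_borel_def
  proof (rule measurable_measure_of)
    fix y assume "y \<in> {{U \<in> orthogonal_group D. U $$ (i, j) \<in> B} | i j B. i < D \<and> j < D \<and> B \<in> sets borel}"
    then obtain i j B where y: "y = {U \<in> orthogonal_group D. U $$ (i, j) \<in> B}" "i < D" "j < D" "B \<in> sets borel"
      by blast
    have "f -` y \<inter> space M = (\<lambda>U. f U $$ (i, j)) -` B \<inter> space M" using f y(1) by auto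
    thus "f -` y \<inter> space M \<in> sets M" using measurable_sets[OF meas[OF y(2,3)] y(4)] by simp
  qed (use f in auto)
  moreover have "sets E = sets (orthogonal_borel D)" using E by (simp add: orthogonal_ensemble_def)
  ultimately show ?thesis by (simp cong: measurable_cong_sets)
qed

lemma mult_measurable:
  assumes E: "orthogonal_ensemble D E" and V: "V \<in> orthogonal_group D"
  shows "(\<lambda>U. V * U) \<in> measurable E E" "(\<lambda>U. U * V) \<in> measurable E E"
proof -
  show "(\<lambda>U. V * U) \<in> measurable E E"
  proof (rule ensemble_measurableI[OF E])
    fix i j assume ij: "i < D" "j < D"
    have "(\<lambda>U. complex_of_real (\<Sum>l<D. re_entry V i l * re_entry U l j)) \<in> borel_measurable E"
      using re_entry_measurable[OF E] ij by measurable
    thus "(\<lambda>U. (V * U) $$ (i, j)) \<in> borel_measurable E"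
      by (rule measurable_cong[THEN iffD1, rotated])
        (simp add: space_ensemble[OF E] mult_entry_orthogonal[OF V _ ij] del: index_mult_mat(1))
  qed (use V in \<open>simp add: space_ensemble[OF E] orthogonal_group_mult\<close>)
  show "(\<lambda>U. U * V) \<in> measurable E E"
  proof (rule ensemble_measurableI[OF E])
    fix i j assume ij: "i < D" "j < D"
    have "(\<lambda>U. complex_of_real (\<Sum>l<D. re_entry U i l * re_entry V l j)) \<in> borel_measurable E"
      using re_entry_measurable[OF E] ij by measurable
    thus "(\<lambda>U. (U * V) $$ (i, j)) \<in> borel_measurable E"
      by (rule measurable_cong[THEN iffD1, rotated])
        (simp add: space_ensemble[OF E] mult_entry_orthogonal[OF _ V ij] del: index_mult_mat(1))
  qed (use V in \<open>simp add: space_ensemble[OF E] orthogonal_group_mult\<close>)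
qed

lemma haar_invariant:
  assumes H: "haar_orthogonal D H" and V: "V \<in> orthogonal_group D"
    and f: "(f :: complex mat \<Rightarrow> real) \<in> borel_measurable H"
  shows "(\<integral>U. f (V * U) \<partial>H) = (\<integral>U. f U \<partial>H)" "(\<integral>U. f (U * V) \<partial>H) = (\<integral>U. f U \<partial>H)"
proof -
  have E: "orthogonal_ensemble D H" using H by (simp add: haar_orthogonal_def)
  have inv: "distr H H (\<lambda>U. V * U) = H" "distr H H (\<lambda>U. U * V) = H"
    using H V by (auto simp: haar_orthogonal_def)
  show "(\<integral>U. f (V * U) \<partial>H) = (\<integral>U. f U \<partial>H)"
    using integral_distr[OF mult_measurable(1)[OF E V] f] by (simp add: inv)
  show "(\<integral>U. f (U * V) \<partial>H) = (\<integral>U. f U \<partial>H)"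
    using integral_distr[OF mult_measurable(2)[OF E V] f] by (simp add: inv)
qed

lemma prob_integrable_bounded:
  fixes f :: "'w \<Rightarrow> real"
  assumes "prob_space M" "f \<in> borel_measurable M" "\<And>x. x \<in> space M \<Longrightarrow> \<bar>f x\<bar> \<le> B"
  shows "integrable M f"
proof -
  interpret prob_space M by fact
  show ?thesis using assms(2,3) by (intro integrable_const_bound[of f B] AE_I2) auto
qed

text \<open>The integral of a function that is not integrable is 0 by convention;
  \<open>B \<ge> 0\<close> covers this case, so no measurability has to be shown.\<close>

lemma prob_integral_le_const:
  fixes f :: "'w \<Rightarrow> real"
  assumes "prob_space M" "\<And>x. x \<in> space M \<Longrightarrow> \<bar>f x\<bar> \<le> B" "B \<ge> 0"
  shows "\<bar>\<integral>x. f x \<partial>M\<bar> \<le> B"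
proof (cases "integrable M f")
  case True
  interpret prob_space M by fact
  have "\<bar>\<integral>x. f x \<partial>M\<bar> \<le> (\<integral>x. \<bar>f x\<bar> \<partial>M)" by (rule integral_abs_bound)
  also have "\<dots> \<le> (\<integral>x. B \<partial>M)" using True assms(2) by (intro integral_mono) auto
  finally show ?thesis by (simp add: prob_space)
qed (simp add: not_integrable_integral_eq assms(3))

text \<open>Column 0 is the image of the zero state; the whole statement about states only concerns
  this column of a random matrix.\<close>

abbreviation haar_column :: "complex mat \<Rightarrow> nat \<Rightarrow> real" where
  "haar_column U \<equiv> \<lambda>i. re_entry U i 0"

definition moment :: "complex mat measure \<Rightarrow> nat \<Rightarrow> (nat \<Rightarrow> nat) \<Rightarrow> (nat \<Rightarrow> nat) \<Rightarrow> real" where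
  "moment H k x y = (\<integral>U. tensor_vec k (haar_column U) x * tensor_vec k (haar_column U) y \<partial>H)"

lemma tensor_vec_measurable:
  assumes "orthogonal_ensemble D E" "D > 0" "\<And>l. l < k \<Longrightarrow> x l < D"
  shows "(\<lambda>U. tensor_vec k (haar_column U) x) \<in> borel_measurable E"
  unfolding tensor_vec_def using re_entry_measurable[OF assms(1) assms(3) assms(2)]
  by (intro borel_measurable_prod) auto

lemma tensor_vec_le_1:
  assumes "\<And>i. i < D \<Longrightarrow> \<bar>\<psi> i\<bar> \<le> 1" "\<And>l. l < k \<Longrightarrow> x l < D"
  shows "\<bar>tensor_vec k \<psi> x\<bar> \<le> 1"
  unfolding tensor_vec_def abs_prod using assms by (intro prod_le_1) auto

lemma haar_column_le_1:
  "U \<in> orthogonal_group D \<Longrightarrow> i < D \<Longrightarrow> \<bar>haar_column U i\<bar> \<le> 1"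
  using orthonormal_columns_entry_le[OF orthonormal_columns_re_entry, of U D i 0] by simp

lemma haar_column_norm:
  "U \<in> orthogonal_group D \<Longrightarrow> D > 0 \<Longrightarrow> (\<Sum>i<D. (haar_column U i)\<^sup>2) = 1"
  using orthonormal_columns_re_entry[of U D] by (simp add: orthonormal_columns_def power2_eq_square)

lemma moment_sym: "moment H k x y = moment H k y x"
  by (simp add: moment_def mult.commute)

text \<open>Left multiplication by the reflection of the basis vector \<open>x l0\<close> changes
  the sign of exactly one factor of the \<open>x\<close> part, as \<open>x\<close> is injective, and
  of no factor of the \<open>y\<close> part. By invariance the moment equals its own
  negative.\<close>

lemma moment_eq_0:
  assumes H: "haar_orthogonal D H" and D: "D > 0"
    and x: "\<And>l. l < k \<Longrightarrow> x l < D" and y: "\<And>l. l < k \<Longrightarrow> y l < D"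
    and inj: "inj_on x {..<k}" and l0: "l0 < k" "x l0 \<notin> y ` {..<k}"
  shows "moment H k x y = 0"
proof -
  have E: "orthogonal_ensemble D H" using H by (simp add: haar_orthogonal_def)
  define s :: "nat \<Rightarrow> real" where "s i = (if i = x l0 then -1 else 1)" for i
  define V where "V = mat D D (\<lambda>(i, j). complex_of_real (s i * of_bool (i = j)))"
  have "(\<Sum>i<D. s i * of_bool (i = j) * (s i * of_bool (i = l))) = of_bool (j = l)" if "j < D" for j l
  proof -
    have "(\<Sum>i<D. s i * of_bool (i = j) * (s i * of_bool (i = l))) = (\<Sum>i<D. if i = j then of_bool (j = l) else 0)"
      by (intro sum.cong) (auto simp: s_def)
    thus ?thesis using that by simp
  qed
  hence V: "V \<in> orthogonal_group D"
    unfolding V_def by (intro real_mat_orthogonal) (simp add: orthonormal_columns_def)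
  define f where "f U = tensor_vec k (haar_column U) x * tensor_vec k (haar_column U) y" for U
  have f: "f \<in> borel_measurable H"
    unfolding f_def[abs_def] using tensor_vec_measurable[OF E D] x y by (intro borel_measurable_times) auto
  have "f (V * U) = - f U" if U: "U \<in> orthogonal_group D" for U
  proof -
    have col: "haar_column (V * U) i = s i * haar_column U i" if "i < D" for i
    proof -
      have "haar_column (V * U) i = (\<Sum>l<D. s i * of_bool (i = l) * haar_column U l)"
        unfolding re_entry_mult[OF V U that D] unfolding V_def
        using re_entry_mat[OF that, of _ "\<lambda>i j. s i * of_bool (i = j)"] by (intro sum.cong refl) simp
      also have "\<dots> = (\<Sum>l<D. if l = i then s i * haar_column U i else 0)"
        by (intro sum.cong) auto
      finally show ?thesis using that by simp
    qed
    have "(\<Prod>l<k. s (x l)) = (\<Prod>l<k. if l = l0 then -1 else 1)"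
    proof (intro prod.cong refl)
      fix l assume "l \<in> {..<k}"
      hence "x l = x l0 \<longleftrightarrow> l = l0" using inj l0(1) by (auto simp: inj_on_eq_iff)
      thus "s (x l) = (if l = l0 then -1 else 1)" by (simp add: s_def)
    qed
    also have "\<dots> = -1" using l0(1) by (simp add: prod.delta)
    finally have sx: "(\<Prod>l<k. s (x l)) = -1" .
    have sy: "(\<Prod>l<k. s (y l)) = 1" using l0(2) by (intro prod.neutral) (force simp: s_def)
    have "tensor_vec k (haar_column (V * U)) x = (\<Prod>l<k. s (x l)) * tensor_vec k (haar_column U) x"
      unfolding tensor_vec_def prod.distrib[symmetric] by (intro prod.cong refl) (simp add: col x)
    moreover have "tensor_vec k (haar_column (V * U)) y = (\<Prod>l<k. s (y l)) * tensor_vec k (haar_column U) y"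
      unfolding tensor_vec_def prod.distrib[symmetric] by (intro prod.cong refl) (simp add: col y)
    ultimately show ?thesis by (simp add: f_def sx sy)
  qed
  hence "(\<integral>U. f (V * U) \<partial>H) = (\<integral>U. - f U \<partial>H)"
    by (intro Bochner_Integration.integral_cong refl) (simp add: space_ensemble[OF E])
  hence "(\<integral>U. f U \<partial>H) = 0" using haar_invariant(1)[OF H V f] by simp
  thus ?thesis by (simp add: moment_def f_def)
qed

lemma ex_bij_extending:
  assumes "finite A" "f ` I \<subseteq> A" "g ` I \<subseteq> A" "inj_on f I" "inj_on g I"
  shows "\<exists>\<pi>. bij_betw \<pi> A A \<and> (\<forall>i\<in>I. \<pi> (f i) = g i)"
proof -
  have I: "bij_betw f I (f ` I)" "bij_betw g I (g ` I)" using assms by (auto simp: bij_betw_def)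
  have b1: "bij_betw (g \<circ> inv_into I f) (f ` I) (g ` I)"
    by (rule bij_betw_trans[OF bij_betw_inv_into[OF I(1)] I(2)])
  have "card (A - f ` I) = card (A - g ` I)"
    using finite_subset[OF assms(2,1)] finite_subset[OF assms(3,1)] assms(2-5)
    by (simp add: card_Diff_subset card_image)
  from finite_same_card_bij[OF finite_Diff[OF assms(1)] finite_Diff[OF assms(1)] this]
  obtain h where h: "bij_betw h (A - f ` I) (A - g ` I)" ..
  define \<pi> where "\<pi> a = (if a \<in> f ` I then (g \<circ> inv_into I f) a else h a)" for a
  have "bij_betw \<pi> (f ` I \<union> (A - f ` I)) (g ` I \<union> (A - g ` I))"
  proof (rule bij_betw_combine)
    show "bij_betw \<pi> (f ` I) (g ` I)"
      using b1 by (subst bij_betw_cong[where g = "g \<circ> inv_into I f"]) (auto simp: \<pi>_def)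
    show "bij_betw \<pi> (A - f ` I) (A - g ` I)"
      using h by (subst bij_betw_cong[where g = h]) (auto simp: \<pi>_def)
  qed auto
  moreover have "f ` I \<union> (A - f ` I) = A" "g ` I \<union> (A - g ` I) = A" using assms by auto
  moreover have "\<pi> (f i) = g i" if "i \<in> I" for i using that assms(4) by (simp add: \<pi>_def)
  ultimately show ?thesis by metis
qed

text \<open>Two injective tuples are carried into each other by a permutation of the basis, and the
  permutation matrix is orthogonal.\<close>

lemma moment_diag_eq:
  assumes H: "haar_orthogonal D H" and D: "D > 0"
    and x: "\<And>l. l < k \<Longrightarrow> x l < D" "inj_on x {..<k}" and y: "\<And>l. l < k \<Longrightarrow> y l < D" "inj_on y {..<k}"
  shows "moment H k x x = moment H k y y"
proof -
  have E: "orthogonal_ensemble D H" using H by (simp add: haar_orthogonal_def)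
  obtain \<pi> where \<pi>: "bij_betw \<pi> {..<D} {..<D}" "\<forall>l\<in>{..<k}. \<pi> (x l) = y l"
    using ex_bij_extending[of "{..<D}" x "{..<k}" y] x y by auto
  define V where "V = mat D D (\<lambda>(i, j). complex_of_real (of_bool (j = \<pi> i)))"
  have \<pi>D: "\<pi> i < D" if "i < D" for i using \<pi>(1) that by (auto simp: bij_betw_def)
  have "(\<Sum>i<D. of_bool (j = \<pi> i) * of_bool (l = \<pi> i)) = (of_bool (j = l) :: real)" if "j < D" for j l
  proof -
    have "(\<Sum>i<D. of_bool (j = \<pi> i) * of_bool (l = \<pi> i)) = (\<Sum>i<D. of_bool (j = i) * of_bool (l = i) :: real)"
      by (rule sum.reindex_bij_betw[OF \<pi>(1), of "\<lambda>i. of_bool (j = i) * of_bool (l = i)"])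
    also have "\<dots> = (\<Sum>i<D. if i = j then of_bool (j = l) else 0)" by (intro sum.cong) auto
    finally show ?thesis using that by simp
  qed
  hence V: "V \<in> orthogonal_group D"
    unfolding V_def by (intro real_mat_orthogonal) (simp add: orthonormal_columns_def)
  define f where "f U = tensor_vec k (haar_column U) x * tensor_vec k (haar_column U) x" for U
  have f: "f \<in> borel_measurable H"
    unfolding f_def[abs_def] using tensor_vec_measurable[OF E D] x by (intro borel_measurable_times) auto
  have "f (V * U) = tensor_vec k (haar_column U) y * tensor_vec k (haar_column U) y"
    if U: "U \<in> orthogonal_group D" for U
  proof -
    have col: "haar_column (V * U) i = haar_column U (\<pi> i)" if "i < D" for i
    proof -
      have "haar_column (V * U) i = (\<Sum>l<D. if l = \<pi> i then haar_column U (\<pi> i) else 0)"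
        unfolding re_entry_mult[OF V U that D] using that
        by (intro sum.cong refl) (simp add: V_def re_entry_mat)
      thus ?thesis using \<pi>D[OF that] by simp
    qed
    have "tensor_vec k (haar_column (V * U)) x = tensor_vec k (haar_column U) y"
      unfolding tensor_vec_def using \<pi>(2) by (intro prod.cong refl) (simp add: col x)
    thus ?thesis by (simp add: f_def)
  qed
  hence "(\<integral>U. f (V * U) \<partial>H) = moment H k y y"
    unfolding moment_def
    by (intro Bochner_Integration.integral_cong refl) (simp add: space_ensemble[OF E])
  moreover have "(\<integral>U. f (V * U) \<partial>H) = moment H k x x"
    unfolding haar_invariant(1)[OF H V f] by (simp add: moment_def f_def[abs_def])
  ultimately show ?thesis by simp
qed

text \<open>\<open>tensor_vec\<close> is a product over the positions and hence blind to their
  order. By counting, \<open>y\<close> is injective as well, so it is \<open>x\<close> with its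
  positions permuted.\<close>

lemma moment_same_range:
  assumes "inj_on x {..<k}" "y ` {..<k} = x ` {..<k}"
  shows "moment H k x y = moment H k x x"
proof -
  have "inj_on y {..<k}"
    by (rule eq_card_imp_inj_on) (simp_all add: assms(2) card_image[OF assms(1)])
  hence "tensor_vec k \<psi> y = tensor_vec k \<psi> x" for \<psi>
    unfolding tensor_vec_def using assms
    by (simp add: prod.reindex[of y "{..<k}" \<psi>, unfolded comp_def, symmetric]
      prod.reindex[of x "{..<k}" \<psi>, unfolded comp_def, symmetric])
  thus ?thesis by (simp add: moment_def)
qed

section \<open>Fourth moments of a Haar-random column\<close>

definition fourth_moment :: "complex mat measure \<Rightarrow> nat \<Rightarrow> nat \<Rightarrow> real" where
  "fourth_moment H a b = (\<integral>U. (haar_column U a)\<^sup>2 * (haar_column U b)\<^sup>2 \<partial>H)"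

text \<open>In the plane of \<open>a\<close> and \<open>b\<close> this is the reflection with rows
  \<open>(c, s)\<close> and \<open>(s, -c)\<close>, elsewhere the identity. Its row \<open>a\<close>
  turns the entry \<open>x_a\<close> of a column into \<open>c x_a + s x_b\<close>.\<close>

lemma plane_reflection_columns:
  fixes c s :: real
  assumes cs: "c\<^sup>2 + s\<^sup>2 = 1" and ab: "a < D" "b < D" "a \<noteq> b"
  defines "f \<equiv> \<lambda>i j. if i = a then c * of_bool (j = a) + s * of_bool (j = b)
    else if i = b then s * of_bool (j = a) - c * of_bool (j = b) else of_bool (i = j)"
  shows "orthonormal_columns D f"
  unfolding orthonormal_columns_def
proof (intro allI impI)
  fix j l assume jl: "j < D" "l < D"
  have "(\<Sum>i<D. f i j * f i l) = f a j * f a l + f b j * f b l + (\<Sum>i\<in>{..<D} - {a} - {b}. f i j * f i l)"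
    using ab by (simp add: sum.remove[of "{..<D}" a] sum.remove[of "{..<D} - {a}" b])
  also have "(\<Sum>i\<in>{..<D} - {a} - {b}. f i j * f i l) = (\<Sum>i\<in>{..<D} - {a} - {b}. if i = j then of_bool (j = l) else 0)"
    by (intro sum.cong) (auto simp: f_def)
  also have "\<dots> = (if j \<noteq> a \<and> j \<noteq> b then of_bool (j = l) else 0)"
    using jl by simp
  also have "f a j * f a l + f b j * f b l + \<dots> = of_bool (j = l)"
    using cs ab(3) by (auto simp: f_def power2_eq_square algebra_simps)
  finally show "(\<Sum>i<D. f i j * f i l) = of_bool (j = l)" .
qed

lemma haar_column_reflection:
  assumes H: "haar_orthogonal D H" and cs: "c\<^sup>2 + s\<^sup>2 = (1 :: real)" and ab: "a < D" "b < D" "a \<noteq> b"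
  shows "(\<integral>U. (c * haar_column U a + s * haar_column U b) ^ 4 \<partial>H) = fourth_moment H a a"
proof -
  have E: "orthogonal_ensemble D H" and D: "D > 0" using H ab by (auto simp: haar_orthogonal_def)
  define f where "f = (\<lambda>i j. if i = a then c * of_bool (j = a) + s * of_bool (j = b)
    else if i = b then s * of_bool (j = a) - c * of_bool (j = b) else of_bool (i = j))"
  define V where "V = mat D D (\<lambda>(i, j). complex_of_real (f i j))"
  have V: "V \<in> orthogonal_group D"
    unfolding V_def f_def by (intro real_mat_orthogonal plane_reflection_columns cs ab)
  have g: "(\<lambda>U. haar_column U a ^ 4) \<in> borel_measurable H"
    using re_entry_measurable[OF E ab(1) D] by measurable
  have "haar_column (V * U) a = c * haar_column U a + s * haar_column U b"
    if U: "U \<in> orthogonal_group D" for U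
  proof -
    have "haar_column (V * U) a = (\<Sum>l<D. (if l = a then c * haar_column U a else 0) + (if l = b then s * haar_column U b else 0))"
      unfolding re_entry_mult[OF V U ab(1) D] using ab
      by (intro sum.cong refl) (simp add: V_def re_entry_mat f_def)
    thus ?thesis using ab by (simp add: sum.distrib)
  qed
  hence "(\<integral>U. (c * haar_column U a + s * haar_column U b) ^ 4 \<partial>H) = (\<integral>U. haar_column (V * U) a ^ 4 \<partial>H)"
    by (intro Bochner_Integration.integral_cong refl) (simp add: space_ensemble[OF E])
  also have "\<dots> = (\<integral>U. haar_column U a ^ 4 \<partial>H)" by (rule haar_invariant(1)[OF H V g])
  finally show ?thesis by (simp add: fourth_moment_def flip: power_add)
qed

lemma fourth_moment_integrable:
  assumes E: "orthogonal_ensemble D E" and ab: "a < D" "b < D"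
  shows "integrable E (\<lambda>U. (haar_column U a)\<^sup>2 * (haar_column U b)\<^sup>2)"
proof (rule prob_integrable_bounded[where B = 1])
  have D: "D > 0" using ab by auto
  show "prob_space E" using E by (simp add: orthogonal_ensemble_def)
  show "(\<lambda>U. (haar_column U a)\<^sup>2 * (haar_column U b)\<^sup>2) \<in> borel_measurable E"
    using re_entry_measurable[OF E ab(1) D] re_entry_measurable[OF E ab(2) D] by measurable
  fix U assume "U \<in> space E"
  hence "\<bar>haar_column U a\<bar> \<le> 1" "\<bar>haar_column U b\<bar> \<le> 1"
    using haar_column_le_1 ab by (simp_all add: space_ensemble[OF E])
  hence "(haar_column U a)\<^sup>2 \<le> 1" "(haar_column U b)\<^sup>2 \<le> 1" by (simp_all add: abs_square_le_1)
  thus "\<bar>(haar_column U a)\<^sup>2 * (haar_column U b)\<^sup>2\<bar> \<le> 1" by (simp add: mult_le_one)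
qed

lemma integral_linear_combination:
  fixes f g h :: "'w \<Rightarrow> real"
  assumes "integrable M f" "integrable M g" "integrable M h"
  shows "(\<integral>x. c1 * f x + c2 * g x + c3 * h x \<partial>M) = c1 * (\<integral>x. f x \<partial>M) + c2 * (\<integral>x. g x \<partial>M) + c3 * (\<integral>x. h x \<partial>M)"
  using assms by simp

text \<open>The reflection through \<open>(3/5, \<plusminus>4/5)\<close>, an arbitrary rational point of the unit circle off the axes,
  turns the invariance of the Haar measure into a linear relation between the fourth moments.\<close>

lemma fourth_moment_diag:
  assumes H: "haar_orthogonal D H" and ab: "a < D" "b < D" "a \<noteq> b"
  shows "fourth_moment H a a = 3 * fourth_moment H a b" "fourth_moment H b b = fourth_moment H a a"
proof -
  have E: "orthogonal_ensemble D H" using H by (simp add: haar_orthogonal_def)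
  have *: "2 * fourth_moment H a a = 162/625 * fourth_moment H a a + 1728/625 * fourth_moment H a b + 512/625 * fourth_moment H b b"
    if ab: "a < D" "b < D" "a \<noteq> b" for a b
  proof -
    have D: "D > 0" using ab by auto
    have int: "integrable H (\<lambda>U. (c * haar_column U a + s * haar_column U b) ^ 4)"
      if cs: "c\<^sup>2 + s\<^sup>2 = 1" for c s :: real
    proof (rule prob_integrable_bounded[where B = "(\<bar>c\<bar> + \<bar>s\<bar>) ^ 4"])
      show "prob_space H" using E by (simp add: orthogonal_ensemble_def)
      show "(\<lambda>U. (c * haar_column U a + s * haar_column U b) ^ 4) \<in> borel_measurable H"
        using re_entry_measurable[OF E ab(1) D] re_entry_measurable[OF E ab(2) D] by measurable
      fix U assume "U \<in> space H"
      hence "\<bar>haar_column U a\<bar> \<le> 1" "\<bar>haar_column U b\<bar> \<le> 1"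
        using haar_column_le_1 ab by (simp_all add: space_ensemble[OF E])
      hence "\<bar>c * haar_column U a\<bar> \<le> \<bar>c\<bar>" "\<bar>s * haar_column U b\<bar> \<le> \<bar>s\<bar>"
        by (simp_all add: abs_mult mult_left_le)
      hence "\<bar>c * haar_column U a + s * haar_column U b\<bar> \<le> \<bar>c\<bar> + \<bar>s\<bar>" by linarith
      thus "\<bar>(c * haar_column U a + s * haar_column U b) ^ 4\<bar> \<le> (\<bar>c\<bar> + \<bar>s\<bar>) ^ 4"
        unfolding power_abs by (intro power_mono) auto
    qed
    have cs: "(3/5)\<^sup>2 + (4/5)\<^sup>2 = (1 :: real)" "(3/5)\<^sup>2 + (-4/5)\<^sup>2 = (1 :: real)"
      by (simp_all add: power2_eq_square)
    \<comment> \<open>Adding the reflections for both signs cancels the odd mixed moments: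
      \<open>(3 x + 4 y) ^ 4 + (3 x - 4 y) ^ 4\<close> has only the coefficients 162, 1728 and
      512.\<close>
    have "2 * fourth_moment H a a = (\<integral>U. (3/5 * haar_column U a + 4/5 * haar_column U b) ^ 4
        + (3/5 * haar_column U a + (-4/5) * haar_column U b) ^ 4 \<partial>H)"
      unfolding Bochner_Integration.integral_add[OF int[OF cs(1)] int[OF cs(2)]]
        haar_column_reflection[OF H cs(1) ab] haar_column_reflection[OF H cs(2) ab] by simp
    also have "\<dots> = (\<integral>U. 162/625 * ((haar_column U a)\<^sup>2 * (haar_column U a)\<^sup>2)
        + 1728/625 * ((haar_column U a)\<^sup>2 * (haar_column U b)\<^sup>2)
        + 512/625 * ((haar_column U b)\<^sup>2 * (haar_column U b)\<^sup>2) \<partial>H)"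
    proof (intro Bochner_Integration.integral_cong refl)
      fix U
      define x y where "x = haar_column U a" and "y = haar_column U b"
      have h: "3/5 * x + 4/5 * y = (3 * x + 4 * y) / 5" "3/5 * x + (-4/5) * y = (3 * x - 4 * y) / 5"
        by (simp_all add: add_divide_distrib diff_divide_distrib)
      have "(3/5 * x + 4/5 * y) ^ 4 + (3/5 * x + (-4/5) * y) ^ 4 = ((3 * x + 4 * y) ^ 4 + (3 * x - 4 * y) ^ 4) / 625"
        unfolding h by (simp add: power_divide)
      also have "(3 * x + 4 * y) ^ 4 + (3 * x - 4 * y) ^ 4 = 162 * (x\<^sup>2 * x\<^sup>2) + 1728 * (x\<^sup>2 * y\<^sup>2) + 512 * (y\<^sup>2 * y\<^sup>2)"
        by (simp add: power4_eq_xxxx power2_eq_square algebra_simps)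
      finally show "(3/5 * haar_column U a + 4/5 * haar_column U b) ^ 4 + (3/5 * haar_column U a + (-4/5) * haar_column U b) ^ 4
          = 162/625 * ((haar_column U a)\<^sup>2 * (haar_column U a)\<^sup>2) + 1728/625 * ((haar_column U a)\<^sup>2 * (haar_column U b)\<^sup>2)
            + 512/625 * ((haar_column U b)\<^sup>2 * (haar_column U b)\<^sup>2)"
        by (simp add: x_def y_def add_divide_distrib)
    qed
    also have "\<dots> = 162/625 * fourth_moment H a a + 1728/625 * fourth_moment H a b + 512/625 * fourth_moment H b b"
      unfolding fourth_moment_def
      by (intro integral_linear_combination fourth_moment_integrable[OF E] ab)
    finally show ?thesis .
  qed
  \<comment> \<open>The relation and its copy with \<open>a\<close> and \<open>b\<close> exchanged
    differ by a multiple of the difference of the two diagonal moments, which are therefore equal.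
    What remains is \<open>576 * fourth_moment H a a = 1728 * fourth_moment H a b\<close>.\<close>
  have "fourth_moment H a b = fourth_moment H b a" by (simp add: fourth_moment_def mult.commute)
  thus "fourth_moment H a a = 3 * fourth_moment H a b" "fourth_moment H b b = fourth_moment H a a"
    using *[OF ab] *[OF ab(2,1) ab(3)[symmetric]] by linarith+
qed

text \<open>The sum of all fourth moments is 1, since columns are normalized. With equal diagonal
  moments \<open>\<rho>\<close> and off-diagonal moments \<open>\<rho> / 3\<close> this reads
  \<open>\<rho> * D * (D + 2) = 3\<close>. The diagonal value is the larger one, so its bound serves
  all \<open>a\<close> and \<open>b\<close>.\<close>

lemma fourth_moment_le:
  assumes H: "haar_orthogonal D H" and ab: "a < D" "b < D"
  shows "fourth_moment H a b \<le> 3 / (real D)\<^sup>2"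
proof -
  have E: "orthogonal_ensemble D H" and D: "D > 0" using H ab by (auto simp: haar_orthogonal_def)
  interpret prob_space H using E by (simp add: orthogonal_ensemble_def)
  define \<rho> where "\<rho> = fourth_moment H a a"
  have r: "fourth_moment H i i = \<rho>" if "i < D" for i
    using fourth_moment_diag(2)[OF H ab(1) that] by (cases "i = a") (auto simp: \<rho>_def)
  have q: "fourth_moment H i j = \<rho> / 3" if "i < D" "j < D" "i \<noteq> j" for i j
    using fourth_moment_diag(1)[OF H that] r[OF that(1)] by simp
  have "(\<Sum>i<D. \<Sum>j<D. fourth_moment H i j) = (\<integral>U. (\<Sum>i<D. \<Sum>j<D. (haar_column U i)\<^sup>2 * (haar_column U j)\<^sup>2) \<partial>H)"
  proof -
    have "(\<integral>U. (\<Sum>i<D. \<Sum>j<D. (haar_column U i)\<^sup>2 * (haar_column U j)\<^sup>2) \<partial>H)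
        = (\<Sum>i<D. \<integral>U. (\<Sum>j<D. (haar_column U i)\<^sup>2 * (haar_column U j)\<^sup>2) \<partial>H)"
      by (intro Bochner_Integration.integral_sum Bochner_Integration.integrable_sum fourth_moment_integrable[OF E]) auto
    also have "\<dots> = (\<Sum>i<D. \<Sum>j<D. fourth_moment H i j)"
      unfolding fourth_moment_def
      by (intro sum.cong refl Bochner_Integration.integral_sum fourth_moment_integrable[OF E]) auto
    finally show ?thesis ..
  qed
  also have "\<dots> = (\<integral>U. 1 \<partial>H)"
  proof (intro Bochner_Integration.integral_cong refl)
    fix U assume "U \<in> space H"
    hence "(\<Sum>i<D. (haar_column U i)\<^sup>2) = 1" using haar_column_norm D by (simp add: space_ensemble[OF E])
    thus "(\<Sum>i<D. \<Sum>j<D. (haar_column U i)\<^sup>2 * (haar_column U j)\<^sup>2) = 1"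
      unfolding sum_product[symmetric] by simp
  qed
  also have "\<dots> = 1" by (simp add: prob_space)
  also have "(\<Sum>i<D. \<Sum>j<D. fourth_moment H i j) = (\<Sum>i<D. \<Sum>j<D. \<rho> / 3 + (if j = i then 2 * \<rho> / 3 else 0))"
    by (intro sum.cong refl) (auto simp: r q)
  also have "\<dots> = \<rho> * (D * (D + 2)) / 3"
    by (simp add: sum.distrib algebra_simps)
  finally have eq: "\<rho> * (real D * (real D + 2)) = 3" by (simp add: algebra_simps)
  have "real D * real D \<le> real D * (real D + 2)" by (intro mult_left_mono) auto
  moreover have pos: "0 < real D * real D" using D by simp
  ultimately have pos2: "0 < real D * (real D + 2)" by linarith
  hence "\<rho> = 3 / (real D * (real D + 2))" using eq by (metis less_irrefl nonzero_eq_divide_eq)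
  also have "\<dots> \<le> 3 / (real D * real D)"
    by (rule divide_left_mono[OF \<open>real D * real D \<le> _\<close> _ mult_pos_pos[OF pos2 pos]]) simp
  finally have r3: "\<rho> \<le> 3 / (real D)\<^sup>2" by (simp add: power2_eq_square)
  have "0 \<le> \<rho>" by (simp add: \<rho>_def fourth_moment_def)
  hence "\<rho> / 3 \<le> 3 / (real D)\<^sup>2" using r3 by linarith
  thus ?thesis using r3 q[OF ab] r[OF ab(1)] by (cases "a = b") auto
qed

section \<open>Orthogonality of the superblocks, and collision probabilities\<close>

lemma orthonormal_columns_cong:
  assumes "\<And>i j. i < n \<Longrightarrow> j < n \<Longrightarrow> f i j = g i j"
  shows "orthonormal_columns n f \<longleftrightarrow> orthonormal_columns n g"
  unfolding orthonormal_columns_def using assms by simp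

lemma one_orthogonal: "1\<^sub>m D \<in> orthogonal_group D"
proof -
  have "mat_adjoint (1\<^sub>m D) = (1\<^sub>m D :: complex mat)"
    by (rule eq_matI) (auto simp: mat_adjoint_index)
  thus ?thesis by (simp add: orthogonal_group_def unitary_group_def)
qed

lemma mat_prod_orthogonal: "set As \<subseteq> orthogonal_group D \<Longrightarrow> mat_prod D As \<in> orthogonal_group D"
proof (induction As)
  case Nil
  show ?case by (simp add: one_orthogonal)
next
  case (Cons A As)
  thus ?case using orthogonal_group_mult[of A D "mat_prod D As"] by simp
qed

lemma on_qubits_orthogonal:
  assumes f: "inj_on f {..<N}" "f ` {..<N} \<subseteq> {..<n}" and U: "U \<in> orthogonal_group (2 ^ N)"
  shows "on_qubits n N f U \<in> orthogonal_group (2 ^ n)"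
proof -
  have carr: "U \<in> carrier_mat (2 ^ N) (2 ^ N)" by (rule orthogonal_group_carrier[OF U])
  have carr': "mat_adjoint U \<in> carrier_mat (2 ^ N) (2 ^ N)"
    using carrier_matD[OF carr] by (intro carrier_matI) simp_all
  have U1: "U * mat_adjoint U = 1\<^sub>m (2 ^ N)" "mat_adjoint U * U = 1\<^sub>m (2 ^ N)"
    using U by (simp_all add: orthogonal_group_def unitary_group_def)
  have "on_qubits n N f U * mat_adjoint (on_qubits n N f U) = 1\<^sub>m (2 ^ n)"
    "mat_adjoint (on_qubits n N f U) * on_qubits n N f U = 1\<^sub>m (2 ^ n)"
    unfolding on_qubits_adjoint[OF carr]
    by (simp_all only: on_qubits_mult[OF f carr carr', symmetric] on_qubits_mult[OF f carr' carr, symmetric] U1 on_qubits_one[OF f(2)])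
  moreover have "on_qubits n N f U $$ (i, j) \<in> \<real>" if "i < 2 ^ n" "j < 2 ^ n" for i j
    using that U by (auto simp: on_qubits_index orthogonal_group_def sub_index_less)
  ultimately show ?thesis by (simp add: orthogonal_group_def unitary_group_def)
qed

lemma superblock_orthogonal:
  assumes "2 \<le> m" "\<xi> > 0" "s < m" "U \<in> orthogonal_group (2 ^ (2 * \<xi>))"
  shows "superblock m \<xi> s U \<in> orthogonal_group (2 ^ (m * \<xi>))"
  unfolding superblock_on_qubits
  using on_qubits_orthogonal[OF inj_on_block_map[OF assms(1)] _ assms(4)] block_qubits_subset[OF assms(2,3)]
  unfolding block_qubits_def by blast

lemma card_even_below:
  fixes m :: nat
  assumes "even m"
  shows "2 * card {s. s < m \<and> even s = True} = m"
proof -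
  from assms obtain h where h: "m = 2 * h" by (elim evenE)
  have "{s. s < m \<and> even s = True} = (\<lambda>i. 2 * i) ` {..<h}"
    unfolding h by (auto elim!: evenE)
  moreover have "inj_on (\<lambda>i :: nat. 2 * i) {..<h}" by (simp add: inj_on_def)
  ultimately show ?thesis by (simp add: card_image h)
qed

lemma card_agree_on_le:
  assumes S: "S \<subseteq> {..<n}"
  shows "card {b. b < 2 ^ n \<and> agree_on S a b} \<le> 2 ^ (n - card S)"
proof -
  define f where "f b = {q \<in> {..<n} - S. bit b q}" for b :: nat
  have "inj_on f {b. b < 2 ^ n \<and> agree_on S a b}"
  proof (rule inj_onI)
    fix b c assume bc: "b \<in> {b. b < 2 ^ n \<and> agree_on S a b}" "c \<in> {b. b < 2 ^ n \<and> agree_on S a b}" "f b = f c"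
    have "bit b q = bit c q" if "q < n" for q
    proof (cases "q \<in> S")
      case True
      thus ?thesis using bc(1,2) unfolding agree_on_def by blast
    next
      case False
      thus ?thesis using bc(3) that unfolding f_def by blast
    qed
    thus "b = c" using bc(1,2) by (intro agree_on_all_imp_eq[of b n c]) (auto simp: agree_on_def)
  qed
  moreover have "f ` {b. b < 2 ^ n \<and> agree_on S a b} \<subseteq> Pow ({..<n} - S)" by (auto simp: f_def)
  ultimately have "card {b. b < 2 ^ n \<and> agree_on S a b} \<le> card (Pow ({..<n} - S))"
    by (intro card_inj_on_le) auto
  also have "\<dots> = 2 ^ (n - card S)"
    using S finite_subset[OF S] by (simp add: card_Pow card_Diff_subset)
  finally show ?thesis .
qed

text \<open>The probability that two measurement outcomes of a Haar state agree on \<open>S\<close>.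
  There are \<open>2 ^ n\<close> choices of \<open>a\<close>, at most
  \<open>2 ^ (n - card S)\<close> choices of \<open>b\<close> for each, and every term is at most
  \<open>3 / 4 ^ n\<close>. The case \<open>a = b\<close> counts as a collision and is covered by
  the same bound.\<close>

lemma haar_collision_le:
  assumes H: "haar_orthogonal (2 ^ n) H" and S: "S \<subseteq> {..<n}"
  shows "(\<Sum>a<2 ^ n. \<Sum>b<2 ^ n. of_bool (agree_on S a b) * fourth_moment H a b) \<le> 3 / 2 ^ card S"
proof -
  have cS: "card S \<le> n" using card_mono[OF _ S] by simp
  have "(\<Sum>b<2 ^ n. of_bool (agree_on S a b) * fourth_moment H a b) \<le> 2 ^ (n - card S) * (3 / (2 ^ n)\<^sup>2)"
    if a: "a < 2 ^ n" for a
  proof -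
    have "(\<Sum>b<2 ^ n. of_bool (agree_on S a b) * fourth_moment H a b)
        \<le> (\<Sum>b<2 ^ n. of_bool (agree_on S a b) * (3 / (2 ^ n)\<^sup>2))"
      using fourth_moment_le[OF H a] by (intro sum_mono mult_left_mono) auto
    also have "\<dots> = real (card {b \<in> {..<2 ^ n}. agree_on S a b}) * (3 / (2 ^ n)\<^sup>2)"
      by (simp only: sum_distrib_right[symmetric] sum.inter_filter[OF finite_lessThan, symmetric] of_bool_def) simp
    also have "{b \<in> {..<2 ^ n}. agree_on S a b} = {b. b < 2 ^ n \<and> agree_on S a b}" by auto
    also have "real (card \<dots>) * (3 / (2 ^ n)\<^sup>2) \<le> 2 ^ (n - card S) * (3 / (2 ^ n)\<^sup>2)"
      using of_nat_mono[OF card_agree_on_le[OF S, of a], where 'a = real] by (intro mult_right_mono) auto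
    finally show ?thesis .
  qed
  hence "(\<Sum>a<2 ^ n. \<Sum>b<2 ^ n. of_bool (agree_on S a b) * fourth_moment H a b)
      \<le> (\<Sum>a<2 ^ n :: nat. 2 ^ (n - card S) * (3 / (2 ^ n)\<^sup>2))"
    by (intro sum_mono) auto
  also have "\<dots> = 3 / 2 ^ card S"
    using cS by (simp add: power2_eq_square power_diff field_simps)
  finally show ?thesis .
qed

text \<open>If \<open>f\<close> is a probability vector, the entries of \<open>x\<close> are
  independent samples from it; a condition on two of them only sees their joint distribution, as
  every other position sums to 1.\<close>

lemma sum_copies_pair:
  fixes f :: "nat \<Rightarrow> real"
  assumes f: "(\<Sum>i<N. f i) = 1" and l: "l < k" "l' < k" "l \<noteq> l'"
  shows "(\<Sum>x\<in>copies k N. of_bool (R (x l) (x l')) * (\<Prod>i<k. f (x i)))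
    = (\<Sum>a<N. \<Sum>b<N. of_bool (R a b) * (f a * f b))"
proof -
  \<comment> \<open>The factors of positions \<open>l\<close> and \<open>l'\<close> are supported at
    \<open>a\<close> and \<open>b\<close>, so that the constraint becomes part of a product and the
    sum over \<open>x\<close> still factorizes.\<close>
  define h where "h a b i c = f c * (if i = l then of_bool (c = a) else if i = l' then of_bool (c = b) else 1)"
    for a b i c :: nat
  have h: "(\<Prod>i<k. h a b i (x i)) = (if x l = a \<and> x l' = b then \<Prod>i<k. f (x i) else 0)" for a b x
  proof (cases "x l = a \<and> x l' = b")
    case True
    thus ?thesis by (auto simp: h_def intro!: prod.cong)
  next
    case False
    hence "h a b l (x l) = 0 \<or> h a b l' (x l') = 0" using l(3) by (auto simp: h_def)
    thus ?thesis using False l by (auto simp: prod_zero_iff)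
  qed
  have sh: "(\<Sum>x\<in>copies k N. \<Prod>i<k. h a b i (x i)) = f a * f b" if ab: "a < N" "b < N" for a b
  proof -
    have "(\<Sum>x\<in>copies k N. \<Prod>i<k. h a b i (x i)) = (\<Prod>i<k. \<Sum>c<N. h a b i c)" by (rule sum_copies_prod)
    also have "\<dots> = (\<Prod>i<k. if i = l then f a else if i = l' then f b else 1)"
    proof (intro prod.cong refl)
      fix i
      have "(\<Sum>c<N. f c * of_bool (c = d)) = f d" if "d < N" for d
      proof -
        have "(\<Sum>c<N. f c * of_bool (c = d)) = (\<Sum>c<N. if c = d then f d else 0)" by (intro sum.cong) auto
        thus ?thesis using that by simp
      qed
      thus "(\<Sum>c<N. h a b i c) = (if i = l then f a else if i = l' then f b else 1)"
        using ab f by (simp add: h_def)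
    qed
    also have "\<dots> = f a * (\<Prod>i\<in>{..<k} - {l}. if i = l then f a else if i = l' then f b else 1)"
      using l by (subst prod.remove[of _ l]) auto
    also have "(\<Prod>i\<in>{..<k} - {l}. if i = l then f a else if i = l' then f b else 1)
        = f b * (\<Prod>i\<in>{..<k} - {l} - {l'}. if i = l then f a else if i = l' then f b else 1)"
      using l by (subst prod.remove[of _ l']) auto
    also have "(\<Prod>i\<in>{..<k} - {l} - {l'}. if i = l then f a else if i = l' then f b else 1) = 1"
      by (intro prod.neutral) auto
    finally show ?thesis by simp
  qed
  have "(\<Sum>x\<in>copies k N. of_bool (R (x l) (x l')) * (\<Prod>i<k. f (x i)))
      = (\<Sum>x\<in>copies k N. \<Sum>a<N. \<Sum>b<N. of_bool (R a b) * (\<Prod>i<k. h a b i (x i)))"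
  proof (intro sum.cong refl)
    fix x assume x: "x \<in> copies k N"
    have "(\<Sum>a<N. \<Sum>b<N. of_bool (R a b) * (\<Prod>i<k. h a b i (x i)))
        = (\<Sum>a<N. \<Sum>b<N. if b = x l' then (if a = x l then of_bool (R (x l) (x l')) * (\<Prod>i<k. f (x i)) else 0) else 0)"
      unfolding h by (intro sum.cong refl) auto
    also have "\<dots> = of_bool (R (x l) (x l')) * (\<Prod>i<k. f (x i))"
      using copies_less[OF x l(1)] copies_less[OF x l(2)] by simp
    finally show "of_bool (R (x l) (x l')) * (\<Prod>i<k. f (x i))
        = (\<Sum>a<N. \<Sum>b<N. of_bool (R a b) * (\<Prod>i<k. h a b i (x i)))" ..
  qed
  also have "\<dots> = (\<Sum>a<N. \<Sum>b<N. \<Sum>x\<in>copies k N. of_bool (R a b) * (\<Prod>i<k. h a b i (x i)))"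
    by (subst sum.swap, rule sum.cong[OF refl], rule sum.swap)
  also have "\<dots> = (\<Sum>a<N. \<Sum>b<N. of_bool (R a b) * (f a * f b))"
    unfolding sum_distrib_left[symmetric] by (intro sum.cong refl) (simp add: sh)
  finally show ?thesis .
qed

section \<open>Basis states seen by the superblocks\<close>

locale superblock_brickwork =
  fixes m \<xi> k :: nat
  assumes even_m: "even m" and m_pos: "m > 0" and xi_pos: "\<xi> > 0"
begin

abbreviation N :: nat where "N \<equiv> 2 ^ (m * \<xi>)"
abbreviation D :: nat where "D \<equiv> 2 ^ (2 * \<xi>)"
abbreviation X :: "(nat \<Rightarrow> nat) set" where "X \<equiv> copies k N"
abbreviation evens :: "nat set" where "evens \<equiv> {s. s < m \<and> even s = True}"
abbreviation odds :: "nat set" where "odds \<equiv> {s. s < m \<and> even s = False}"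

definition block_val :: "nat \<Rightarrow> nat \<Rightarrow> nat" where
  "block_val s i = sub_index (2 * \<xi>) (block_map m \<xi> s) i"

definition patch :: "nat \<Rightarrow> nat set" where
  "patch t = {t * \<xi>..<t * \<xi> + \<xi>}"

definition real_layer :: "bool \<Rightarrow> (nat \<Rightarrow> complex mat) \<Rightarrow> nat \<Rightarrow> nat \<Rightarrow> real" where
  "real_layer b U i j = (\<Prod>s | s < m \<and> even s = b. re_entry (U s) (block_val s i) (block_val s j))"

definition real_state :: "(nat \<Rightarrow> complex mat) \<Rightarrow> nat \<Rightarrow> real" where
  "real_state U i = (\<Sum>j<N. real_layer False U i j * real_layer True U j 0)"

definition good :: "(nat \<Rightarrow> nat) set" where
  "good = {x \<in> X. \<forall>l<k. \<forall>l'<k. l \<noteq> l' \<longrightarrow> (\<forall>t<m. \<not> agree_on (patch t) (x l) (x l'))}"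

lemma m_ge_2: "2 \<le> m"
  using even_pos_ge_2[OF even_m m_pos] .

lemma block_val_less: "block_val s i < D"
  by (simp add: block_val_def sub_index_less)

lemma block_val_0: "block_val s 0 = 0"
  by (simp add: block_val_def sub_index_def)

lemma block_val_eq_iff: "block_val s i = block_val s j \<longleftrightarrow> agree_on (block_qubits m \<xi> s) i j"
  by (simp add: block_val_def sub_index_eq_iff block_qubits_def)

lemma block_vals_eq_imp_eq:
  assumes "i < N" "j < N" "\<And>s. s < m \<Longrightarrow> even s = b \<Longrightarrow> block_val s i = block_val s j"
  shows "i = j"
proof (rule agree_on_all_imp_eq[OF assms(1,2)])
  show "agree_on {..<m * \<xi>} i j"
    using assms(3) unfolding UN_block_qubits[OF even_m xi_pos, of b, symmetric] block_val_eq_iff agree_on_def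
    by blast
qed

lemma patch_subset_block:
  assumes "s < m"
  shows "patch s \<subseteq> block_qubits m \<xi> s" "s + 1 < m \<Longrightarrow> patch (s + 1) \<subseteq> block_qubits m \<xi> s"
proof -
  have *: "patch t \<subseteq> {q. q < m * \<xi> \<and> q div \<xi> = t}" if t: "t < m" for t
  proof
    fix q assume q: "q \<in> patch t"
    have "t * \<xi> + \<xi> = (t + 1) * \<xi>" by simp
    also have "\<dots> \<le> m * \<xi>" using t by (intro mult_right_mono) auto
    finally have "q < m * \<xi>" using q by (auto simp: patch_def)
    moreover have "q div \<xi> = t"
      using q xi_pos by (intro div_nat_eqI) (auto simp: patch_def mult.commute)
    ultimately show "q \<in> {q. q < m * \<xi> \<and> q div \<xi> = t}" by simp
  qed
  show "patch s \<subseteq> block_qubits m \<xi> s"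
    using *[OF assms] unfolding block_qubits_eq[OF xi_pos assms] by blast
  show "patch (s + 1) \<subseteq> block_qubits m \<xi> s" if "s + 1 < m"
  proof -
    have "(s + 1) mod m = s + 1" using that by simp
    thus ?thesis using *[OF that] unfolding block_qubits_eq[OF xi_pos assms] by auto
  qed
qed

lemma block_val_eq_imp_agree_patch:
  "s < m \<Longrightarrow> block_val s i = block_val s j \<Longrightarrow> agree_on (patch s) i j"
  "s + 1 < m \<Longrightarrow> block_val s i = block_val s j \<Longrightarrow> agree_on (patch (s + 1)) i j"
  unfolding block_val_eq_iff using patch_subset_block[of s] agree_on_mono by auto

text \<open>Every patch is the lower or the upper half of an even block, according to
  \<open>t mod 2\<close>, and even blocks do not wrap around the ring. So a collision on a patch, of
  either parity, is an event of a single superblock of the first layer.\<close>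

lemma agree_patch_even_block:
  assumes t: "t < m"
  defines "e \<equiv> t - t mod 2" and "S \<equiv> {t mod 2 * \<xi>..<t mod 2 * \<xi> + \<xi>}"
  shows "e \<in> evens" "S \<subseteq> {..<2 * \<xi>}" "card S = \<xi>"
    "agree_on (patch t) i j \<longleftrightarrow> agree_on S (block_val e i) (block_val e j)"
proof -
  have t2: "t mod 2 = 0 \<or> t mod 2 = 1" by auto
  show e: "e \<in> evens" using t by (auto simp: e_def)
  show S: "S \<subseteq> {..<2 * \<xi>}" "card S = \<xi>" using t2 by (auto simp: S_def)
  have te: "t = e + t mod 2" by (simp add: e_def)
  have "even e" "e < m" using e by auto
  hence em: "e + 2 \<le> m" using even_m by presburger
  have bm: "block_map m \<xi> e q = e * \<xi> + q" if "q < 2 * \<xi>" for q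
  proof -
    have "e * \<xi> + q < (e + 2) * \<xi>" using that by (simp add: algebra_simps)
    also have "\<dots> \<le> m * \<xi>" using em by (intro mult_right_mono) auto
    finally show ?thesis by (simp add: block_map_def)
  qed
  have "t * \<xi> = e * \<xi> + t mod 2 * \<xi>" by (subst te) (simp only: distrib_right)
  hence "patch t = (\<lambda>q. e * \<xi> + q) ` S"
    unfolding patch_def S_def image_add_atLeastLessThan by (simp add: ac_simps)
  thus "agree_on (patch t) i j \<longleftrightarrow> agree_on S (block_val e i) (block_val e j)"
    using S(1) bm by (auto simp: agree_on_def block_val_def bit_sub_index subset_iff)
qed

lemma layer_entry:
  assumes U: "\<And>s. s < m \<Longrightarrow> even s = b \<Longrightarrow> U s \<in> orthogonal_group D" and ij: "i < N" "j < N"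
  shows "layer m \<xi> (layer_blocks m b) U $$ (i, j) = complex_of_real (real_layer b U i j)"
  unfolding layer_index[OF even_m xi_pos ij] real_layer_def of_real_prod
proof (intro prod.cong refl)
  fix s assume "s \<in> {s. s < m \<and> even s = b}"
  hence s: "s < m" "even s = b" by simp_all
  show "U s $$ (sub_index (2 * \<xi>) (block_map m \<xi> s) i, sub_index (2 * \<xi>) (block_map m \<xi> s) j)
      = complex_of_real (re_entry (U s) (block_val s i) (block_val s j))"
    unfolding block_val_def by (rule orthogonal_entry[OF U[OF s] sub_index_less sub_index_less])
qed

lemma layer_orthogonal:
  assumes U: "\<And>s. s < m \<Longrightarrow> even s = b \<Longrightarrow> U s \<in> orthogonal_group D"
  shows "layer m \<xi> (layer_blocks m b) U \<in> orthogonal_group N"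
  unfolding layer_def
proof (intro mat_prod_orthogonal subsetI)
  fix A assume "A \<in> set (map (\<lambda>s. superblock m \<xi> s (U s)) (layer_blocks m b))"
  then obtain s where s: "s < m" "even s = b" "A = superblock m \<xi> s (U s)" by auto
  show "A \<in> orthogonal_group N"
    unfolding s(3) by (rule superblock_orthogonal[OF m_ge_2 xi_pos s(1) U[OF s(1,2)]])
qed

lemma real_layer_orthonormal:
  assumes U: "\<And>s. s < m \<Longrightarrow> even s = b \<Longrightarrow> U s \<in> orthogonal_group D"
  shows "orthonormal_columns N (real_layer b U)"
proof -
  have "re_entry (layer m \<xi> (layer_blocks m b) U) i j = real_layer b U i j" if "i < N" "j < N" for i j
    using layer_entry[of b U i j, OF U that] by (simp add: re_entry_def)
  hence "orthonormal_columns N (re_entry (layer m \<xi> (layer_blocks m b) U)) \<longleftrightarrow> orthonormal_columns N (real_layer b U)"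
    by (rule orthonormal_columns_cong)
  thus ?thesis using orthonormal_columns_re_entry[OF layer_orthogonal, OF U] by simp
qed

lemma real_layer_cong:
  assumes "\<And>s. s < m \<Longrightarrow> even s = b \<Longrightarrow> U s = V s"
  shows "real_layer b U = real_layer b V"
  unfolding real_layer_def using assms by (intro ext prod.cong refl) auto

lemma brickwork_orthogonal:
  assumes "\<And>s. s < m \<Longrightarrow> U s \<in> orthogonal_group D"
  shows "brickwork m \<xi> U \<in> orthogonal_group N"
  unfolding brickwork_layers by (intro orthogonal_group_mult layer_orthogonal assms)

lemma brickwork_column:
  assumes U: "\<And>s. s < m \<Longrightarrow> U s \<in> orthogonal_group D" and i: "i < N"
  shows "(brickwork m \<xi> U *\<^sub>v zero_state (m * \<xi>)) $ i = complex_of_real (real_state U i)"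
    "re_entry (brickwork m \<xi> U) i 0 = real_state U i"
proof -
  have carr: "brickwork m \<xi> U \<in> carrier_mat N N"
    by (rule orthogonal_group_carrier[OF brickwork_orthogonal[OF U]])
  have 1: "(brickwork m \<xi> U *\<^sub>v zero_state (m * \<xi>)) $ i = brickwork m \<xi> U $$ (i, 0)"
    using carr i by (simp add: zero_state_def)
  have "brickwork m \<xi> U $$ (i, 0) = (\<Sum>j<N. layer m \<xi> (layer_blocks m False) U $$ (i, j) * layer m \<xi> (layer_blocks m True) U $$ (j, 0))"
    unfolding brickwork_layers using i carrier_matD[OF layer_carrier] by (simp add: scalar_prod_def atLeast0LessThan)
  also have "\<dots> = complex_of_real (real_state U i)"
    unfolding real_state_def of_real_sum of_real_mult using U i
    by (intro sum.cong refl) (simp add: layer_entry)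
  finally have 2: "brickwork m \<xi> U $$ (i, 0) = complex_of_real (real_state U i)" .
  show "(brickwork m \<xi> U *\<^sub>v zero_state (m * \<xi>)) $ i = complex_of_real (real_state U i)"
    using 1 2 by simp
  show "re_entry (brickwork m \<xi> U) i 0 = real_state U i" using 2 by (simp add: re_entry_def)
qed

text \<open>The even blocks cover the ring, so a basis state is determined by its block values.
  Surjectivity follows by counting, from \<open>m / 2\<close> blocks of \<open>2 * \<xi>\<close>
  qubits each.\<close>

lemma bij_betw_even_blocks:
  "bij_betw (\<lambda>i. \<lambda>s\<in>evens. block_val s i) {..<N} (evens \<rightarrow>\<^sub>E {..<D})"
proof -
  have inj: "inj_on (\<lambda>i. \<lambda>s\<in>evens. block_val s i) {..<N}"
  proof (rule inj_onI)
    fix i j assume ij: "i \<in> {..<N}" "j \<in> {..<N}"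
      and eq: "(\<lambda>s\<in>evens. block_val s i) = (\<lambda>s\<in>evens. block_val s j)"
    have "block_val s i = block_val s j" if "s \<in> evens" for s
      using fun_cong[OF eq, of s] that by simp
    thus "i = j" using ij by (intro block_vals_eq_imp_eq[of i j True]) auto
  qed
  have "D ^ card evens = N"
    using card_even_below[OF even_m] by (metis mult.assoc mult.commute power_mult)
  hence "card (evens \<rightarrow>\<^sub>E {..<D}) = N" by (simp add: card_PiE)
  moreover have "(\<lambda>i. \<lambda>s\<in>evens. block_val s i) ` {..<N} \<subseteq> (evens \<rightarrow>\<^sub>E {..<D})"
    using block_val_less by (intro image_subsetI) (simp add: PiE_iff)
  moreover have "card ((\<lambda>i. \<lambda>s\<in>evens. block_val s i) ` {..<N}) = N"
    by (simp only: card_image[OF inj] card_lessThan)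
  moreover have "finite (evens \<rightarrow>\<^sub>E {..<D})" by (intro finite_PiE) auto
  ultimately have "(\<lambda>i. \<lambda>s\<in>evens. block_val s i) ` {..<N} = (evens \<rightarrow>\<^sub>E {..<D})"
    by (intro card_subset_eq) (simp_all only:)
  thus ?thesis using inj by (simp add: bij_betw_def)
qed

lemma sum_even_blocks:
  fixes h :: "nat \<Rightarrow> nat \<Rightarrow> real"
  shows "(\<Sum>i<N. \<Prod>s\<in>evens. h s (block_val s i)) = (\<Prod>s\<in>evens. \<Sum>a<D. h s a)"
proof -
  have "(\<Sum>i<N. \<Prod>s\<in>evens. h s (block_val s i)) = (\<Sum>i<N. \<Prod>s\<in>evens. h s ((\<lambda>s\<in>evens. block_val s i) s))"
    by (intro sum.cong prod.cong refl) simp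
  also have "\<dots> = (\<Sum>x\<in>evens \<rightarrow>\<^sub>E {..<D}. \<Prod>s\<in>evens. h s (x s))"
    by (rule sum.reindex_bij_betw[OF bij_betw_even_blocks])
  also have "\<dots> = (\<Prod>s\<in>evens. \<Sum>a<D. h s a)" by (rule prod_sum_PiE[symmetric]) auto
  finally show ?thesis .
qed

text \<open>The sum factorizes over the even blocks, and the factors of the blocks other than
  \<open>e\<close> are 1. This is the marginal of a product distribution.\<close>

lemma sum_even_blocks_marginal:
  fixes h :: "nat \<Rightarrow> nat \<Rightarrow> real"
  assumes h: "\<And>s. s \<in> evens \<Longrightarrow> (\<Sum>a<D. h s a) = 1" and e: "e \<in> evens"
  shows "(\<Sum>i<N. g (block_val e i) * (\<Prod>s\<in>evens. h s (block_val s i))) = (\<Sum>a<D. g a * h e a)"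
proof -
  define h' where "h' s a = (if s = e then g a else 1) * h s a" for s a
  have "(\<Sum>i<N. g (block_val e i) * (\<Prod>s\<in>evens. h s (block_val s i))) = (\<Sum>i<N. \<Prod>s\<in>evens. h' s (block_val s i))"
  proof (intro sum.cong refl)
    fix i
    have "(\<Prod>s\<in>evens. if s = e then g (block_val s i) else 1) = g (block_val e i)"
      using e by (simp add: prod.delta)
    thus "g (block_val e i) * (\<Prod>s\<in>evens. h s (block_val s i)) = (\<Prod>s\<in>evens. h' s (block_val s i))"
      by (simp add: h'_def prod.distrib)
  qed
  also have "\<dots> = (\<Prod>s\<in>evens. \<Sum>a<D. h' s a)" by (rule sum_even_blocks)
  also have "\<dots> = (\<Prod>s\<in>evens. if s = e then \<Sum>a<D. g a * h e a else 1)"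
    using h by (intro prod.cong refl) (auto simp: h'_def)
  also have "\<dots> = (\<Sum>a<D. g a * h e a)" using e by (simp add: prod.delta)
  finally show ?thesis .
qed

lemma sum_even_blocks_pair:
  fixes h :: "nat \<Rightarrow> nat \<Rightarrow> real"
  assumes h: "\<And>s. s \<in> evens \<Longrightarrow> (\<Sum>a<D. h s a) = 1" and t: "t < m"
  defines "f \<equiv> \<lambda>i. \<Prod>s\<in>evens. h s (block_val s i)" and "e \<equiv> t - t mod 2"
    and "S \<equiv> {t mod 2 * \<xi>..<t mod 2 * \<xi> + \<xi>}"
  shows "(\<Sum>i<N. \<Sum>j<N. of_bool (agree_on (patch t) i j) * (f i * f j))
    = (\<Sum>a<D. \<Sum>b<D. of_bool (agree_on S a b) * (h e a * h e b))"
proof -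
  note e = agree_patch_even_block[OF t, folded e_def S_def]
  have "(\<Sum>i<N. \<Sum>j<N. of_bool (agree_on (patch t) i j) * (f i * f j))
      = (\<Sum>i<N. f i * (\<Sum>j<N. of_bool (agree_on S (block_val e i) (block_val e j)) * f j))"
    unfolding e(4) sum_distrib_left by (intro sum.cong refl) (simp add: ac_simps)
  also have "\<dots> = (\<Sum>i<N. (\<Sum>b<D. of_bool (agree_on S (block_val e i) b) * h e b) * f i)"
  proof (intro sum.cong refl)
    fix i
    have "(\<Sum>j<N. of_bool (agree_on S (block_val e i) (block_val e j)) * f j)
        = (\<Sum>b<D. of_bool (agree_on S (block_val e i) b) * h e b)"
      unfolding f_def by (rule sum_even_blocks_marginal[of h, OF h e(1)])
    thus "f i * (\<Sum>j<N. of_bool (agree_on S (block_val e i) (block_val e j)) * f j)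
        = (\<Sum>b<D. of_bool (agree_on S (block_val e i) b) * h e b) * f i"
      by (simp only: mult.commute)
  qed
  also have "\<dots> = (\<Sum>a<D. (\<Sum>b<D. of_bool (agree_on S a b) * h e b) * h e a)"
    unfolding f_def by (rule sum_even_blocks_marginal[of h, OF h e(1)])
  also have "\<dots> = (\<Sum>a<D. \<Sum>b<D. of_bool (agree_on S a b) * (h e a * h e b))"
    unfolding sum_distrib_right by (intro sum.cong refl) (simp add: ac_simps)
  finally show ?thesis .
qed

section \<open>Good tuples: their mass and their rigidity\<close>

lemma good_subset: "good \<subseteq> X"
  by (auto simp: good_def)

text \<open>A union bound over the ordered pairs of different copies and over the patches; each bad
  tuple collides in at least one of these ways. \<open>sum_copies_pair\<close> then reduces every
  term to two copies.\<close>

lemma bad_mass_le: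
  assumes psi: "(\<Sum>i<N. (\<psi> i)\<^sup>2) = 1"
  shows "(\<Sum>x\<in>X - good. (tensor_vec k \<psi> x)\<^sup>2) \<le> (\<Sum>l<k. \<Sum>l'\<in>{..<k} - {l}. \<Sum>t<m.
    \<Sum>a<N. \<Sum>b<N. of_bool (agree_on (patch t) a b) * ((\<psi> a)\<^sup>2 * (\<psi> b)\<^sup>2))"
proof -
  have "(\<Sum>x\<in>X - good. (tensor_vec k \<psi> x)\<^sup>2)
      \<le> (\<Sum>x\<in>X - good. (\<Sum>l<k. \<Sum>l'\<in>{..<k} - {l}. \<Sum>t<m. of_bool (agree_on (patch t) (x l) (x l'))) * (tensor_vec k \<psi> x)\<^sup>2)"
  proof (rule sum_mono)
    fix x assume "x \<in> X - good"
    then obtain l l' t where x: "l < k" "l' \<in> {..<k} - {l}" "t < m" "agree_on (patch t) (x l) (x l')"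
      by (auto simp: good_def)
    have "(1 :: real) = of_bool (agree_on (patch t) (x l) (x l'))" using x by simp
    also have "\<dots> \<le> (\<Sum>t<m. of_bool (agree_on (patch t) (x l) (x l')))"
      using x by (intro member_le_sum[of t "{..<m}" "\<lambda>t. of_bool (agree_on (patch t) (x l) (x l'))"]) auto
    also have "\<dots> \<le> (\<Sum>l'\<in>{..<k} - {l}. \<Sum>t<m. of_bool (agree_on (patch t) (x l) (x l')))"
      using x(2) by (intro member_le_sum[of l' "{..<k} - {l}" "\<lambda>l'. \<Sum>t<m. of_bool (agree_on (patch t) (x l) (x l'))"] sum_nonneg) auto
    also have "\<dots> \<le> (\<Sum>l<k. \<Sum>l'\<in>{..<k} - {l}. \<Sum>t<m. of_bool (agree_on (patch t) (x l) (x l')))"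
      using x(1) by (intro member_le_sum[of l "{..<k}" "\<lambda>l. \<Sum>l'\<in>{..<k} - {l}. \<Sum>t<m. of_bool (agree_on (patch t) (x l) (x l'))"] sum_nonneg) auto
    finally show "(tensor_vec k \<psi> x)\<^sup>2
        \<le> (\<Sum>l<k. \<Sum>l'\<in>{..<k} - {l}. \<Sum>t<m. of_bool (agree_on (patch t) (x l) (x l'))) * (tensor_vec k \<psi> x)\<^sup>2"
      by (simp add: mult_le_cancel_right1)
  qed
  also have "\<dots> \<le> (\<Sum>x\<in>X. (\<Sum>l<k. \<Sum>l'\<in>{..<k} - {l}. \<Sum>t<m. of_bool (agree_on (patch t) (x l) (x l'))) * (tensor_vec k \<psi> x)\<^sup>2)"
    by (intro sum_mono2 mult_nonneg_nonneg sum_nonneg) auto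
  also have "\<dots> = (\<Sum>l<k. \<Sum>l'\<in>{..<k} - {l}. \<Sum>t<m. \<Sum>x\<in>X. of_bool (agree_on (patch t) (x l) (x l')) * (tensor_vec k \<psi> x)\<^sup>2)"
    unfolding sum_distrib_right
    by (subst sum.swap, rule sum.cong[OF refl], subst sum.swap, rule sum.cong[OF refl], rule sum.swap)
  also have "\<dots> = (\<Sum>l<k. \<Sum>l'\<in>{..<k} - {l}. \<Sum>t<m.
    \<Sum>a<N. \<Sum>b<N. of_bool (agree_on (patch t) a b) * ((\<psi> a)\<^sup>2 * (\<psi> b)\<^sup>2))"
  proof (intro sum.cong refl)
    fix l l' t assume l: "l \<in> {..<k}" "l' \<in> {..<k} - {l}"
    show "(\<Sum>x\<in>X. of_bool (agree_on (patch t) (x l) (x l')) * (tensor_vec k \<psi> x)\<^sup>2)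
      = (\<Sum>a<N. \<Sum>b<N. of_bool (agree_on (patch t) a b) * ((\<psi> a)\<^sup>2 * (\<psi> b)\<^sup>2))"
      unfolding tensor_vec_def prod_power_distrib using l by (intro sum_copies_pair psi) auto
  qed
  finally show ?thesis .
qed

lemma good_block_inj:
  assumes x: "x \<in> good" and s: "s < m"
  shows "inj_on (\<lambda>l. block_val s (x l)) {..<k}"
proof (rule inj_onI, rule ccontr)
  fix l l' assume l: "l \<in> {..<k}" "l' \<in> {..<k}" "block_val s (x l) = block_val s (x l')" "l \<noteq> l'"
  hence "agree_on (patch s) (x l) (x l')" using block_val_eq_imp_agree_patch(1)[OF s] by blast
  thus False using x l s by (auto simp: good_def)
qed

lemma good_inj: "x \<in> good \<Longrightarrow> inj_on x {..<k}"
  using inj_on_imageI2[of "block_val 0" x] good_block_inj[OF _ m_pos] by (simp add: comp_def)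

lemma range_eq_if_subset:
  assumes "inj_on f {..<k}" "f ` {..<k} \<subseteq> g ` {..<k}"
  shows "g ` {..<k} = f ` {..<k}" "inj_on g {..<k}"
proof -
  have "card (g ` {..<k}) \<le> k" using card_image_le[of "{..<k}" g] by simp
  hence "f ` {..<k} = g ` {..<k}"
    using assms by (intro card_seteq) (auto simp: card_image)
  thus "g ` {..<k} = f ` {..<k}" ..
  thus "inj_on g {..<k}"
    by (intro eq_card_imp_inj_on) (simp_all add: card_image[OF assms(1)])
qed

text \<open>On each even block the values of \<open>x\<close> are distinct, so by counting the
  values of \<open>y\<close> there are distinct and form the same set. A collision of
  \<open>y\<close> on a patch can be read off from the even block around it, and would thus be a
  collision of two different entries of \<open>x\<close>.\<close>

lemma good_transfer:
  assumes x: "x \<in> good" and y: "y \<in> X"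
    and r: "\<And>s. s \<in> evens \<Longrightarrow> (\<lambda>l. block_val s (x l)) ` {..<k} \<subseteq> (\<lambda>l. block_val s (y l)) ` {..<k}"
  shows "y \<in> good"
proof (rule ccontr)
  assume "y \<notin> good"
  then obtain l l' t where *: "l < k" "l' < k" "l \<noteq> l'" "t < m" "agree_on (patch t) (y l) (y l')"
    using y by (auto simp: good_def)
  let ?e = "t - t mod 2" and ?S = "{t mod 2 * \<xi>..<t mod 2 * \<xi> + \<xi>}"
  note e = agree_patch_even_block[OF *(4)]
  have em: "?e < m" using e(1) by simp
  note re = range_eq_if_subset[OF good_block_inj[OF x em] r[OF e(1)]]
  have "block_val ?e (y l) \<in> (\<lambda>l. block_val ?e (x l)) ` {..<k}"
    "block_val ?e (y l') \<in> (\<lambda>l. block_val ?e (x l)) ` {..<k}" using re(1) *(1,2) by blast+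
  then obtain i i' where i: "i < k" "i' < k" "block_val ?e (y l) = block_val ?e (x i)"
    "block_val ?e (y l') = block_val ?e (x i')" by auto
  have "block_val ?e (y l) \<noteq> block_val ?e (y l')"
    using inj_onD[OF re(2)] *(1-3) by blast
  hence "i \<noteq> i'" using i by auto
  moreover have "agree_on (patch t) (x i) (x i')" using *(5) unfolding e(4) i(3,4) .
  ultimately show False using x i(1,2) *(4) by (auto simp: good_def)
qed

lemma good_same_range:
  assumes x: "x \<in> good" and y: "y \<in> good"
    and r: "\<And>s. s < m \<Longrightarrow> (\<lambda>l. block_val s (x l)) ` {..<k} \<subseteq> (\<lambda>l. block_val s (y l)) ` {..<k}"
  shows "x ` {..<k} = y ` {..<k}"
proof -
  have "x ` {..<k} \<subseteq> y ` {..<k}"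
  proof
    fix v assume "v \<in> x ` {..<k}"
    then obtain l where l: "l < k" "v = x l" by auto
    have "\<exists>j. s < m \<longrightarrow> j < k \<and> block_val s (x l) = block_val s (y j)" for s
      using r[of s] l(1) by (cases "s < m") blast+
    then obtain \<sigma> where \<sigma>: "s < m \<Longrightarrow> \<sigma> s < k \<and> block_val s (x l) = block_val s (y (\<sigma> s))" for s by metis
    \<comment> \<open>Here \<open>\<sigma> s\<close> is the position in \<open>y\<close> that
      matches \<open>x l\<close> on block \<open>s\<close>. Blocks \<open>s\<close> and
      \<open>s + 1\<close> share patch \<open>s + 1\<close>, so \<open>x l\<close> agrees there with
      both matched entries of \<open>y\<close>; as \<open>y\<close> is good, they are the same
      entry.\<close>
    have step: "\<sigma> (s + 1) = \<sigma> s" if s: "s + 1 < m" for s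
    proof (rule ccontr)
      assume neq: "\<sigma> (s + 1) \<noteq> \<sigma> s"
      have s': "s < m" using s by simp
      have "agree_on (patch (s + 1)) (x l) (y (\<sigma> s))"
        using block_val_eq_imp_agree_patch(2)[OF s] \<sigma>[OF s'] by blast
      moreover have "agree_on (patch (s + 1)) (x l) (y (\<sigma> (s + 1)))"
        using block_val_eq_imp_agree_patch(1)[OF s] \<sigma>[OF s] by blast
      ultimately have "agree_on (patch (s + 1)) (y (\<sigma> (s + 1))) (y (\<sigma> s))"
        by (rule agree_on_trans[OF agree_on_sym, rotated])
      thus False using y neq \<sigma>[OF s'] \<sigma>[OF s] s by (auto simp: good_def)
    qed
    have const: "s < m \<Longrightarrow> \<sigma> s = \<sigma> 0" for s
    proof (induction s)
      case (Suc s)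
      thus ?case using step[of s] by simp
    qed simp
    have \<sigma>0: "\<sigma> 0 < k" using \<sigma>[OF m_pos] by simp
    have "x l = y (\<sigma> 0)"
    proof (rule block_vals_eq_imp_eq)
      show "x l < N" "y (\<sigma> 0) < N"
        using copies_less[OF subsetD[OF good_subset x] l(1)] copies_less[OF subsetD[OF good_subset y] \<sigma>0] .
      show "block_val s (x l) = block_val s (y (\<sigma> 0))" if "s < m" "even s = True" for s
        using \<sigma>[OF that(1)] const[OF that(1)] by simp
    qed
    thus "v \<in> y ` {..<k}" using l \<sigma>0 by auto
  qed
  from range_eq_if_subset(1)[OF good_inj[OF x] this] show ?thesis ..
qed

end

section \<open>Haar-random superblocks\<close>

lemma product_sigma_finite_prob:
  "(\<And>i. prob_space (M i)) \<Longrightarrow> product_sigma_finite M"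
  by (simp add: product_sigma_finite_def prob_space_imp_sigma_finite)

lemma integral_component_measurable:
  fixes f :: "('i \<Rightarrow> 'a) \<Rightarrow> real"
  assumes s: "s \<notin> J" and M': "prob_space M'" "sets M' = sets (M s)"
    and f: "f \<in> borel_measurable (Pi\<^sub>M (insert s J) M)"
  shows "(\<lambda>x. \<integral>v. f (x(s := v)) \<partial>M') \<in> borel_measurable (Pi\<^sub>M J M)"
proof -
  interpret prob_space M' by fact
  have "(\<lambda>(x, v). x(s := v)) \<in> measurable (Pi\<^sub>M J M \<Otimes>\<^sub>M M') (Pi\<^sub>M (insert s J) M)"
    using measurable_add_dim[of s J M] M'(2) by (simp cong: measurable_cong_sets sets_pair_measure_cong)
  from measurable_compose[OF this f]
  have "(\<lambda>(x, v). f (x(s := v))) \<in> borel_measurable (Pi\<^sub>M J M \<Otimes>\<^sub>M M')"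
    by (simp add: case_prod_beta)
  thus ?thesis by (rule borel_measurable_lebesgue_integral)
qed

text \<open>By Fubini the component \<open>s\<close> is integrated first, with the others fixed. The
  outer integral runs over \<open>J\<close>, where \<open>M\<close> and \<open>M'\<close> coincide,
  so the pointwise bound \<open>\<delta>\<close> passes through it.\<close>

lemma PiM_replace_component:
  fixes f :: "('i \<Rightarrow> 'a) \<Rightarrow> real"
  assumes I: "finite I" "s \<in> I" and prob: "\<And>i. prob_space (M i)" "\<And>i. prob_space (M' i)"
    and same: "\<And>i. i \<in> I - {s} \<Longrightarrow> M i = M' i" and sets: "sets (M s) = sets (M' s)"
    and f: "f \<in> borel_measurable (Pi\<^sub>M I M)" and B: "\<And>x. x \<in> space (Pi\<^sub>M I M) \<Longrightarrow> \<bar>f x\<bar> \<le> B"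
    and step: "\<And>x. x \<in> space (Pi\<^sub>M I M) \<Longrightarrow> \<bar>(\<integral>v. f (x(s := v)) \<partial>M s) - (\<integral>v. f (x(s := v)) \<partial>M' s)\<bar> \<le> \<delta>"
  shows "\<bar>(\<integral>x. f x \<partial>Pi\<^sub>M I M) - (\<integral>x. f x \<partial>Pi\<^sub>M I M')\<bar> \<le> \<delta>"
proof -
  define J where "J = I - {s}"
  have J: "I = insert s J" "s \<notin> J" "finite J" using I by (auto simp: J_def)
  have sets_I: "sets (Pi\<^sub>M I M) = sets (Pi\<^sub>M I M')"
  proof (rule sets_PiM_cong)
    fix i assume "i \<in> I"
    thus "sets (M i) = sets (M' i)" using same[of i] sets by (cases "i = s") auto
  qed simp
  have PJ: "Pi\<^sub>M J M = Pi\<^sub>M J M'" using same by (intro PiM_cong) (auto simp: J_def)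
  have pI: "prob_space (Pi\<^sub>M K M)" "prob_space (Pi\<^sub>M K M')" for K using prob by (intro prob_space_PiM; simp)+
  have spI: "space (Pi\<^sub>M I M) = space (Pi\<^sub>M I M')" by (rule sets_eq_imp_space_eq[OF sets_I])
  have f': "f \<in> borel_measurable (Pi\<^sub>M I M')" using f sets_I by (simp cong: measurable_cong_sets)
  have int: "integrable (Pi\<^sub>M I M) f" "integrable (Pi\<^sub>M I M') f"
    using prob_integrable_bounded[OF pI(1) f B] prob_integrable_bounded[OF pI(2) f'] B spI by auto
  have spJ: "x(s := v) \<in> space (Pi\<^sub>M I M)" if "x \<in> space (Pi\<^sub>M J M)" "v \<in> space (M s)" for x v
    using that unfolding space_PiM J(1) by (intro PiE_fun_upd)
  obtain v0 where v0: "v0 \<in> space (M s)" using prob_space.not_empty[OF prob(1)] by auto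
  obtain x0 where x0: "x0 \<in> space (Pi\<^sub>M I M)" using prob_space.not_empty[OF pI(1)[of I]] by blast
  have B0: "0 \<le> B" using B[OF x0] by linarith
  have sp: "space (M s) = space (M' s)" by (rule sets_eq_imp_space_eq[OF sets])
  have m1: "(\<lambda>x. \<integral>v. f (x(s := v)) \<partial>M s) \<in> borel_measurable (Pi\<^sub>M J M)"
    by (rule integral_component_measurable[OF J(2) prob(1) refl f[unfolded J(1)]])
  have m2: "(\<lambda>x. \<integral>v. f (x(s := v)) \<partial>M' s) \<in> borel_measurable (Pi\<^sub>M J M)"
    by (rule integral_component_measurable[OF J(2) prob(2) sets[symmetric] f[unfolded J(1)]])
  have b1: "\<bar>\<integral>v. f (x(s := v)) \<partial>M s\<bar> \<le> B" "\<bar>\<integral>v. f (x(s := v)) \<partial>M' s\<bar> \<le> B" if "x \<in> space (Pi\<^sub>M J M)" for x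
    using spJ[OF that] B B0 sp by (intro prob_integral_le_const prob; simp)+
  have i: "integrable (Pi\<^sub>M J M) (\<lambda>x. \<integral>v. f (x(s := v)) \<partial>M s)" "integrable (Pi\<^sub>M J M) (\<lambda>x. \<integral>v. f (x(s := v)) \<partial>M' s)"
    using prob_integrable_bounded[OF pI(1) m1 b1(1)] prob_integrable_bounded[OF pI(1) m2 b1(2)] by auto
  have e1: "(\<integral>x. f x \<partial>Pi\<^sub>M I M) = (\<integral>x. \<integral>v. f (x(s := v)) \<partial>M s \<partial>Pi\<^sub>M J M)"
    unfolding J(1) using int(1)[unfolded J(1)]
    by (intro product_sigma_finite.product_integral_insert[OF product_sigma_finite_prob[of M, OF prob(1)] J(3,2)])
  have e2: "(\<integral>x. f x \<partial>Pi\<^sub>M I M') = (\<integral>x. \<integral>v. f (x(s := v)) \<partial>M' s \<partial>Pi\<^sub>M J M)"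
    unfolding J(1) PJ using int(2)[unfolded J(1)]
    by (intro product_sigma_finite.product_integral_insert[OF product_sigma_finite_prob[of M', OF prob(2)] J(3,2)])
  have st: "\<bar>(\<integral>v. f (x(s := v)) \<partial>M s) - (\<integral>v. f (x(s := v)) \<partial>M' s)\<bar> \<le> \<delta>" if "x \<in> space (Pi\<^sub>M J M)" for x
    using step[OF spJ[OF that v0]] by simp
  have "0 \<le> \<delta>" using step[OF x0] by linarith
  have "(\<integral>x. f x \<partial>Pi\<^sub>M I M) - (\<integral>x. f x \<partial>Pi\<^sub>M I M')
      = (\<integral>x. (\<integral>v. f (x(s := v)) \<partial>M s) - (\<integral>v. f (x(s := v)) \<partial>M' s) \<partial>Pi\<^sub>M J M)"
    unfolding e1 e2 by (rule Bochner_Integration.integral_diff[OF i, symmetric])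
  thus ?thesis using prob_integral_le_const[OF pI(1) st \<open>0 \<le> \<delta>\<close>] by simp
qed

text \<open>\<open>mix J\<close> is the hybrid in which exactly the components in \<open>J\<close>
  have been replaced; enlarging \<open>J\<close> by \<open>s\<close> costs
  \<open>\<delta> s\<close>.\<close>

lemma PiM_hybrid:
  fixes f :: "('i \<Rightarrow> 'a) \<Rightarrow> real"
  assumes I: "finite I" and prob: "\<And>i. prob_space (M i)" "\<And>i. prob_space (M' i)"
    and sets: "\<And>i. sets (M i) = sets (M' i)"
    and f: "f \<in> borel_measurable (Pi\<^sub>M I M)" and B: "\<And>x. x \<in> space (Pi\<^sub>M I M) \<Longrightarrow> \<bar>f x\<bar> \<le> B"
    and step: "\<And>s x. s \<in> I \<Longrightarrow> x \<in> space (Pi\<^sub>M I M) \<Longrightarrow> \<bar>(\<integral>v. f (x(s := v)) \<partial>M s) - (\<integral>v. f (x(s := v)) \<partial>M' s)\<bar> \<le> \<delta> s"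
  shows "\<bar>(\<integral>x. f x \<partial>Pi\<^sub>M I M) - (\<integral>x. f x \<partial>Pi\<^sub>M I M')\<bar> \<le> (\<Sum>s\<in>I. \<delta> s)"
proof -
  define mix where "mix J i = (if i \<in> J then M' i else M i)" for J i
  have prob_mix: "prob_space (mix J i)" for J i using prob by (simp add: mix_def)
  have sets_mix: "sets (mix J i) = sets (M i)" for J i using sets by (simp add: mix_def)
  have sets_P: "sets (Pi\<^sub>M I (mix J)) = sets (Pi\<^sub>M I M)" for J using sets_mix by (intro sets_PiM_cong) auto
  have space_P: "space (Pi\<^sub>M I (mix J)) = space (Pi\<^sub>M I M)" for J by (rule sets_eq_imp_space_eq[OF sets_P])
  have f_mix: "f \<in> borel_measurable (Pi\<^sub>M I (mix J))" for J using f sets_P by (simp cong: measurable_cong_sets)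
  have "\<bar>(\<integral>x. f x \<partial>Pi\<^sub>M I M) - (\<integral>x. f x \<partial>Pi\<^sub>M I (mix J))\<bar> \<le> (\<Sum>s\<in>J. \<delta> s)" if "finite J" "J \<subseteq> I" for J
    using that
  proof (induction J rule: finite_induct)
    case empty
    have "mix {} = M" by (simp add: mix_def fun_eq_iff)
    thus ?case by simp
  next
    case (insert s J)
    have "\<bar>(\<integral>x. f x \<partial>Pi\<^sub>M I (mix J)) - (\<integral>x. f x \<partial>Pi\<^sub>M I (mix (insert s J)))\<bar> \<le> \<delta> s"
    proof (rule PiM_replace_component[OF I])
      show "s \<in> I" using insert.prems by simp
      show "mix J i = mix (insert s J) i" if "i \<in> I - {s}" for i using that by (simp add: mix_def)
      show "sets (mix J s) = sets (mix (insert s J) s)" by (simp only: sets_mix)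
      show "\<bar>f x\<bar> \<le> B" if "x \<in> space (Pi\<^sub>M I (mix J))" for x using B that unfolding space_P by blast
      have "mix J s = M s" "mix (insert s J) s = M' s" using insert.hyps by (simp_all add: mix_def)
      thus "\<bar>(\<integral>v. f (x(s := v)) \<partial>mix J s) - (\<integral>v. f (x(s := v)) \<partial>mix (insert s J) s)\<bar> \<le> \<delta> s"
        if "x \<in> space (Pi\<^sub>M I (mix J))" for x
        using step[of s x] that insert.prems unfolding space_P by simp
    qed (rule prob_mix f_mix)+
    moreover have "\<bar>(\<integral>x. f x \<partial>Pi\<^sub>M I M) - (\<integral>x. f x \<partial>Pi\<^sub>M I (mix J))\<bar> \<le> (\<Sum>s\<in>J. \<delta> s)"
      using insert by simp
    ultimately show ?case using insert.hyps by (simp add: abs_le_iff)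
  qed
  from this[OF I order_refl] have "\<bar>(\<integral>x. f x \<partial>Pi\<^sub>M I M) - (\<integral>x. f x \<partial>Pi\<^sub>M I (mix I))\<bar> \<le> (\<Sum>s\<in>I. \<delta> s)" .
  moreover have "Pi\<^sub>M I (mix I) = Pi\<^sub>M I M'" by (intro PiM_cong) (simp_all add: mix_def)
  ultimately show ?thesis by simp
qed

text \<open>A measure-preserving map of one factor preserves the product measure. The random second
  layer thereby inherits the Haar invariance of each of its blocks.\<close>

lemma PiM_component_invariant:
  fixes f :: "('i \<Rightarrow> 'a) \<Rightarrow> real"
  assumes I: "finite I" "s \<in> I" and prob: "\<And>i. prob_space (M i)"
    and T: "T \<in> measurable (M s) (M s)" "distr (M s) (M s) T = M s"
    and f: "f \<in> borel_measurable (Pi\<^sub>M I M)" and B: "\<And>x. x \<in> space (Pi\<^sub>M I M) \<Longrightarrow> \<bar>f x\<bar> \<le> B"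
  shows "(\<integral>x. f (x(s := T (x s))) \<partial>Pi\<^sub>M I M) = (\<integral>x. f x \<partial>Pi\<^sub>M I M)"
proof -
  define J where "J = I - {s}"
  have J: "I = insert s J" "s \<notin> J" "finite J" using I by (auto simp: J_def)
  have pI: "prob_space (Pi\<^sub>M K M)" for K using prob by (intro prob_space_PiM)
  have upd: "(\<lambda>x. x(s := T (x s))) \<in> measurable (Pi\<^sub>M I M) (Pi\<^sub>M I M)"
  proof (rule measurable_fun_upd[where J = I])
    show "(\<lambda>x. T (x s)) \<in> measurable (Pi\<^sub>M I M) (M s)"
      by (rule measurable_compose[OF measurable_component_singleton[OF I(2), of M] T(1)])
  qed (use I in auto)
  have f2: "(\<lambda>x. f (x(s := T (x s)))) \<in> borel_measurable (Pi\<^sub>M I M)"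
    by (rule measurable_compose[OF upd f])
  have B2: "\<bar>f (x(s := T (x s)))\<bar> \<le> B" if "x \<in> space (Pi\<^sub>M I M)" for x
    by (rule B[OF measurable_space[OF upd that]])
  note ins = product_sigma_finite.product_integral_insert[OF product_sigma_finite_prob[of M, OF prob] J(3,2)]
  have "(\<integral>x. f (x(s := T (x s))) \<partial>Pi\<^sub>M I M) = (\<integral>x. \<integral>v. f (x(s := T v)) \<partial>M s \<partial>Pi\<^sub>M J M)"
    using ins[OF prob_integrable_bounded[OF pI f2[unfolded J(1)] B2[unfolded J(1)]]] unfolding J(1) by simp
  also have "\<dots> = (\<integral>x. \<integral>v. f (x(s := v)) \<partial>M s \<partial>Pi\<^sub>M J M)"
  proof (rule Bochner_Integration.integral_cong[OF refl])
    fix x assume x: "x \<in> space (Pi\<^sub>M J M)"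
    have "(\<lambda>v. f (x(s := v))) \<in> borel_measurable (M s)"
      by (rule measurable_compose[OF measurable_component_update[OF x J(2)] f[unfolded J(1)]])
    from integral_distr[OF T(1) this] show "(\<integral>v. f (x(s := T v)) \<partial>M s) = (\<integral>v. f (x(s := v)) \<partial>M s)"
      by (simp only: T(2))
  qed
  also have "\<dots> = (\<integral>x. f x \<partial>Pi\<^sub>M I M)"
    using ins[OF prob_integrable_bounded[OF pI f[unfolded J(1)] B[unfolded J(1)]]] unfolding J(1) by simp
  finally show ?thesis .
qed

lemma form_bounded_integral:
  assumes P: "prob_space P" and X: "finite X"
    and c: "\<And>x. x \<in> space P \<Longrightarrow> form_bounded X (c x)"
    and int: "\<And>p q. p \<in> X \<Longrightarrow> q \<in> X \<Longrightarrow> integrable P (\<lambda>x. c x p q)"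
  shows "form_bounded X (\<lambda>p q. \<integral>x. c x p q \<partial>P)"
  unfolding form_bounded_def
proof
  fix v
  have "quad_form X (\<lambda>p q. \<integral>x. c x p q \<partial>P) v = (\<Sum>p\<in>X. \<Sum>q\<in>X. \<integral>x. c x p q * v p * v q \<partial>P)"
    by (simp add: quad_form_def)
  also have "\<dots> = (\<Sum>p\<in>X. \<integral>x. (\<Sum>q\<in>X. c x p q * v p * v q) \<partial>P)"
    using int by (intro sum.cong refl Bochner_Integration.integral_sum[symmetric] integrable_mult_left) auto
  also have "\<dots> = (\<integral>x. quad_form X (c x) v \<partial>P)"
    unfolding quad_form_def
    using int by (intro Bochner_Integration.integral_sum[symmetric] Bochner_Integration.integrable_sum integrable_mult_left) auto
  finally show "\<bar>quad_form X (\<lambda>p q. \<integral>x. c x p q \<partial>P) v\<bar> \<le> (\<Sum>x\<in>X. (v x)\<^sup>2)"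
    using prob_integral_le_const[OF P, of "\<lambda>x. quad_form X (c x) v" "\<Sum>x\<in>X. (v x)\<^sup>2"] c
    by (simp add: form_bounded_def sum_nonneg)
qed

lemma integral_quad_form:
  fixes t :: "'w \<Rightarrow> 'i \<Rightarrow> real"
  assumes int: "\<And>p q. p \<in> S \<Longrightarrow> q \<in> S \<Longrightarrow> integrable P (\<lambda>y. t y p * t y q)"
  shows "(\<integral>y. (\<Sum>p\<in>S. \<Sum>q\<in>S. g p q * (t y p * t y q)) \<partial>P) = (\<Sum>p\<in>S. \<Sum>q\<in>S. g p q * (\<integral>y. t y p * t y q \<partial>P))"
    "integrable P (\<lambda>y. \<Sum>p\<in>S. \<Sum>q\<in>S. g p q * (t y p * t y q))"
proof -
  have i: "integrable P (\<lambda>y. g p q * (t y p * t y q))" if "p \<in> S" "q \<in> S" for p q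
    using int[OF that] by (rule integrable_mult_right)
  have i': "integrable P (\<lambda>y. \<Sum>q\<in>S. g p q * (t y p * t y q))" if "p \<in> S" for p
    using i[OF that] by (rule Bochner_Integration.integrable_sum)
  show "integrable P (\<lambda>y. \<Sum>p\<in>S. \<Sum>q\<in>S. g p q * (t y p * t y q))"
    using i' by (rule Bochner_Integration.integrable_sum)
  have "(\<integral>y. (\<Sum>p\<in>S. \<Sum>q\<in>S. g p q * (t y p * t y q)) \<partial>P) = (\<Sum>p\<in>S. \<integral>y. (\<Sum>q\<in>S. g p q * (t y p * t y q)) \<partial>P)"
    using i' by (rule Bochner_Integration.integral_sum)
  also have "\<dots> = (\<Sum>p\<in>S. \<Sum>q\<in>S. \<integral>y. g p q * (t y p * t y q) \<partial>P)"
    using i by (intro sum.cong refl Bochner_Integration.integral_sum)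
  also have "\<dots> = (\<Sum>p\<in>S. \<Sum>q\<in>S. g p q * (\<integral>y. t y p * t y q \<partial>P))"
    by simp
  finally show "(\<integral>y. (\<Sum>p\<in>S. \<Sum>q\<in>S. g p q * (t y p * t y q)) \<partial>P) = (\<Sum>p\<in>S. \<Sum>q\<in>S. g p q * (\<integral>y. t y p * t y q \<partial>P))" .
qed

text \<open>\<open>form_pairing_PSD\<close> holds for every outcome \<open>y\<close>, hence in
  expectation. This supplies the positivity hypotheses of
  \<open>pairing_difference_le\<close>.\<close>

lemma second_moment_pairing_le:
  fixes t :: "'w \<Rightarrow> 'i \<Rightarrow> real"
  assumes g: "form_bounded X g" and X: "finite X" "S \<subseteq> X"
    and int: "\<And>p q. p \<in> X \<Longrightarrow> q \<in> X \<Longrightarrow> integrable P (\<lambda>y. t y p * t y q)"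
  shows "\<bar>\<Sum>p\<in>S. \<Sum>q\<in>S. g p q * (\<integral>y. t y p * t y q \<partial>P)\<bar> \<le> (\<Sum>p\<in>S. \<integral>y. t y p * t y p \<partial>P)"
proof -
  have int': "integrable P (\<lambda>y. t y p * t y q)" if "p \<in> S" "q \<in> S" for p q
    using that X(2) by (intro int) auto
  have eq: "(\<integral>y. (\<Sum>p\<in>S. \<Sum>q\<in>S. g p q * (t y p * t y q)) \<partial>P) = (\<Sum>p\<in>S. \<Sum>q\<in>S. g p q * (\<integral>y. t y p * t y q \<partial>P))"
    by (rule integral_quad_form(1)[OF int'])
  have "\<bar>\<Sum>p\<in>S. \<Sum>q\<in>S. g p q * (\<integral>y. t y p * t y q \<partial>P)\<bar>
      \<le> (\<integral>y. \<bar>\<Sum>p\<in>S. \<Sum>q\<in>S. g p q * (t y p * t y q)\<bar> \<partial>P)"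
    unfolding eq[symmetric] by (rule integral_abs_bound)
  also have "\<dots> \<le> (\<integral>y. (\<Sum>p\<in>S. t y p * t y p) \<partial>P)"
  proof (rule integral_mono)
    show "integrable P (\<lambda>y. \<bar>\<Sum>p\<in>S. \<Sum>q\<in>S. g p q * (t y p * t y q)\<bar>)"
      by (rule integrable_abs[OF integral_quad_form(2)[OF int']])
    show "integrable P (\<lambda>y. \<Sum>p\<in>S. t y p * t y p)"
      using int' by (intro Bochner_Integration.integrable_sum)
    show "\<bar>\<Sum>p\<in>S. \<Sum>q\<in>S. g p q * (t y p * t y q)\<bar> \<le> (\<Sum>p\<in>S. t y p * t y p)" for y
      using form_pairing_PSD[OF g X, of "t y"] by (simp add: power2_eq_square)
  qed
  also have "\<dots> = (\<Sum>p\<in>S. \<integral>y. t y p * t y p \<partial>P)"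
    using int' by (intro Bochner_Integration.integral_sum)
  finally show ?thesis .
qed

lemma quad_form_tensor: "quad_form X w t = (\<Sum>p\<in>X. \<Sum>q\<in>X. w p q * (t p * t q))"
  by (simp add: quad_form_def mult.assoc)

lemma quad_form_le:
  "form_bounded X w \<Longrightarrow> (\<Sum>x\<in>X. (t x)\<^sup>2) = 1 \<Longrightarrow> \<bar>quad_form X w t\<bar> \<le> 1"
  by (metis form_bounded_def)

lemma sign_matrix:
  fixes \<sigma> :: "nat \<Rightarrow> real" and D :: nat
  assumes \<sigma>: "\<And>a. \<sigma> a * \<sigma> a = 1"
  defines "V \<equiv> mat D D (\<lambda>(i, j). complex_of_real (\<sigma> i * of_bool (i = j)))"
  shows "V \<in> orthogonal_group D"
    "U \<in> orthogonal_group D \<Longrightarrow> i < D \<Longrightarrow> j < D \<Longrightarrow> re_entry (U * V) i j = re_entry U i j * \<sigma> j"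
proof -
  have "(\<Sum>i<D. \<sigma> i * of_bool (i = j) * (\<sigma> i * of_bool (i = l))) = of_bool (j = l)" if "j < D" for j l
  proof -
    have "(\<Sum>i<D. \<sigma> i * of_bool (i = j) * (\<sigma> i * of_bool (i = l))) = (\<Sum>i<D. if i = j then of_bool (j = l) else 0)"
      using \<sigma> by (intro sum.cong refl) auto
    thus ?thesis using that by simp
  qed
  thus V: "V \<in> orthogonal_group D"
    unfolding V_def by (intro real_mat_orthogonal) (simp add: orthonormal_columns_def)
  assume U: "U \<in> orthogonal_group D" and ij: "i < D" "j < D"
  have "re_entry (U * V) i j = (\<Sum>l<D. re_entry U i l * (\<sigma> l * of_bool (l = j)))"
    unfolding re_entry_mult[OF U V ij] unfolding V_def
    using re_entry_mat[OF _ ij(2), of _ "\<lambda>i j. \<sigma> i * of_bool (i = j)"] by (intro sum.cong refl) simp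
  also have "\<dots> = (\<Sum>l<D. if l = j then re_entry U i j * \<sigma> j else 0)" by (intro sum.cong refl) auto
  finally show "re_entry (U * V) i j = re_entry U i j * \<sigma> j" using ij by simp
qed

lemma prod_single_sign:
  fixes k l0 :: nat
  assumes "inj_on f {..<k}" "l0 < k"
  shows "(\<Prod>l<k. if f l = f l0 then -1 else 1 :: real) = -1"
proof -
  have "(\<Prod>l<k. if f l = f l0 then -1 else 1 :: real) = (\<Prod>l<k. if l = l0 then -1 else 1)"
    using assms by (intro prod.cong refl) (auto simp: inj_on_eq_iff)
  also have "\<dots> = -1" using assms(2) prod.delta[of "{..<k}" l0 "\<lambda>_. -1 :: real"] by simp
  finally show ?thesis .
qed

lemma PiM_entry_measurable:
  assumes "\<And>i. i \<in> I \<Longrightarrow> orthogonal_ensemble D (E i)" "s \<in> I" "i < D" "j < D"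
  shows "(\<lambda>U. re_entry (U s) i j) \<in> borel_measurable (Pi\<^sub>M I E)"
  by (rule measurable_compose[OF measurable_component_singleton[OF assms(2), of E] re_entry_measurable[OF assms(1)[OF assms(2)] assms(3,4)]])

lemma PiM_orthogonal:
  assumes "\<And>i. i \<in> I \<Longrightarrow> orthogonal_ensemble D (E i)" "U \<in> space (Pi\<^sub>M I E)" "s \<in> I"
  shows "U s \<in> orthogonal_group D"
proof -
  have "U s \<in> space (E s)" using assms(2,3) by (auto simp: space_PiM)
  thus ?thesis using space_ensemble[OF assms(1)[OF assms(3)]] by simp
qed

context superblock_brickwork
begin

lemma real_layer_measurable:
  assumes E: "\<And>s. s \<in> I \<Longrightarrow> orthogonal_ensemble D (E s)" and I: "{s. s < m \<and> even s = b} \<subseteq> I"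
  shows "(\<lambda>U. real_layer b U i j) \<in> borel_measurable (Pi\<^sub>M I E)"
  unfolding real_layer_def
  using I by (intro borel_measurable_prod PiM_entry_measurable[OF E] block_val_less) auto

lemma real_state_measurable:
  assumes E: "\<And>s. s < m \<Longrightarrow> orthogonal_ensemble D (E s)"
  shows "(\<lambda>U. real_state U i) \<in> borel_measurable (Pi\<^sub>M {..<m} E)"
proof -
  have E': "orthogonal_ensemble D (E s)" if "s \<in> {..<m}" for s using E that by simp
  have l: "(\<lambda>U. real_layer b U i j) \<in> borel_measurable (Pi\<^sub>M {..<m} E)" for b i j
    by (rule real_layer_measurable[OF E']) auto
  show ?thesis
    unfolding real_state_def by (intro borel_measurable_sum borel_measurable_times l)
qed

text \<open>The state between the two layers: the first layer acts on the zero state, so only its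
  column 0 matters.\<close>

definition first_state :: "(nat \<Rightarrow> complex mat) \<Rightarrow> nat \<Rightarrow> real" where
  "first_state U i = real_layer True U i 0"

lemma first_state_prod: "first_state U i = (\<Prod>s\<in>evens. haar_column (U s) (block_val s i))"
  by (simp add: first_state_def real_layer_def block_val_0)

lemma first_state_norm:
  assumes "\<And>s. s \<in> evens \<Longrightarrow> U s \<in> orthogonal_group D"
  shows "(\<Sum>i<N. (first_state U i)\<^sup>2) = 1"
proof -
  have "orthonormal_columns N (real_layer True U)" using assms by (intro real_layer_orthonormal) auto
  thus ?thesis by (simp add: orthonormal_columns_def first_state_def power2_eq_square)
qed

lemma real_state_apply: "real_state U = (\<lambda>i. \<Sum>j<N. real_layer False U i j * first_state U j)"
  by (simp add: fun_eq_iff real_state_def first_state_def)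

lemma real_state_norm:
  assumes "\<And>s. s < m \<Longrightarrow> U s \<in> orthogonal_group D"
  shows "(\<Sum>i<N. (real_state U i)\<^sup>2) = 1"
proof -
  have "orthonormal_columns N (re_entry (brickwork m \<xi> U))"
    by (rule orthonormal_columns_re_entry[OF brickwork_orthogonal[OF assms]])
  hence "(\<Sum>i<N. (re_entry (brickwork m \<xi> U) i 0)\<^sup>2) = 1"
    by (simp add: orthonormal_columns_def power2_eq_square)
  moreover have "(\<Sum>i<N. (re_entry (brickwork m \<xi> U) i 0)\<^sup>2) = (\<Sum>i<N. (real_state U i)\<^sup>2)"
    by (intro sum.cong refl) (simp add: brickwork_column(2)[OF assms])
  ultimately show ?thesis by simp
qed

lemma tensor_norm:
  assumes "(\<Sum>i<N. (\<psi> i)\<^sup>2) = 1"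
  shows "(\<Sum>x\<in>X. (tensor_vec k \<psi> x)\<^sup>2) = 1"
  by (simp only: sum_tensor_vec_square assms power_one)

lemma unit_entry_le:
  fixes \<psi> :: "nat \<Rightarrow> real"
  assumes "(\<Sum>i<N. (\<psi> i)\<^sup>2) = 1" "i < N"
  shows "\<bar>\<psi> i\<bar> \<le> 1"
proof -
  have "(\<psi> i)\<^sup>2 \<le> (\<Sum>i<N. (\<psi> i)\<^sup>2)" using assms(2) by (intro member_le_sum) auto
  thus ?thesis by (simp add: assms(1) abs_square_le_1)
qed

lemma tensor_pair_integrable:
  assumes P: "prob_space P" and \<psi>: "\<And>y. y \<in> space P \<Longrightarrow> (\<Sum>i<N. (\<psi> y i)\<^sup>2) = 1"
    and meas: "\<And>i. i < N \<Longrightarrow> (\<lambda>y. \<psi> y i) \<in> borel_measurable P" and pq: "p \<in> X" "q \<in> X"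
  shows "integrable P (\<lambda>y. tensor_vec k (\<psi> y) p * tensor_vec k (\<psi> y) q)"
proof (rule prob_integrable_bounded[OF P, where B = 1])
  have m: "(\<lambda>y. tensor_vec k (\<psi> y) x) \<in> borel_measurable P" if "x \<in> X" for x
    unfolding tensor_vec_def using copies_less[OF that] by (intro borel_measurable_prod meas) auto
  show "(\<lambda>y. tensor_vec k (\<psi> y) p * tensor_vec k (\<psi> y) q) \<in> borel_measurable P"
    using m[OF pq(1)] m[OF pq(2)] by (rule borel_measurable_times)
  fix y assume y: "y \<in> space P"
  have "\<bar>tensor_vec k (\<psi> y) x\<bar> \<le> 1" if "x \<in> X" for x
    by (rule tensor_vec_le_1[where D = N, OF unit_entry_le[OF \<psi>[OF y]] copies_less[OF that]])
  from this[OF pq(1)] this[OF pq(2)]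
  show "\<bar>tensor_vec k (\<psi> y) p * tensor_vec k (\<psi> y) q\<bar> \<le> 1"
    by (simp add: abs_mult mult_le_one)
qed

text \<open>The expectation of \<open>bad_mass_le\<close>: there are \<open>k * (k - 1)\<close>
  ordered pairs and \<open>m\<close> patches, and each of them contributes at most
  \<open>\<beta>\<close>.\<close>

lemma bad_mass_integral_le:
  assumes P: "prob_space P" and \<psi>: "\<And>y. y \<in> space P \<Longrightarrow> (\<Sum>i<N. (\<psi> y i)\<^sup>2) = 1"
    and meas: "\<And>i. i < N \<Longrightarrow> (\<lambda>y. \<psi> y i) \<in> borel_measurable P"
    and \<beta>: "\<And>t. t < m \<Longrightarrow> (\<integral>y. (\<Sum>a<N. \<Sum>b<N. of_bool (agree_on (patch t) a b) * ((\<psi> y a)\<^sup>2 * (\<psi> y b)\<^sup>2)) \<partial>P) \<le> \<beta>"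
  shows "(\<Sum>x\<in>X - good. \<integral>y. tensor_vec k (\<psi> y) x * tensor_vec k (\<psi> y) x \<partial>P) \<le> real (k * (k - 1) * m) * \<beta>"
proof -
  define F where "F t y = (\<Sum>a<N. \<Sum>b<N. of_bool (agree_on (patch t) a b) * ((\<psi> y a)\<^sup>2 * (\<psi> y b)\<^sup>2))" for t y
  have int2: "integrable P (\<lambda>y. (\<psi> y a)\<^sup>2 * (\<psi> y b)\<^sup>2)" if ab: "a < N" "b < N" for a b
  proof (rule prob_integrable_bounded[OF P, where B = 1])
    show "(\<lambda>y. (\<psi> y a)\<^sup>2 * (\<psi> y b)\<^sup>2) \<in> borel_measurable P"
      using meas[OF ab(1)] meas[OF ab(2)] by measurable
    fix y assume "y \<in> space P"
    hence "(\<psi> y a)\<^sup>2 \<le> 1" "(\<psi> y b)\<^sup>2 \<le> 1"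
      using unit_entry_le[OF \<psi>] ab by (simp_all add: abs_square_le_1)
    thus "\<bar>(\<psi> y a)\<^sup>2 * (\<psi> y b)\<^sup>2\<bar> \<le> 1" by (simp add: mult_le_one)
  qed
  have intF: "integrable P (F t)" for t
    unfolding F_def[abs_def] by (intro Bochner_Integration.integrable_sum integrable_mult_right int2) auto
  have intT: "integrable P (\<lambda>y. tensor_vec k (\<psi> y) x * tensor_vec k (\<psi> y) x)" if "x \<in> X" for x
    by (rule tensor_pair_integrable[OF P \<psi> meas that that])
  have "(\<Sum>x\<in>X - good. \<integral>y. tensor_vec k (\<psi> y) x * tensor_vec k (\<psi> y) x \<partial>P)
      = (\<integral>y. (\<Sum>x\<in>X - good. tensor_vec k (\<psi> y) x * tensor_vec k (\<psi> y) x) \<partial>P)"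
    using intT by (intro Bochner_Integration.integral_sum[symmetric]) auto
  also have "\<dots> \<le> (\<integral>y. (\<Sum>l<k. \<Sum>l'\<in>{..<k} - {l}. \<Sum>t<m. F t y) \<partial>P)"
  proof (rule integral_mono)
    show "integrable P (\<lambda>y. \<Sum>x\<in>X - good. tensor_vec k (\<psi> y) x * tensor_vec k (\<psi> y) x)"
      using intT by (intro Bochner_Integration.integrable_sum) auto
    show "integrable P (\<lambda>y. \<Sum>l<k. \<Sum>l'\<in>{..<k} - {l}. \<Sum>t<m. F t y)"
      by (intro Bochner_Integration.integrable_sum intF)
    show "(\<Sum>x\<in>X - good. tensor_vec k (\<psi> y) x * tensor_vec k (\<psi> y) x) \<le> (\<Sum>l<k. \<Sum>l'\<in>{..<k} - {l}. \<Sum>t<m. F t y)"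
      if "y \<in> space P" for y
      using bad_mass_le[OF \<psi>[OF that]] unfolding F_def power2_eq_square[of "tensor_vec _ _ _"] .
  qed
  also have "\<dots> = (\<Sum>l<k. \<Sum>l'\<in>{..<k} - {l}. \<Sum>t<m. \<integral>y. F t y \<partial>P)"
    by (subst Bochner_Integration.integral_sum, intro Bochner_Integration.integrable_sum intF,
        rule sum.cong[OF refl], subst Bochner_Integration.integral_sum, intro Bochner_Integration.integrable_sum intF,
        rule sum.cong[OF refl], subst Bochner_Integration.integral_sum, rule intF, rule refl)
  also have "\<dots> \<le> (\<Sum>l<k. \<Sum>l'\<in>{..<k} - {l}. \<Sum>t<m. \<beta>)"
    using \<beta> unfolding F_def by (intro sum_mono) auto
  also have "\<dots> = real (k * (k - 1) * m) * \<beta>" by (cases k) (simp_all add: card_Diff_singleton algebra_simps)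
  finally show ?thesis .
qed

end

locale haar_brickwork = superblock_brickwork +
  fixes Hb HN :: "complex mat measure"
  assumes Hb: "haar_orthogonal (2 ^ (2 * \<xi>)) Hb" and HN: "haar_orthogonal (2 ^ (m * \<xi>)) HN"
begin

abbreviation "P0 \<equiv> Pi\<^sub>M evens (\<lambda>_. Hb)"
abbreviation "P1 \<equiv> Pi\<^sub>M odds (\<lambda>_. Hb)"

lemma orthogonal_ensembles: "orthogonal_ensemble D Hb" "orthogonal_ensemble N HN"
  using Hb HN by (simp_all add: haar_orthogonal_def)

lemma prob_Hb: "prob_space Hb" and prob_HN: "prob_space HN"
  using orthogonal_ensembles by (simp_all add: orthogonal_ensemble_def)

lemma prob_P: "prob_space (Pi\<^sub>M I (\<lambda>_. Hb))"
  by (intro prob_space_PiM prob_Hb)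

definition layer_moment :: "(nat \<Rightarrow> nat) \<Rightarrow> (nat \<Rightarrow> nat) \<Rightarrow> real" where
  "layer_moment p q = (\<integral>y. tensor_vec k (first_state y) p * tensor_vec k (first_state y) q \<partial>P0)"

lemma P0_orthogonal: "y \<in> space P0 \<Longrightarrow> s \<in> evens \<Longrightarrow> y s \<in> orthogonal_group D"
  by (rule PiM_orthogonal[where E = "\<lambda>_. Hb", OF orthogonal_ensembles(1)])

lemma P1_orthogonal: "x \<in> space P1 \<Longrightarrow> s < m \<Longrightarrow> even s = False \<Longrightarrow> x s \<in> orthogonal_group D"
  by (rule PiM_orthogonal[where E = "\<lambda>_. Hb" and I = odds, OF orthogonal_ensembles(1)]) auto

lemma first_state_unit: "y \<in> space P0 \<Longrightarrow> (\<Sum>i<N. (first_state y i)\<^sup>2) = 1"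
  by (rule first_state_norm[OF P0_orthogonal])

lemma first_state_measurable: "(\<lambda>y. first_state y i) \<in> borel_measurable P0"
  unfolding first_state_def by (rule real_layer_measurable[OF orthogonal_ensembles(1)]) simp

lemma first_pair_integrable:
  "p \<in> X \<Longrightarrow> q \<in> X \<Longrightarrow> integrable P0 (\<lambda>y. tensor_vec k (first_state y) p * tensor_vec k (first_state y) q)"
  by (rule tensor_pair_integrable[OF prob_P first_state_unit first_state_measurable])

text \<open>The superblocks of the first layer are independent, and the entries of
  \<open>first_state\<close> are products over the even blocks, so every moment factorizes into
  block moments.\<close>

lemma layer_moment_prod:
  "layer_moment p q = (\<Prod>s\<in>evens. moment Hb k (\<lambda>l. block_val s (p l)) (\<lambda>l. block_val s (q l)))"
proof -
  have t: "tensor_vec k (first_state y) p = (\<Prod>s\<in>evens. tensor_vec k (haar_column (y s)) (\<lambda>l. block_val s (p l)))" for y p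
    unfolding tensor_vec_def first_state_prod by (rule prod.swap)
  have "layer_moment p q = (\<integral>y. (\<Prod>s\<in>evens. tensor_vec k (haar_column (y s)) (\<lambda>l. block_val s (p l))
      * tensor_vec k (haar_column (y s)) (\<lambda>l. block_val s (q l))) \<partial>P0)"
    unfolding layer_moment_def t prod.distrib ..
  also have "\<dots> = (\<Prod>s\<in>evens. \<integral>U. tensor_vec k (haar_column U) (\<lambda>l. block_val s (p l))
      * tensor_vec k (haar_column U) (\<lambda>l. block_val s (q l)) \<partial>Hb)"
  proof (rule product_sigma_finite.product_integral_prod[OF product_sigma_finite_prob[of "\<lambda>_. Hb", OF prob_Hb]])
    fix s
    have D0: "D > 0" by simp
    show "integrable Hb (\<lambda>U. tensor_vec k (haar_column U) (\<lambda>l. block_val s (p l))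
      * tensor_vec k (haar_column U) (\<lambda>l. block_val s (q l)))"
    proof (rule prob_integrable_bounded[OF prob_Hb, where B = 1])
      show "(\<lambda>U. tensor_vec k (haar_column U) (\<lambda>l. block_val s (p l))
          * tensor_vec k (haar_column U) (\<lambda>l. block_val s (q l))) \<in> borel_measurable Hb"
        by (intro borel_measurable_times tensor_vec_measurable[OF orthogonal_ensembles(1) D0] block_val_less)
      fix U assume "U \<in> space Hb"
      hence U: "U \<in> orthogonal_group D" by (simp add: space_ensemble[OF orthogonal_ensembles(1)])
      have "\<bar>tensor_vec k (haar_column U) (\<lambda>l. block_val s (x l))\<bar> \<le> 1" for x
        by (rule tensor_vec_le_1[where D = D, OF haar_column_le_1[OF U] block_val_less])
      thus "\<bar>tensor_vec k (haar_column U) (\<lambda>l. block_val s (p l))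
          * tensor_vec k (haar_column U) (\<lambda>l. block_val s (q l))\<bar> \<le> 1"
        by (simp add: abs_mult mult_le_one)
    qed
  qed simp
  finally show ?thesis by (simp only: moment_def)
qed

lemma layer_moment_eq_0:
  assumes p: "p \<in> good" and s: "s \<in> evens"
    and r: "\<not> (\<lambda>l. block_val s (p l)) ` {..<k} \<subseteq> (\<lambda>l. block_val s (q l)) ` {..<k}"
  shows "layer_moment p q = 0" "layer_moment q p = 0"
proof -
  obtain l0 where l0: "l0 < k" "block_val s (p l0) \<notin> (\<lambda>l. block_val s (q l)) ` {..<k}" using r by auto
  have sm: "s < m" using s by simp
  have "moment Hb k (\<lambda>l. block_val s (p l)) (\<lambda>l. block_val s (q l)) = 0"
    by (rule moment_eq_0[OF Hb _ block_val_less block_val_less good_block_inj[OF p sm] l0]) simp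
  hence "\<exists>s\<in>evens. moment Hb k (\<lambda>l. block_val s (p l)) (\<lambda>l. block_val s (q l)) = 0"
    using s by (rule bexI)
  thus "layer_moment p q = 0" unfolding layer_moment_prod by (intro prod_zero) simp_all
  thus "layer_moment q p = 0" by (simp only: layer_moment_def mult.commute)
qed

lemma layer_moment_same_range:
  assumes p: "p \<in> good" and r: "p ` {..<k} = q ` {..<k}"
  shows "layer_moment p q = layer_moment p p"
  unfolding layer_moment_prod
proof (intro prod.cong refl)
  fix s assume "s \<in> evens"
  hence s: "s < m" by simp
  have "(\<lambda>l. block_val s (q l)) ` {..<k} = (\<lambda>l. block_val s (p l)) ` {..<k}"
    unfolding image_image[of "block_val s" q, symmetric] image_image[of "block_val s" p, symmetric] r ..
  thus "moment Hb k (\<lambda>l. block_val s (p l)) (\<lambda>l. block_val s (q l))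
      = moment Hb k (\<lambda>l. block_val s (p l)) (\<lambda>l. block_val s (p l))"
    by (rule moment_same_range[OF good_block_inj[OF p s]])
qed

lemma layer_moment_diag:
  assumes p: "p \<in> good" and q: "q \<in> good"
  shows "layer_moment p p = layer_moment q q"
  unfolding layer_moment_prod
proof (intro prod.cong refl)
  fix s assume "s \<in> evens"
  hence s: "s < m" by simp
  show "moment Hb k (\<lambda>l. block_val s (p l)) (\<lambda>l. block_val s (p l))
      = moment Hb k (\<lambda>l. block_val s (q l)) (\<lambda>l. block_val s (q l))"
    by (rule moment_diag_eq[OF Hb _ block_val_less good_block_inj[OF p s] block_val_less good_block_inj[OF q s]]) simp
qed

lemma layer_moment_trace: "(\<Sum>x\<in>X. layer_moment x x) = 1"
proof -
  interpret prob_space P0 by (rule prob_P)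
  have "(\<Sum>x\<in>X. layer_moment x x) = (\<integral>y. (\<Sum>x\<in>X. tensor_vec k (first_state y) x * tensor_vec k (first_state y) x) \<partial>P0)"
    unfolding layer_moment_def by (rule Bochner_Integration.integral_sum[symmetric]) (rule first_pair_integrable)
  also have "\<dots> = (\<integral>y. 1 \<partial>P0)"
    by (rule Bochner_Integration.integral_cong[OF refl])
      (simp add: tensor_norm[OF first_state_unit, unfolded power2_eq_square])
  also have "\<dots> = 1" by (simp only: lebesgue_integral_const prob_space real_scaleR_def mult_1)
  finally show ?thesis .
qed

lemma haar_moment_trace: "(\<Sum>x\<in>X. moment HN k x x) = 1"
proof -
  interpret prob_space HN by (rule prob_HN)
  have u: "(\<Sum>i<N. (haar_column U i)\<^sup>2) = 1" if "U \<in> space HN" for U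
    using that by (intro haar_column_norm) (simp_all add: space_ensemble[OF orthogonal_ensembles(2)])
  have m: "(\<lambda>U. haar_column U i) \<in> borel_measurable HN" if "i < N" for i
    by (rule re_entry_measurable[OF orthogonal_ensembles(2) that]) simp
  have "(\<Sum>x\<in>X. moment HN k x x) = (\<integral>U. (\<Sum>x\<in>X. tensor_vec k (haar_column U) x * tensor_vec k (haar_column U) x) \<partial>HN)"
    unfolding moment_def
    by (rule Bochner_Integration.integral_sum[symmetric]) (rule tensor_pair_integrable[OF prob_HN u m])
  also have "\<dots> = (\<integral>U. 1 \<partial>HN)"
    by (rule Bochner_Integration.integral_cong[OF refl])
      (simp add: tensor_norm[OF u, unfolded power2_eq_square])
  finally show ?thesis by (simp add: prob_space)
qed

lemma haar_bad_mass: "(\<Sum>x\<in>X - good. moment HN k x x) \<le> real (k * (k - 1) * m) * (3 / 2 ^ \<xi>)"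
  unfolding moment_def
proof (rule bad_mass_integral_le[OF prob_HN])
  show "(\<Sum>i<N. (haar_column U i)\<^sup>2) = 1" if "U \<in> space HN" for U
    using that by (intro haar_column_norm) (simp_all add: space_ensemble[OF orthogonal_ensembles(2)])
  show "(\<lambda>U. haar_column U i) \<in> borel_measurable HN" if "i < N" for i
    by (rule re_entry_measurable[OF orthogonal_ensembles(2) that]) simp
  fix t assume t: "t < m"
  have i: "integrable HN (\<lambda>U. of_bool (agree_on (patch t) a b) * ((haar_column U a)\<^sup>2 * (haar_column U b)\<^sup>2))"
    if "a < N" "b < N" for a b
    by (intro integrable_mult_right fourth_moment_integrable[OF orthogonal_ensembles(2)] that)
  have "(\<integral>U. (\<Sum>a<N. \<Sum>b<N. of_bool (agree_on (patch t) a b) * ((haar_column U a)\<^sup>2 * (haar_column U b)\<^sup>2)) \<partial>HN)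
      = (\<Sum>a<N. \<integral>U. (\<Sum>b<N. of_bool (agree_on (patch t) a b) * ((haar_column U a)\<^sup>2 * (haar_column U b)\<^sup>2)) \<partial>HN)"
    by (intro Bochner_Integration.integral_sum Bochner_Integration.integrable_sum i) auto
  also have "\<dots> = (\<Sum>a<N. \<Sum>b<N. of_bool (agree_on (patch t) a b) * fourth_moment HN a b)"
  proof (rule sum.cong[OF refl])
    fix a assume "a \<in> {..<N}"
    hence "(\<integral>U. (\<Sum>b<N. of_bool (agree_on (patch t) a b) * ((haar_column U a)\<^sup>2 * (haar_column U b)\<^sup>2)) \<partial>HN)
        = (\<Sum>b<N. \<integral>U. of_bool (agree_on (patch t) a b) * ((haar_column U a)\<^sup>2 * (haar_column U b)\<^sup>2) \<partial>HN)"
      by (intro Bochner_Integration.integral_sum i) auto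
    thus "(\<integral>U. (\<Sum>b<N. of_bool (agree_on (patch t) a b) * ((haar_column U a)\<^sup>2 * (haar_column U b)\<^sup>2)) \<partial>HN)
        = (\<Sum>b<N. of_bool (agree_on (patch t) a b) * fourth_moment HN a b)"
      by (simp add: fourth_moment_def)
  qed
  also have "\<dots> \<le> 3 / 2 ^ card (patch t)"
  proof (rule haar_collision_le[OF HN])
    show "patch t \<subseteq> {..<m * \<xi>}"
      using patch_subset_block(1)[OF t] block_qubits_subset[OF xi_pos t] by (rule subset_trans)
  qed
  also have "card (patch t) = \<xi>" by (simp add: patch_def)
  finally show "(\<integral>U. (\<Sum>a<N. \<Sum>b<N. of_bool (agree_on (patch t) a b) * ((haar_column U a)\<^sup>2 * (haar_column U b)\<^sup>2)) \<partial>HN)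
      \<le> 3 / 2 ^ \<xi>" .
qed

lemma P0_component_fourth_moment:
  assumes e: "e \<in> evens" and ab: "a < D" "b < D"
  shows "integrable P0 (\<lambda>y. (haar_column (y e) a)\<^sup>2 * (haar_column (y e) b)\<^sup>2)"
    "(\<integral>y. (haar_column (y e) a)\<^sup>2 * (haar_column (y e) b)\<^sup>2 \<partial>P0) = fourth_moment Hb a b"
proof -
  have d: "distr P0 Hb (\<lambda>y. y e) = Hb"
    using distr_PiM_component[of evens "\<lambda>_. Hb" e] prob_Hb e by simp
  have m: "(\<lambda>y. y e) \<in> measurable P0 Hb" using measurable_component_singleton[OF e, of "\<lambda>_. Hb"] .
  have i: "integrable Hb (\<lambda>U. (haar_column U a)\<^sup>2 * (haar_column U b)\<^sup>2)"
    by (rule fourth_moment_integrable[OF orthogonal_ensembles(1) ab])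
  show "integrable P0 (\<lambda>y. (haar_column (y e) a)\<^sup>2 * (haar_column (y e) b)\<^sup>2)"
    using integrable_distr_eq[OF m borel_measurable_integrable[OF i]] i by (simp only: d)
  show "(\<integral>y. (haar_column (y e) a)\<^sup>2 * (haar_column (y e) b)\<^sup>2 \<partial>P0) = fourth_moment Hb a b"
    using integral_distr[OF m borel_measurable_integrable[OF i]] by (simp only: d fourth_moment_def)
qed

text \<open>A collision on patch \<open>t\<close> concerns only the even block \<open>e\<close> that
  contains it; the other blocks drop out by normalization. What remains is the collision bound for
  one Haar-random block column on a set \<open>S\<close> of \<open>\<xi>\<close> qubits.\<close>

lemma layer_bad_mass: "(\<Sum>x\<in>X - good. layer_moment x x) \<le> real (k * (k - 1) * m) * (3 / 2 ^ \<xi>)"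
  unfolding layer_moment_def
proof (rule bad_mass_integral_le[OF prob_P first_state_unit first_state_measurable])
  fix t assume t: "t < m"
  define e where "e = t - t mod 2"
  define S where "S = {t mod 2 * \<xi>..<t mod 2 * \<xi> + \<xi>}"
  note e = agree_patch_even_block[OF t, folded e_def S_def]
  have i: "integrable P0 (\<lambda>y. of_bool (agree_on S a b) * ((haar_column (y e) a)\<^sup>2 * (haar_column (y e) b)\<^sup>2))"
    if "a < D" "b < D" for a b
    by (intro integrable_mult_right P0_component_fourth_moment(1) e(1) that)
  have "(\<integral>y. (\<Sum>a<N. \<Sum>b<N. of_bool (agree_on (patch t) a b) * ((first_state y a)\<^sup>2 * (first_state y b)\<^sup>2)) \<partial>P0)
      = (\<integral>y. (\<Sum>a<D. \<Sum>b<D. of_bool (agree_on S a b) * ((haar_column (y e) a)\<^sup>2 * (haar_column (y e) b)\<^sup>2)) \<partial>P0)"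
  proof (rule Bochner_Integration.integral_cong[OF refl])
    fix y assume y: "y \<in> space P0"
    have n: "(\<Sum>a<D. (haar_column (y s) a)\<^sup>2) = 1" if "s \<in> evens" for s
      by (rule haar_column_norm[OF P0_orthogonal[OF y that]]) simp
    show "(\<Sum>a<N. \<Sum>b<N. of_bool (agree_on (patch t) a b) * ((first_state y a)\<^sup>2 * (first_state y b)\<^sup>2))
      = (\<Sum>a<D. \<Sum>b<D. of_bool (agree_on S a b) * ((haar_column (y e) a)\<^sup>2 * (haar_column (y e) b)\<^sup>2))"
      unfolding first_state_prod prod_power_distrib e_def S_def
      by (rule sum_even_blocks_pair[of "\<lambda>s a. (haar_column (y s) a)\<^sup>2", OF n t])
  qed
  also have "\<dots> = (\<Sum>a<D. \<integral>y. (\<Sum>b<D. of_bool (agree_on S a b) * ((haar_column (y e) a)\<^sup>2 * (haar_column (y e) b)\<^sup>2)) \<partial>P0)"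
    by (intro Bochner_Integration.integral_sum Bochner_Integration.integrable_sum i) auto
  also have "\<dots> = (\<Sum>a<D. \<Sum>b<D. of_bool (agree_on S a b) * fourth_moment Hb a b)"
  proof (rule sum.cong[OF refl])
    fix a assume a: "a \<in> {..<D}"
    hence "(\<integral>y. (\<Sum>b<D. of_bool (agree_on S a b) * ((haar_column (y e) a)\<^sup>2 * (haar_column (y e) b)\<^sup>2)) \<partial>P0)
        = (\<Sum>b<D. \<integral>y. of_bool (agree_on S a b) * ((haar_column (y e) a)\<^sup>2 * (haar_column (y e) b)\<^sup>2) \<partial>P0)"
      by (intro Bochner_Integration.integral_sum i) auto
    also have "\<dots> = (\<Sum>b<D. of_bool (agree_on S a b) * fourth_moment Hb a b)"
    proof (rule sum.cong[OF refl])
      fix b assume "b \<in> {..<D}"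
      with a have "a < D" "b < D" by simp_all
      thus "(\<integral>y. of_bool (agree_on S a b) * ((haar_column (y e) a)\<^sup>2 * (haar_column (y e) b)\<^sup>2) \<partial>P0)
          = of_bool (agree_on S a b) * fourth_moment Hb a b"
        by (simp only: Bochner_Integration.integral_mult_right_zero P0_component_fourth_moment(2)[OF e(1)])
    qed
    finally show "(\<integral>y. (\<Sum>b<D. of_bool (agree_on S a b) * ((haar_column (y e) a)\<^sup>2 * (haar_column (y e) b)\<^sup>2)) \<partial>P0)
        = (\<Sum>b<D. of_bool (agree_on S a b) * fourth_moment Hb a b)" .
  qed
  also have "\<dots> \<le> 3 / 2 ^ card S" by (rule haar_collision_le[OF Hb e(2)])
  finally show "(\<integral>y. (\<Sum>a<N. \<Sum>b<N. of_bool (agree_on (patch t) a b) * ((first_state y a)\<^sup>2 * (first_state y b)\<^sup>2)) \<partial>P0)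
      \<le> 3 / 2 ^ \<xi>" unfolding e(3) .
qed

text \<open>The observable in the Heisenberg picture: \<open>w\<close> pulled back through the
  Haar-random second layer and averaged over it. Its indices are basis tuples between the two
  layers.\<close>

definition second_form :: "((nat \<Rightarrow> nat) \<Rightarrow> (nat \<Rightarrow> nat) \<Rightarrow> real) \<Rightarrow> (nat \<Rightarrow> nat) \<Rightarrow> (nat \<Rightarrow> nat) \<Rightarrow> real" where
  "second_form w p q = (\<integral>x. conj_form k N (real_layer False x) w p q \<partial>P1)"

lemma second_layer_orthonormal: "x \<in> space P1 \<Longrightarrow> orthonormal_columns N (real_layer False x)"
  by (rule real_layer_orthonormal[OF P1_orthogonal])

lemma second_layer_measurable: "(\<lambda>x. real_layer False x i j) \<in> borel_measurable P1"
  by (rule real_layer_measurable[OF orthogonal_ensembles(1)]) simp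

lemma conj_form_measurable: "(\<lambda>x. conj_form k N (real_layer False x) w p q) \<in> borel_measurable P1"
  unfolding conj_form_def tensor_op_def
  by (intro borel_measurable_sum borel_measurable_times borel_measurable_prod second_layer_measurable borel_measurable_const)

lemma conj_form_le:
  assumes x: "x \<in> space P1" and pq: "p \<in> X" "q \<in> X"
  shows "\<bar>conj_form k N (real_layer False x) w p q\<bar> \<le> (\<Sum>a\<in>X. \<Sum>b\<in>X. \<bar>w a b\<bar>)"
proof -
  have t: "\<bar>tensor_op k (real_layer False x) a p\<bar> \<le> 1" if "a \<in> X" "p \<in> X" for a p
    unfolding tensor_op_def abs_prod
    using orthonormal_columns_entry_le[OF second_layer_orthonormal[OF x] copies_less[OF that(1)] copies_less[OF that(2)]]
    by (intro prod_le_1) auto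
  have "\<bar>conj_form k N (real_layer False x) w p q\<bar>
      \<le> (\<Sum>a\<in>X. \<bar>\<Sum>b\<in>X. w a b * tensor_op k (real_layer False x) a p * tensor_op k (real_layer False x) b q\<bar>)"
    unfolding conj_form_def by (rule sum_abs)
  also have "\<dots> \<le> (\<Sum>a\<in>X. \<Sum>b\<in>X. \<bar>w a b * tensor_op k (real_layer False x) a p * tensor_op k (real_layer False x) b q\<bar>)"
    by (intro sum_mono sum_abs)
  also have "\<dots> \<le> (\<Sum>a\<in>X. \<Sum>b\<in>X. \<bar>w a b\<bar>)"
  proof (intro sum_mono)
    fix a b assume ab: "a \<in> X" "b \<in> X"
    have "\<bar>w a b\<bar> * (\<bar>tensor_op k (real_layer False x) a p\<bar> * \<bar>tensor_op k (real_layer False x) b q\<bar>) \<le> \<bar>w a b\<bar> * 1"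
      using t[OF ab(1) pq(1)] t[OF ab(2) pq(2)] by (intro mult_left_mono mult_le_one) auto
    thus "\<bar>w a b * tensor_op k (real_layer False x) a p * tensor_op k (real_layer False x) b q\<bar> \<le> \<bar>w a b\<bar>"
      by (simp add: abs_mult mult.assoc)
  qed
  finally show ?thesis .
qed

lemma conj_form_integrable:
  "p \<in> X \<Longrightarrow> q \<in> X \<Longrightarrow> integrable P1 (\<lambda>x. conj_form k N (real_layer False x) w p q)"
  by (rule prob_integrable_bounded[OF prob_P conj_form_measurable conj_form_le])

lemma second_form_bounded:
  assumes "form_bounded X w"
  shows "form_bounded X (second_form w)"
  unfolding second_form_def[abs_def]
  by (rule form_bounded_integral[OF prob_P finite_copies form_bounded_conj_form[OF second_layer_orthonormal assms] conj_form_integrable])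

text \<open>Right multiplication of superblock \<open>s\<close> by a diagonal sign matrix multiplies
  the columns of the layer, that is its inputs, by signs that depend on the value on block
  \<open>s\<close>. So the second layer uses right invariance, where the moments of the first layer
  use left invariance.\<close>

lemma second_form_sign:
  assumes s: "s \<in> odds" and \<sigma>: "\<And>a. \<sigma> a * \<sigma> a = (1 :: real)" and pq: "p \<in> X" "q \<in> X"
  shows "second_form w p q = (\<Prod>l<k. \<sigma> (block_val s (p l))) * (\<Prod>l<k. \<sigma> (block_val s (q l))) * second_form w p q"
proof -
  define V where "V = mat D D (\<lambda>(i, j). complex_of_real (\<sigma> i * of_bool (i = j)))"
  have V: "V \<in> orthogonal_group D" unfolding V_def by (rule sign_matrix(1)[OF \<sigma>])
  have fin: "finite odds" by simp
  have d: "distr Hb Hb (\<lambda>U. U * V) = Hb" using Hb V by (auto simp: haar_orthogonal_def)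
  have L: "real_layer False (x(s := x s * V)) i j = real_layer False x i j * \<sigma> (block_val s j)"
    if x: "x \<in> space P1" for x i j
  proof -
    have "x s \<in> orthogonal_group D" using P1_orthogonal[OF x] s by simp
    hence "re_entry ((x(s := x s * V)) s') (block_val s' i) (block_val s' j)
        = re_entry (x s') (block_val s' i) (block_val s' j) * (if s' = s then \<sigma> (block_val s j) else 1)" for s'
      using sign_matrix(2)[OF \<sigma> _ block_val_less block_val_less] unfolding V_def by simp
    hence "real_layer False (x(s := x s * V)) i j
        = real_layer False x i j * (\<Prod>s'\<in>odds. if s' = s then \<sigma> (block_val s j) else 1)"
      unfolding real_layer_def by (simp only: prod.distrib)
    also have "(\<Prod>s'\<in>odds. if s' = s then \<sigma> (block_val s j) else 1) = \<sigma> (block_val s j)"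
      using s prod.delta[OF fin, of s "\<lambda>_. \<sigma> (block_val s j)"] by simp
    finally show ?thesis .
  qed
  have T: "tensor_op k (real_layer False (x(s := x s * V))) a p = tensor_op k (real_layer False x) a p * (\<Prod>l<k. \<sigma> (block_val s (p l)))"
    if x: "x \<in> space P1" for x a p
    unfolding tensor_op_def L[OF x] prod.distrib ..
  have C: "conj_form k N (real_layer False (x(s := x s * V))) w p q
      = (\<Prod>l<k. \<sigma> (block_val s (p l))) * (\<Prod>l<k. \<sigma> (block_val s (q l))) * conj_form k N (real_layer False x) w p q"
    if x: "x \<in> space P1" for x
    unfolding conj_form_def T[OF x] sum_distrib_left by (intro sum.cong refl) (simp add: ac_simps)
  have "second_form w p q = (\<integral>x. conj_form k N (real_layer False (x(s := x s * V))) w p q \<partial>P1)"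
    unfolding second_form_def
    by (rule PiM_component_invariant[OF fin s prob_Hb mult_measurable(2)[OF orthogonal_ensembles(1) V] d conj_form_measurable conj_form_le[OF _ pq], symmetric])
  also have "\<dots> = (\<integral>x. (\<Prod>l<k. \<sigma> (block_val s (p l))) * (\<Prod>l<k. \<sigma> (block_val s (q l))) * conj_form k N (real_layer False x) w p q \<partial>P1)"
    by (rule Bochner_Integration.integral_cong[OF refl C])
  finally show ?thesis by (simp only: Bochner_Integration.integral_mult_right_zero second_form_def)
qed

lemma second_form_eq_0:
  assumes p: "p \<in> good" and q: "q \<in> X" and s: "s \<in> odds"
    and r: "\<not> (\<lambda>l. block_val s (p l)) ` {..<k} \<subseteq> (\<lambda>l. block_val s (q l)) ` {..<k}"
  shows "second_form w p q = 0" "second_form w q p = 0"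
proof -
  obtain l0 where l0: "l0 < k" "block_val s (p l0) \<notin> (\<lambda>l. block_val s (q l)) ` {..<k}" using r by auto
  have sm: "s < m" using s by simp
  have pX: "p \<in> X" using p good_subset by auto
  define \<sigma> where "\<sigma> a = (if a = block_val s (p l0) then -1 else 1 :: real)" for a
  have \<sigma>: "\<sigma> a * \<sigma> a = 1" for a by (simp add: \<sigma>_def)
  have 1: "(\<Prod>l<k. \<sigma> (block_val s (p l))) = -1"
    unfolding \<sigma>_def by (rule prod_single_sign[OF good_block_inj[OF p sm] l0(1)])
  have 2: "(\<Prod>l<k. \<sigma> (block_val s (q l))) = 1"
  proof (rule prod.neutral, rule ballI)
    fix l assume "l \<in> {..<k}"
    hence "block_val s (q l) \<noteq> block_val s (p l0)" using l0(2) by (metis imageI)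
    thus "\<sigma> (block_val s (q l)) = 1" by (simp add: \<sigma>_def)
  qed
  show "second_form w p q = 0" using second_form_sign[of s \<sigma>, OF s \<sigma> pX q, of w] unfolding 1 2 by simp
  show "second_form w q p = 0" using second_form_sign[of s \<sigma>, OF s \<sigma> q pX, of w] unfolding 1 2 by simp
qed

lemma integral_second_form:
  "(\<integral>x. (\<Sum>p\<in>X. \<Sum>q\<in>X. conj_form k N (real_layer False x) w p q * M p q) \<partial>P1)
    = (\<Sum>p\<in>X. \<Sum>q\<in>X. second_form w p q * M p q)"
proof -
  have i: "integrable P1 (\<lambda>x. conj_form k N (real_layer False x) w p q * M p q)" if "p \<in> X" "q \<in> X" for p q
    by (rule integrable_mult_left) (rule conj_form_integrable[OF that])
  have "(\<integral>x. (\<Sum>p\<in>X. \<Sum>q\<in>X. conj_form k N (real_layer False x) w p q * M p q) \<partial>P1)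
      = (\<Sum>p\<in>X. \<integral>x. (\<Sum>q\<in>X. conj_form k N (real_layer False x) w p q * M p q) \<partial>P1)"
    by (intro Bochner_Integration.integral_sum Bochner_Integration.integrable_sum i)
  also have "\<dots> = (\<Sum>p\<in>X. \<Sum>q\<in>X. \<integral>x. conj_form k N (real_layer False x) w p q * M p q \<partial>P1)"
    by (intro sum.cong refl Bochner_Integration.integral_sum i)
  also have "\<dots> = (\<Sum>p\<in>X. \<Sum>q\<in>X. second_form w p q * M p q)"
    by (simp only: Bochner_Integration.integral_mult_left_zero second_form_def)
  finally show ?thesis .
qed

lemma quad_form_tensor_second_layer:
  "quad_form X w (tensor_vec k (\<lambda>i. \<Sum>j<N. A i j * \<psi> j)) = (\<Sum>p\<in>X. \<Sum>q\<in>X. conj_form k N A w p q * (tensor_vec k \<psi> p * tensor_vec k \<psi> q))"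
proof -
  have "tensor_vec k (\<lambda>i. \<Sum>j<N. A i j * \<psi> j) = apply_op k N A (tensor_vec k \<psi>)"
    by (rule ext) (rule apply_op_tensor_vec[symmetric])
  hence "quad_form X w (tensor_vec k (\<lambda>i. \<Sum>j<N. A i j * \<psi> j)) = quad_form X (conj_form k N A w) (tensor_vec k \<psi>)"
    by (simp only: quad_form_apply_op)
  thus ?thesis by (simp only: quad_form_tensor)
qed

lemma haar_pair_integrable:
  "p \<in> X \<Longrightarrow> q \<in> X \<Longrightarrow> integrable HN (\<lambda>U. tensor_vec k (haar_column U) p * tensor_vec k (haar_column U) q)"
proof (rule tensor_pair_integrable[OF prob_HN])
  show "(\<Sum>i<N. (haar_column U i)\<^sup>2) = 1" if "U \<in> space HN" for U
    using that by (intro haar_column_norm) (simp_all add: space_ensemble[OF orthogonal_ensembles(2)])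
  show "(\<lambda>U. haar_column U i) \<in> borel_measurable HN" if "i < N" for i
    by (rule re_entry_measurable[OF orthogonal_ensembles(2) that]) simp
qed

text \<open>For each fixed second layer \<open>V\<close>, invariance replaces \<open>U\<close> by
  \<open>V * U\<close> and thereby \<open>w\<close> by its pullback. The left-hand side does not
  depend on the layer, so averaging over it leaves it unchanged and produces
  \<open>second_form\<close>.\<close>

lemma haar_state_pairing:
  "(\<integral>U. quad_form X w (tensor_vec k (haar_column U)) \<partial>HN) = (\<Sum>p\<in>X. \<Sum>q\<in>X. second_form w p q * moment HN k p q)"
proof -
  interpret prob_space P1 by (rule prob_P)
  define f where "f U = quad_form X w (tensor_vec k (haar_column U))" for U
  have f: "f \<in> borel_measurable HN"
    unfolding f_def quad_form_tensor
    using integral_quad_form(2)[of X HN "\<lambda>U. tensor_vec k (haar_column U)" w, OF haar_pair_integrable]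
    by (rule borel_measurable_integrable)
  have "(\<integral>U. f U \<partial>HN) = (\<Sum>p\<in>X. \<Sum>q\<in>X. conj_form k N (real_layer False x) w p q * moment HN k p q)"
    if x: "x \<in> space P1" for x
  proof -
    define V where "V = mat N N (\<lambda>(i, j). complex_of_real (real_layer False x i j))"
    have V: "V \<in> orthogonal_group N"
      unfolding V_def by (rule real_mat_orthogonal[OF second_layer_orthonormal[OF x]])
    have "(\<integral>U. f U \<partial>HN) = (\<integral>U. f (V * U) \<partial>HN)" by (rule haar_invariant(1)[OF HN V f, symmetric])
    also have "\<dots> = (\<integral>U. (\<Sum>p\<in>X. \<Sum>q\<in>X. conj_form k N (real_layer False x) w p q * (tensor_vec k (haar_column U) p * tensor_vec k (haar_column U) q)) \<partial>HN)"
    proof (rule Bochner_Integration.integral_cong[OF refl])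
      fix U assume "U \<in> space HN"
      hence U: "U \<in> orthogonal_group N" by (simp add: space_ensemble[OF orthogonal_ensembles(2)])
      have col: "haar_column (V * U) i = (\<Sum>j<N. real_layer False x i j * haar_column U j)" if "i < N" for i
      proof -
        have "haar_column (V * U) i = (\<Sum>j<N. re_entry V i j * haar_column U j)"
          by (rule re_entry_mult[OF V U that]) simp
        also have "\<dots> = (\<Sum>j<N. real_layer False x i j * haar_column U j)"
          unfolding V_def by (intro sum.cong refl) (simp add: re_entry_mat that)
        finally show ?thesis .
      qed
      have "tensor_vec k (haar_column (V * U)) p = tensor_vec k (\<lambda>i. \<Sum>j<N. real_layer False x i j * haar_column U j) p"
        if "p \<in> X" for p
        unfolding tensor_vec_def using copies_less[OF that] by (intro prod.cong refl col) simp
      hence "f (V * U) = quad_form X w (tensor_vec k (\<lambda>i. \<Sum>j<N. real_layer False x i j * haar_column U j))"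
        unfolding f_def quad_form_def by (intro sum.cong refl) simp
      thus "f (V * U) = (\<Sum>p\<in>X. \<Sum>q\<in>X. conj_form k N (real_layer False x) w p q * (tensor_vec k (haar_column U) p * tensor_vec k (haar_column U) q))"
        by (simp only: quad_form_tensor_second_layer)
    qed
    also have "\<dots> = (\<Sum>p\<in>X. \<Sum>q\<in>X. conj_form k N (real_layer False x) w p q * moment HN k p q)"
      unfolding moment_def by (rule integral_quad_form(1)[OF haar_pair_integrable])
    finally show ?thesis .
  qed
  hence "(\<integral>x. (\<integral>U. f U \<partial>HN) \<partial>P1) = (\<integral>x. (\<Sum>p\<in>X. \<Sum>q\<in>X. conj_form k N (real_layer False x) w p q * moment HN k p q) \<partial>P1)"
    by (intro Bochner_Integration.integral_cong refl)
  moreover have "(\<integral>x. (\<integral>U. f U \<partial>HN) \<partial>P1) = (\<integral>U. f U \<partial>HN)"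
    by (simp only: lebesgue_integral_const prob_space real_scaleR_def mult_1)
  ultimately show ?thesis by (simp only: integral_second_form f_def)
qed

lemma state_form_measurable:
  assumes E: "\<And>s. s < m \<Longrightarrow> orthogonal_ensemble D (E s)"
  shows "(\<lambda>U. quad_form X w (tensor_vec k (real_state U))) \<in> borel_measurable (Pi\<^sub>M {..<m} E)"
  unfolding quad_form_def tensor_vec_def
  by (intro borel_measurable_sum borel_measurable_times borel_measurable_prod borel_measurable_const
    real_state_measurable[of E, OF E])

text \<open>Odd and even superblocks are independent, so the two averages separate: the odd ones act
  on \<open>w\<close>, the even ones produce the moments of \<open>first_state\<close>.\<close>

lemma haar_layers_pairing:
  assumes w: "form_bounded X w"
  shows "(\<integral>U. quad_form X w (tensor_vec k (real_state U)) \<partial>Pi\<^sub>M {..<m} (\<lambda>_. Hb))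
    = (\<Sum>p\<in>X. \<Sum>q\<in>X. second_form w p q * layer_moment p q)"
proof -
  define F where "F U = quad_form X w (tensor_vec k (real_state U))" for U
  have un: "odds \<union> evens = {..<m}" "odds \<inter> evens = {}" by auto
  have F: "F \<in> borel_measurable (Pi\<^sub>M {..<m} (\<lambda>_. Hb))"
    unfolding F_def[abs_def] by (rule state_form_measurable[OF orthogonal_ensembles(1)])
  have B: "\<bar>F U\<bar> \<le> 1" if U: "U \<in> space (Pi\<^sub>M {..<m} (\<lambda>_. Hb))" for U
  proof -
    have "U s \<in> orthogonal_group D" if "s < m" for s
      by (rule PiM_orthogonal[where E = "\<lambda>_. Hb", OF orthogonal_ensembles(1) U]) (simp add: that)
    thus ?thesis unfolding F_def by (intro quad_form_le[OF w] tensor_norm real_state_norm)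
  qed
  have "(\<integral>U. F U \<partial>Pi\<^sub>M (odds \<union> evens) (\<lambda>_. Hb)) = (\<integral>x. \<integral>y. F (merge odds evens (x, y)) \<partial>P0 \<partial>P1)"
  proof (rule product_sigma_finite.product_integral_fold[OF product_sigma_finite_prob[of "\<lambda>_. Hb", OF prob_Hb] un(2)])
    show "integrable (Pi\<^sub>M (odds \<union> evens) (\<lambda>_. Hb)) F"
      unfolding un(1) by (rule prob_integrable_bounded[OF prob_P F B])
  qed simp_all
  also have "\<dots> = (\<integral>x. (\<Sum>p\<in>X. \<Sum>q\<in>X. conj_form k N (real_layer False x) w p q * layer_moment p q) \<partial>P1)"
  proof (rule Bochner_Integration.integral_cong[OF refl])
    fix x
    have "F (merge odds evens (x, y)) = (\<Sum>p\<in>X. \<Sum>q\<in>X. conj_form k N (real_layer False x) w p q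
        * (tensor_vec k (first_state y) p * tensor_vec k (first_state y) q))" for y
    proof -
      have "real_layer False (merge odds evens (x, y)) = real_layer False x"
        by (rule real_layer_cong) (simp add: merge_def)
      moreover have "first_state (merge odds evens (x, y)) = first_state y"
        unfolding first_state_def[abs_def] by (subst real_layer_cong[of True _ y]) (simp_all add: merge_def)
      ultimately show ?thesis
        unfolding F_def real_state_apply by (simp only: quad_form_tensor_second_layer)
    qed
    thus "(\<integral>y. F (merge odds evens (x, y)) \<partial>P0) = (\<Sum>p\<in>X. \<Sum>q\<in>X. conj_form k N (real_layer False x) w p q * layer_moment p q)"
      unfolding layer_moment_def by (simp only: integral_quad_form(1)[OF first_pair_integrable])
  qed
  finally show ?thesis unfolding un(1) F_def integral_second_form .
qed

lemma haar_brickwork_close: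
  assumes w: "form_bounded X w"
  shows "\<bar>(\<integral>U. quad_form X w (tensor_vec k (real_state U)) \<partial>Pi\<^sub>M {..<m} (\<lambda>_. Hb))
      - (\<integral>U. quad_form X w (tensor_vec k (haar_column U)) \<partial>HN)\<bar> \<le> 12 * real (k * (k - 1) * m) / 2 ^ \<xi>"
proof -
  define \<eta> where "\<eta> = real (k * (k - 1) * m) * (3 / 2 ^ \<xi>)"
  \<comment> \<open>A good reference tuple for the common diagonal values. If there is no good tuple
    the choice is arbitrary, and all claims about good tuples are vacuous.\<close>
  define p0 where "p0 = (SOME p. p \<in> good)"
  have p0: "p0 \<in> good" if "p \<in> good" for p using someI[of "\<lambda>p. p \<in> good"] that by (simp add: p0_def)
  define c c' where "c = layer_moment p0 p0" and "c' = moment HN k p0 p0"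
  have diag: "layer_moment x x = c \<and> moment HN k x x = c'" if x: "x \<in> good" for x
  proof
    show "layer_moment x x = c" unfolding c_def by (rule layer_moment_diag[OF x p0[OF x]])
    have X: "x \<in> X" "p0 \<in> X" using x p0[OF x] good_subset by auto
    show "moment HN k x x = c'" unfolding c'_def
      by (rule moment_diag_eq[OF HN _ copies_less[OF X(1)] good_inj[OF x] copies_less[OF X(2)] good_inj[OF p0[OF x]]]) simp
  qed
  have haar0: "moment HN k x y = 0" if x: "x \<in> good" and y: "y \<in> X" and r: "\<not> x ` {..<k} \<subseteq> y ` {..<k}" for x y
  proof -
    obtain l0 where l0: "l0 < k" "x l0 \<notin> y ` {..<k}" using r by auto
    have "x \<in> X" using x good_subset by auto
    from moment_eq_0[OF HN _ copies_less[OF this] copies_less[OF y] good_inj[OF x] l0]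
    show ?thesis by simp
  qed
  \<comment> \<open>The first layer alone separates good tuples from bad ones, because
    \<open>good_transfer\<close> only looks at even blocks. For the global moment, an inclusion of
    the entry sets would imply the inclusion on each block.\<close>
  have off: "layer_moment x y = 0 \<and> layer_moment y x = 0 \<and> moment HN k x y = 0 \<and> moment HN k y x = 0"
    if x: "x \<in> good" and y: "y \<in> X - good" for x y
  proof -
    have yX: "y \<in> X" "y \<notin> good" using y by auto
    obtain s where s: "s \<in> evens" "\<not> (\<lambda>l. block_val s (x l)) ` {..<k} \<subseteq> (\<lambda>l. block_val s (y l)) ` {..<k}"
      using good_transfer[OF x yX(1)] yX(2) by blast
    have "\<not> x ` {..<k} \<subseteq> y ` {..<k}"
    proof
      assume "x ` {..<k} \<subseteq> y ` {..<k}"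
      hence "block_val s ` x ` {..<k} \<subseteq> block_val s ` y ` {..<k}" by (rule image_mono)
      thus False using s(2) by (simp only: image_image)
    qed
    from haar0[OF x yX(1) this] layer_moment_eq_0[OF x s] show ?thesis by (simp add: moment_sym[of HN k y x])
  qed
  have pat: "second_form w x y * layer_moment x y = c * (second_form w x y * of_bool (x ` {..<k} = y ` {..<k})) \<and>
      second_form w x y * moment HN k x y = c' * (second_form w x y * of_bool (x ` {..<k} = y ` {..<k}))"
    if x: "x \<in> good" and y: "y \<in> good" for x y
  proof (cases "x ` {..<k} = y ` {..<k}")
    case True
    have "layer_moment x y = c" using layer_moment_same_range[OF x True] diag[OF x] by simp
    moreover have "moment HN k x y = c'" using moment_same_range[OF good_inj[OF x] True[symmetric], of HN] diag[OF x] by simp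
    ultimately show ?thesis using True by simp
  next
    case False
    have yX: "y \<in> X" using y good_subset by auto
    have "\<not> x ` {..<k} \<subseteq> y ` {..<k}"
      using range_eq_if_subset(1)[OF good_inj[OF x], of y] False by blast
    hence 1: "moment HN k x y = 0" by (rule haar0[OF x yX])
    \<comment> \<open>Some block separates the value sets of \<open>x\<close> and \<open>y\<close>.
      If it is even, the first-layer moment vanishes, and if it is odd, the averaged form does; in
      general only the product is 0.\<close>
    obtain s where s: "s < m" "\<not> (\<lambda>l. block_val s (x l)) ` {..<k} \<subseteq> (\<lambda>l. block_val s (y l)) ` {..<k}"
      using good_same_range[OF x y] False by blast
    have "second_form w x y * layer_moment x y = 0"
    proof (cases "even s")
      case True
      hence "s \<in> evens" using s(1) by simp
      from layer_moment_eq_0(1)[OF x this s(2)] show ?thesis by simp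
    next
      case False
      hence "s \<in> odds" using s(1) by simp
      from second_form_eq_0(1)[OF x yX this s(2)] show ?thesis by simp
    qed
    thus ?thesis using 1 False by simp
  qed
  have "\<bar>(\<Sum>x\<in>X. \<Sum>y\<in>X. second_form w x y * layer_moment x y) - (\<Sum>x\<in>X. \<Sum>y\<in>X. second_form w x y * moment HN k x y)\<bar>
      \<le> 2 * \<eta> + 2 * \<eta>"
  \<comment> \<open>Both bad masses are at most \<open>\<eta>\<close>, three times
    \<open>k * (k - 1) * m / 2 ^ \<xi>\<close>; the total \<open>4 * \<eta>\<close> is the origin of
    the constant 12.\<close>
  proof (rule pairing_difference_le[where S = good and R = "\<lambda>x y. x ` {..<k} = y ` {..<k}" and c = c and c' = c'])
    show "finite X" by simp
    show "good \<subseteq> X" by (rule good_subset)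
    show "\<bar>\<Sum>x\<in>S. \<Sum>y\<in>S. second_form w x y * layer_moment x y\<bar> \<le> (\<Sum>x\<in>S. layer_moment x x)" if "S \<subseteq> X" for S
      unfolding layer_moment_def
      by (rule second_moment_pairing_le[OF second_form_bounded[OF w] finite_copies that first_pair_integrable])
    show "\<bar>\<Sum>x\<in>S. \<Sum>y\<in>S. second_form w x y * moment HN k x y\<bar> \<le> (\<Sum>x\<in>S. moment HN k x x)" if "S \<subseteq> X" for S
      unfolding moment_def
      by (rule second_moment_pairing_le[OF second_form_bounded[OF w] finite_copies that haar_pair_integrable])
    show "(\<Sum>x\<in>X - good. layer_moment x x) \<le> \<eta>" unfolding \<eta>_def by (rule layer_bad_mass)
    show "(\<Sum>x\<in>X - good. moment HN k x x) \<le> \<eta>" unfolding \<eta>_def by (rule haar_bad_mass)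
  qed (rule off diag pat layer_moment_trace haar_moment_trace; assumption)+
  thus ?thesis unfolding haar_layers_pairing[OF w] haar_state_pairing by (simp add: \<eta>_def mult_ac)
qed

end

section \<open>Superblocks drawn from approximate designs\<close>

text \<open>The factors on the two sides of position \<open>s\<close> do not involve
  \<open>V\<close>, which the order of the quantifiers records: a single pair \<open>A\<close>,
  \<open>B\<close> serves all \<open>V\<close>.\<close>

lemma mat_prod_split_orthogonal:
  assumes s: "s \<in> set ss" "distinct ss" and S: "\<And>t. t \<in> set ss \<Longrightarrow> t \<noteq> s \<Longrightarrow> F t (U t) \<in> orthogonal_group d"
    and V: "\<And>V. V \<in> W \<Longrightarrow> F s V \<in> orthogonal_group d"
  shows "\<exists>A\<in>orthogonal_group d. \<exists>B\<in>orthogonal_group d. \<forall>V\<in>W.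
    mat_prod d (map (\<lambda>t. F t ((U(s := V)) t)) ss) = A * F s V * B"
proof -
  obtain ss1 ss2 where ss: "ss = ss1 @ s # ss2" using s(1) by (auto simp: in_set_conv_decomp)
  have ns: "s \<notin> set ss1" "s \<notin> set ss2" using s(2) ss by auto
  define A B where "A = mat_prod d (map (\<lambda>t. F t (U t)) ss1)" and "B = mat_prod d (map (\<lambda>t. F t (U t)) ss2)"
  have sub: "set (map (\<lambda>t. F t (U t)) ss1) \<subseteq> orthogonal_group d" "set (map (\<lambda>t. F t (U t)) ss2) \<subseteq> orthogonal_group d"
    using S ns ss by auto
  have AB: "A \<in> orthogonal_group d" "B \<in> orthogonal_group d"
    unfolding A_def B_def by (rule mat_prod_orthogonal[OF sub(1)], rule mat_prod_orthogonal[OF sub(2)])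
  have carr: "set (map (\<lambda>t. F t (U t)) ss1) \<subseteq> carrier_mat d d" "set (map (\<lambda>t. F t (U t)) ss2) \<subseteq> carrier_mat d d"
    using sub orthogonal_group_carrier by blast+
  have "mat_prod d (map (\<lambda>t. F t ((U(s := V)) t)) ss) = A * F s V * B" if "V \<in> W" for V
  proof -
    have FV: "F s V \<in> carrier_mat d d" using orthogonal_group_carrier[OF V[OF that]] .
    have m: "map (\<lambda>t. F t ((U(s := V)) t)) ss = map (\<lambda>t. F t (U t)) ss1 @ F s V # map (\<lambda>t. F t (U t)) ss2"
      unfolding ss using ns by auto
    have "mat_prod d (map (\<lambda>t. F t ((U(s := V)) t)) ss) = A * (F s V * B)"
      unfolding m A_def B_def using carr FV by (subst mat_prod_append) auto
    also have "\<dots> = A * F s V * B"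
      by (rule assoc_mult_mat[OF orthogonal_group_carrier[OF AB(1)] FV orthogonal_group_carrier[OF AB(2)], symmetric])
    finally show ?thesis .
  qed
  thus ?thesis using AB by blast
qed

section \<open>Twirls of rank-one inputs and the diamond norm\<close>

lemma trace_norm_ampliate_le:
  assumes "diamond_norm d \<Phi> \<le> ereal \<delta>" "A \<in> carrier_mat (d * r) (d * r)" "trace_norm A \<le> 1"
  shows "trace_norm (ampliate d r \<Phi> A) \<le> \<delta>"
proof -
  have "ereal (trace_norm (ampliate d r \<Phi> A)) \<le> diamond_norm d \<Phi>"
    unfolding diamond_norm_def using assms(2,3)
    by (intro SUP_upper2[where i = "(r, A)"]) auto
  from order_trans[OF this assms(1)] show ?thesis by simp
qed

definition undigits :: "nat \<Rightarrow> nat \<Rightarrow> (nat \<Rightarrow> nat) \<Rightarrow> nat" where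
  "undigits k N = inv_into {..<N ^ k} (digits k N)"

lemma digits_undigits:
  assumes "N > 0" "x \<in> copies k N"
  shows "undigits k N x < N ^ k" "digits k N (undigits k N x) = x"
proof -
  have "x \<in> digits k N ` {..<N ^ k}" using bij_betw_digits[OF assms(1), of k] assms(2) by (simp add: bij_betw_def)
  from inv_into_into[OF this] f_inv_into_f[OF this] show "undigits k N x < N ^ k" "digits k N (undigits k N x) = x"
    by (simp_all add: undigits_def)
qed

lemma tensor_power_entry:
  assumes U: "U \<in> carrier_mat D D" and re: "\<And>i j. i < D \<Longrightarrow> j < D \<Longrightarrow> U $$ (i, j) = complex_of_real (f i j)"
    and D: "D > 0" and ab: "a < D ^ k" "b < D ^ k"
  shows "tensor_power k U $$ (a, b) = complex_of_real (tensor_op k f (digits k D a) (digits k D b))"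
  using U ab D by (simp add: tensor_power_def tensor_op_def digits_def re)

lemma transpose_orthogonal_entry:
  assumes "U \<in> orthogonal_group D" "i < D" "j < D"
  shows "mat_adjoint U $$ (i, j) = complex_of_real (re_entry U j i)"
  using orthogonal_group_carrier[OF assms(1)] assms(2,3) orthogonal_entry[OF assms(1,3,2)]
  by (simp add: mat_adjoint_index)

text \<open>Two vectors are needed because a block of a rank-one matrix, cut out by two different
  ancilla indices, is the outer product of two different pieces of the vector. Since
  \<open>U\<close> is real, both factors of an entry involve \<open>U\<close> itself.\<close>

lemma twirl_entry:
  fixes v v' :: "nat \<Rightarrow> real"
  assumes E: "orthogonal_ensemble D E" and D: "D > 0" and ab: "a < D ^ k" "b < D ^ k"
  shows "twirl D k E (mat (D ^ k) (D ^ k) (\<lambda>(p, q). complex_of_real (v p * v' q))) $$ (a, b)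
    = complex_of_real (\<integral>U. (\<Sum>p<D ^ k. tensor_op k (re_entry U) (digits k D a) (digits k D p) * v p)
        * (\<Sum>q<D ^ k. tensor_op k (re_entry U) (digits k D b) (digits k D q) * v' q) \<partial>E)"
proof -
  let ?A = "mat (D ^ k) (D ^ k) (\<lambda>(p, q). complex_of_real (v p * v' q))"
  have "(tensor_power k U * ?A * tensor_power k (mat_adjoint U)) $$ (a, b)
      = complex_of_real ((\<Sum>p<D ^ k. tensor_op k (re_entry U) (digits k D a) (digits k D p) * v p)
        * (\<Sum>q<D ^ k. tensor_op k (re_entry U) (digits k D b) (digits k D q) * v' q))"
    if U: "U \<in> orthogonal_group D" for U
  proof -
    have carr: "U \<in> carrier_mat D D" by (rule orthogonal_group_carrier[OF U])
    have carr': "mat_adjoint U \<in> carrier_mat D D" using carrier_matD[OF carr] by (intro carrier_matI) simp_all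
    have T: "tensor_power k U $$ (x, y) = complex_of_real (tensor_op k (re_entry U) (digits k D x) (digits k D y))"
      if "x < D ^ k" "y < D ^ k" for x y
      by (rule tensor_power_entry[OF carr orthogonal_entry[OF U] D that])
    have T': "tensor_power k (mat_adjoint U) $$ (x, y) = complex_of_real (tensor_op k (re_entry U) (digits k D y) (digits k D x))"
      if "x < D ^ k" "y < D ^ k" for x y
      using tensor_power_entry[OF carr' transpose_orthogonal_entry[OF U] D that] by (simp add: tensor_op_def)
    have dims: "dim_row (tensor_power k U) = D ^ k" "dim_col (tensor_power k U) = D ^ k"
      "dim_row (tensor_power k (mat_adjoint U)) = D ^ k" "dim_col (tensor_power k (mat_adjoint U)) = D ^ k"
      using carrier_matD[OF carr] carrier_matD[OF carr'] by (simp_all add: tensor_power_def)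
    have "(tensor_power k U * ?A * tensor_power k (mat_adjoint U)) $$ (a, b)
        = (\<Sum>q<D ^ k. (tensor_power k U * ?A) $$ (a, q) * tensor_power k (mat_adjoint U) $$ (q, b))"
      using ab dims by (simp add: scalar_prod_def atLeast0LessThan del: assoc_mult_mat)
    also have "\<dots> = (\<Sum>q<D ^ k. (\<Sum>p<D ^ k. tensor_power k U $$ (a, p) * ?A $$ (p, q)) * tensor_power k (mat_adjoint U) $$ (q, b))"
      using ab dims by (intro sum.cong refl) (simp add: scalar_prod_def atLeast0LessThan)
    also have "\<dots> = (\<Sum>q<D ^ k. complex_of_real ((\<Sum>p<D ^ k. tensor_op k (re_entry U) (digits k D a) (digits k D p) * v p)
        * (tensor_op k (re_entry U) (digits k D b) (digits k D q) * v' q)))"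
    proof (intro sum.cong refl)
      fix q assume "q \<in> {..<D ^ k}"
      hence q: "q < D ^ k" by simp
      have "(\<Sum>p<D ^ k. tensor_power k U $$ (a, p) * ?A $$ (p, q))
          = complex_of_real (\<Sum>p<D ^ k. tensor_op k (re_entry U) (digits k D a) (digits k D p) * v p * v' q)"
        unfolding of_real_sum using q ab by (intro sum.cong refl) (simp add: T)
      also have "(\<Sum>p<D ^ k. tensor_op k (re_entry U) (digits k D a) (digits k D p) * v p * v' q)
          = (\<Sum>p<D ^ k. tensor_op k (re_entry U) (digits k D a) (digits k D p) * v p) * v' q"
        by (rule sum_distrib_right[symmetric])
      finally show "(\<Sum>p<D ^ k. tensor_power k U $$ (a, p) * ?A $$ (p, q)) * tensor_power k (mat_adjoint U) $$ (q, b)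
          = complex_of_real ((\<Sum>p<D ^ k. tensor_op k (re_entry U) (digits k D a) (digits k D p) * v p)
            * (tensor_op k (re_entry U) (digits k D b) (digits k D q) * v' q))"
        by (simp only: T'[OF q ab(2)] of_real_mult mult.assoc mult.commute[of "complex_of_real (v' q)"])
    qed
    finally show ?thesis by (simp only: of_real_sum[symmetric] sum_distrib_left[symmetric])
  qed
  note entry = this
  have "twirl D k E ?A $$ (a, b) = (\<integral>U. (tensor_power k U * ?A * tensor_power k (mat_adjoint U)) $$ (a, b) \<partial>E)"
    unfolding twirl_def expect_mat_def index_mat(1)[OF ab] by simp
  also have "\<dots> = (\<integral>U. complex_of_real ((\<Sum>p<D ^ k. tensor_op k (re_entry U) (digits k D a) (digits k D p) * v p)
        * (\<Sum>q<D ^ k. tensor_op k (re_entry U) (digits k D b) (digits k D q) * v' q)) \<partial>E)"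
    by (rule Bochner_Integration.integral_cong[OF refl]) (rule entry, simp add: space_ensemble[OF E])
  finally show ?thesis by (simp only: integral_complex_of_real)
qed

lemma sum_div_mod:
  fixes g :: "nat \<Rightarrow> 'a :: comm_monoid_add"
  shows "(\<Sum>i<d * r. g i) = (\<Sum>p<d. \<Sum>c<r. g (p * r + c))"
proof -
  have "(\<Sum>i<d * r. g i) = (\<Sum>p<d. sum g {p * r..<p * r + r})" by (rule sum.nat_group[symmetric])
  also have "\<dots> = (\<Sum>p<d. \<Sum>c<r. g (p * r + c))"
  proof (rule sum.cong[OF refl])
    fix p
    show "sum g {p * r..<p * r + r} = (\<Sum>c<r. g (p * r + c))"
      using sum.shift_bounds_nat_ivl[of g 0 "p * r" r] by (simp add: atLeast0LessThan add.commute)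
  qed
  finally show ?thesis .
qed

context superblock_brickwork
begin

text \<open>All superblocks except \<open>s\<close> are merged into two fixed orthogonal matrices.
  The layer without \<open>s\<close> joins \<open>A\<close> if \<open>s\<close> lies in the first
  layer, which acts first, and joins \<open>B\<close> otherwise.\<close>

lemma brickwork_split:
  assumes s: "s < m" and U: "\<And>t. t < m \<Longrightarrow> U t \<in> orthogonal_group D"
  shows "\<exists>A\<in>orthogonal_group N. \<exists>B\<in>orthogonal_group N. \<forall>V\<in>orthogonal_group D.
    brickwork m \<xi> (U(s := V)) = A * superblock m \<xi> s V * B"
proof -
  define b where "b = even s"
  have sb: "superblock m \<xi> t V \<in> orthogonal_group N" if "t < m" "V \<in> orthogonal_group D" for t V
    by (rule superblock_orthogonal[OF m_ge_2 xi_pos that])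
  have "\<exists>A\<in>orthogonal_group N. \<exists>B\<in>orthogonal_group N. \<forall>V\<in>orthogonal_group D.
      layer m \<xi> (layer_blocks m b) (U(s := V)) = A * superblock m \<xi> s V * B"
    unfolding layer_def
  proof (rule mat_prod_split_orthogonal)
    show "s \<in> set (layer_blocks m b)" using s by (simp add: b_def)
    show "superblock m \<xi> t (U t) \<in> orthogonal_group N" if "t \<in> set (layer_blocks m b)" for t
      using sb[of t "U t"] U[of t] that by simp
    show "superblock m \<xi> s V \<in> orthogonal_group N" if "V \<in> orthogonal_group D" for V by (rule sb[OF s that])
  qed simp
  then obtain A B where AB: "A \<in> orthogonal_group N" "B \<in> orthogonal_group N"
    "\<And>V. V \<in> orthogonal_group D \<Longrightarrow> layer m \<xi> (layer_blocks m b) (U(s := V)) = A * superblock m \<xi> s V * B"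
    by blast
  define L where "L = layer m \<xi> (layer_blocks m (\<not> b)) U"
  have L: "L \<in> orthogonal_group N" unfolding L_def by (rule layer_orthogonal[OF U])
  have other: "layer m \<xi> (layer_blocks m (\<not> b)) (U(s := V)) = L" for V
    unfolding L_def layer_def
    by (intro arg_cong[of _ _ "mat_prod _"] map_cong refl) (auto simp: b_def)
  note carr = orthogonal_group_carrier[OF AB(1)] orthogonal_group_carrier[OF AB(2)] orthogonal_group_carrier[OF L]
  have sbc: "superblock m \<xi> s V \<in> carrier_mat N N" for V by simp
  show ?thesis
  proof (cases b)
    case True
    have "brickwork m \<xi> (U(s := V)) = (L * A) * superblock m \<xi> s V * B" if "V \<in> orthogonal_group D" for V
      using other[of V] AB(3)[OF that] carr sbc[of V] True
      by (simp add: brickwork_layers assoc_mult_mat[of _ N N _ N _ N])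
    thus ?thesis using orthogonal_group_mult[OF L AB(1)] AB(2) by blast
  next
    case False
    have "brickwork m \<xi> (U(s := V)) = A * superblock m \<xi> s V * (B * L)" if "V \<in> orthogonal_group D" for V
      using other[of V] AB(3)[OF that] carr sbc[of V] mult_carrier_mat[OF sbc[of V] carr(2)] False
      by (simp add: brickwork_layers assoc_mult_mat[of _ N N _ N _ N])
    thus ?thesis using orthogonal_group_mult[OF AB(2) L] AB(1) by blast
  qed
qed

lemma re_entry_superblock:
  assumes "i < N" "j < N"
  shows "re_entry (superblock m \<xi> s V) i j
    = (if agree_on ({..<m * \<xi>} - block_qubits m \<xi> s) i j then re_entry V (block_val s i) (block_val s j) else 0)"
  using assms
  by (simp add: re_entry_def superblock_on_qubits on_qubits_index block_qubits_def block_val_def)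

text \<open>The reindexing that turns the \<open>k\<close>-fold power of a superblock into \<open>T \<otimes> 1\<close>: the quotient by \<open>r\<close>
  encodes the \<open>k\<close> values on the block, the remainder the bits outside of it.\<close>

lemma block_reindexing:
  assumes s: "s < m"
  obtains r \<beta> where "bij_betw \<beta> {..<D ^ k * r} X" "r > 0"
    "\<And>i l. i < D ^ k * r \<Longrightarrow> l < k \<Longrightarrow> block_val s (\<beta> i l) = digits k D (i div r) l"
    "\<And>i j. i < D ^ k * r \<Longrightarrow> j < D ^ k * r \<Longrightarrow>
      (\<forall>l<k. agree_on ({..<m * \<xi>} - block_qubits m \<xi> s) (\<beta> i l) (\<beta> j l)) \<longleftrightarrow> i mod r = j mod r"
proof -
  define Q where "Q = {..<m * \<xi>} - block_qubits m \<xi> s"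
  define K where "K = ({..<k} \<rightarrow>\<^sub>E Pow Q)"
  define r where "r = card K"
  define \<kappa> where "\<kappa> z = (\<lambda>l\<in>{..<k}. {q \<in> Q. bit (z l) q})" for z :: "nat \<Rightarrow> nat"
  have finK: "finite K" unfolding K_def Q_def by (intro finite_PiE) auto
  have cardb: "card (block_qubits m \<xi> s) = 2 * \<xi>"
    unfolding block_qubits_def by (simp add: card_image[OF inj_on_block_map[OF m_ge_2]])
  have cQ: "card Q = m * \<xi> - 2 * \<xi>"
    unfolding Q_def using block_qubits_subset[OF xi_pos s] finite_subset[OF block_qubits_subset[OF xi_pos s]]
    by (simp add: card_Diff_subset cardb)
  have "card K = (2 ^ (m * \<xi> - 2 * \<xi>)) ^ k"
    unfolding K_def by (simp add: card_PiE card_Pow Q_def[symmetric] cQ[symmetric]) (simp add: Q_def card_Pow)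
  hence r: "r = (2 ^ (m * \<xi> - 2 * \<xi>)) ^ k" by (simp add: r_def)
  have r0: "r > 0" by (simp add: r)
  have "2 * \<xi> \<le> m * \<xi>" using m_ge_2 by (intro mult_right_mono) auto
  hence "D * 2 ^ (m * \<xi> - 2 * \<xi>) = N" by (simp flip: power_add)
  hence Nk: "D ^ k * r = N ^ k" unfolding r by (metis power_mult_distrib)
  \<comment> \<open>Any numbering of the configurations outside of the block will do: only equality
    of remainders modulo \<open>r\<close> is ever tested.\<close>
  obtain e where e: "bij_betw e K {..<r}"
    using ex_bij_betw_finite_nat[OF finK] by (auto simp: r_def atLeast0LessThan)
  have \<kappa>: "\<kappa> z \<in> K" for z unfolding \<kappa>_def K_def by (auto simp: PiE_iff)
  have er: "e (\<kappa> z) < r" for z using e \<kappa> by (auto simp: bij_betw_def)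
  define bv where "bv z = (\<lambda>l\<in>{..<k}. block_val s (z l))" for z
  have bv: "bv z \<in> copies k D" for z unfolding bv_def copies_def by (simp add: PiE_iff block_val_less)
  have D0: "D > 0" by simp
  \<comment> \<open>The inverse direction of the reindexing. \<open>\<theta>\<close> is injective
    because the block values and the outside bits determine all entries, and it is onto because
    \<open>D ^ k * r = N ^ k\<close>.\<close>
  define \<theta> where "\<theta> z = undigits k D (bv z) * r + e (\<kappa> z)" for z
  have div: "\<theta> z div r = undigits k D (bv z)" and mod: "\<theta> z mod r = e (\<kappa> z)" for z
    using er[of z] r0 by (simp_all add: \<theta>_def)
  have \<kappa>_eq: "\<kappa> z = \<kappa> z' \<longleftrightarrow> (\<forall>l<k. agree_on Q (z l) (z' l))" for z z'
  proof
    assume eq: "\<kappa> z = \<kappa> z'"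
    show "\<forall>l<k. agree_on Q (z l) (z' l)"
    proof (intro allI impI)
      fix l assume "l < k"
      hence "{q \<in> Q. bit (z l) q} = {q \<in> Q. bit (z' l) q}" using fun_cong[OF eq, of l] by (simp add: \<kappa>_def)
      thus "agree_on Q (z l) (z' l)" unfolding agree_on_def by blast
    qed
  next
    assume "\<forall>l<k. agree_on Q (z l) (z' l)"
    hence "{q \<in> Q. bit (z l) q} = {q \<in> Q. bit (z' l) q}" if "l < k" for l
      using that unfolding agree_on_def by blast
    thus "\<kappa> z = \<kappa> z'" unfolding \<kappa>_def by (intro restrict_ext) simp
  qed
  have inj: "inj_on \<theta> X"
  proof (rule inj_onI)
    fix z z' assume z: "z \<in> X" "z' \<in> X" "\<theta> z = \<theta> z'"
    have "undigits k D (bv z) = undigits k D (bv z')" using z(3) div by metis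
    hence bvz: "bv z = bv z'" using digits_undigits(2)[OF D0 bv] by metis
    have b: "block_val s (z l) = block_val s (z' l)" if "l < k" for l
      using that fun_cong[OF bvz, of l] by (simp add: bv_def)
    have "e (\<kappa> z) = e (\<kappa> z')" using z(3) mod by metis
    hence "\<kappa> z = \<kappa> z'" using e \<kappa> by (auto simp: bij_betw_def inj_on_eq_iff)
    hence a: "agree_on Q (z l) (z' l)" if "l < k" for l using \<kappa>_eq that by blast
    show "z = z'"
    proof (rule copies_eqI[OF z(1,2)])
      fix l assume l: "l < k"
      have "agree_on (Q \<union> block_qubits m \<xi> s) (z l) (z' l)"
        using a[OF l] b[OF l] by (simp add: agree_on_Un block_val_eq_iff)
      moreover have "{..<m * \<xi>} \<subseteq> Q \<union> block_qubits m \<xi> s" by (auto simp: Q_def)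
      ultimately show "z l = z' l"
        by (intro agree_on_all_imp_eq[OF copies_less[OF z(1) l] copies_less[OF z(2) l]]) (rule agree_on_mono)
    qed
  qed
  have sub: "\<theta> ` X \<subseteq> {..<D ^ k * r}"
  proof (rule image_subsetI)
    fix z
    have "\<theta> z < (undigits k D (bv z) + 1) * r" using er[of z] by (simp add: \<theta>_def)
    also have "\<dots> \<le> D ^ k * r" using digits_undigits(1)[OF D0 bv, of z] by (intro mult_right_mono) auto
    finally show "\<theta> z \<in> {..<D ^ k * r}" by simp
  qed
  have "\<theta> ` X = {..<D ^ k * r}"
    by (rule card_subset_eq[OF _ sub]) (simp_all only: finite_lessThan card_image[OF inj] card_copies card_lessThan Nk)
  hence bij: "bij_betw \<theta> X {..<D ^ k * r}" using inj by (simp add: bij_betw_def)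
  define \<beta> where "\<beta> = inv_into X \<theta>"
  have \<beta>: "bij_betw \<beta> {..<D ^ k * r} X" unfolding \<beta>_def by (rule bij_betw_inv_into[OF bij])
  have \<theta>\<beta>: "\<theta> (\<beta> i) = i" if "i < D ^ k * r" for i
    unfolding \<beta>_def using bij that by (simp add: bij_betw_inv_into_right)
  show ?thesis
  proof (rule that[OF \<beta> r0])
    fix i l assume i: "i < D ^ k * r" and l: "l < k"
    have "digits k D (i div r) = bv (\<beta> i)" using div[of "\<beta> i"] digits_undigits(2)[OF D0 bv] \<theta>\<beta>[OF i] by simp
    thus "block_val s (\<beta> i l) = digits k D (i div r) l" using l by (simp add: bv_def)
  next
    fix i j assume i: "i < D ^ k * r" and j: "j < D ^ k * r"
    have "\<kappa> (\<beta> i) = \<kappa> (\<beta> j) \<longleftrightarrow> e (\<kappa> (\<beta> i)) = e (\<kappa> (\<beta> j))"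
      using e \<kappa> by (auto simp: bij_betw_def inj_on_eq_iff)
    also have "\<dots> \<longleftrightarrow> i mod r = j mod r" using mod[of "\<beta> i"] mod[of "\<beta> j"] \<theta>\<beta>[OF i] \<theta>\<beta>[OF j] by simp
    finally show "(\<forall>l<k. agree_on ({..<m * \<xi>} - block_qubits m \<xi> s) (\<beta> i l) (\<beta> j l)) \<longleftrightarrow> i mod r = j mod r"
      unfolding \<kappa>_eq Q_def .
  qed
qed

text \<open>The superblock leaves all outside bits alone, so input and output have the same
  remainder modulo \<open>r\<close>, and only the sum over the quotient survives.\<close>

lemma apply_superblock_reindexed:
  assumes \<beta>: "bij_betw \<beta> {..<D ^ k * r} X" and r: "r > 0"
    and val: "\<And>i l. i < D ^ k * r \<Longrightarrow> l < k \<Longrightarrow> block_val s (\<beta> i l) = digits k D (i div r) l"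
    and out: "\<And>i j. i < D ^ k * r \<Longrightarrow> j < D ^ k * r \<Longrightarrow>
      (\<forall>l<k. agree_on ({..<m * \<xi>} - block_qubits m \<xi> s) (\<beta> i l) (\<beta> j l)) \<longleftrightarrow> i mod r = j mod r"
    and i: "i < D ^ k * r"
  shows "apply_op k N (re_entry (superblock m \<xi> s V)) u (\<beta> i)
    = (\<Sum>p<D ^ k. tensor_op k (re_entry V) (digits k D (i div r)) (digits k D p) * u (\<beta> (p * r + i mod r)))"
proof -
  have X: "\<beta> j \<in> X" if "j < D ^ k * r" for j using \<beta> that by (auto simp: bij_betw_def)
  have T: "tensor_op k (re_entry (superblock m \<xi> s V)) (\<beta> i) (\<beta> j)
      = (if j mod r = i mod r then tensor_op k (re_entry V) (digits k D (i div r)) (digits k D (j div r)) else 0)"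
    if j: "j < D ^ k * r" for j
  proof (cases "j mod r = i mod r")
    case True
    have "agree_on ({..<m * \<xi>} - block_qubits m \<xi> s) (\<beta> i l) (\<beta> j l)" if "l < k" for l
      using out[OF i j] True that by simp
    thus ?thesis
      unfolding tensor_op_def using True copies_less[OF X[OF i]] copies_less[OF X[OF j]]
      by (simp add: re_entry_superblock val[OF i] val[OF j])
  next
    case False
    then obtain l where l: "l < k" "\<not> agree_on ({..<m * \<xi>} - block_qubits m \<xi> s) (\<beta> i l) (\<beta> j l)"
      using out[OF i j] by auto
    hence "re_entry (superblock m \<xi> s V) (\<beta> i l) (\<beta> j l) = 0"
      using copies_less[OF X[OF i] l(1)] copies_less[OF X[OF j] l(1)] by (simp add: re_entry_superblock)
    hence "tensor_op k (re_entry (superblock m \<xi> s V)) (\<beta> i) (\<beta> j) = 0"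
      unfolding tensor_op_def using l(1) by (intro prod_zero bexI[of _ l]) auto
    thus ?thesis using False by simp
  qed
  have "apply_op k N (re_entry (superblock m \<xi> s V)) u (\<beta> i)
      = (\<Sum>j<D ^ k * r. tensor_op k (re_entry (superblock m \<xi> s V)) (\<beta> i) (\<beta> j) * u (\<beta> j))"
    unfolding apply_op_def by (rule sum.reindex_bij_betw[OF \<beta>, symmetric])
  also have "\<dots> = (\<Sum>p<D ^ k. \<Sum>c<r. tensor_op k (re_entry (superblock m \<xi> s V)) (\<beta> i) (\<beta> (p * r + c)) * u (\<beta> (p * r + c)))"
    by (rule sum_div_mod)
  also have "\<dots> = (\<Sum>p<D ^ k. \<Sum>c<r. if c = i mod r then
      tensor_op k (re_entry V) (digits k D (i div r)) (digits k D p) * u (\<beta> (p * r + i mod r)) else 0)"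
  proof (intro sum.cong refl)
    fix p c assume "p \<in> {..<D ^ k}" "c \<in> {..<r}"
    hence pc: "p + 1 \<le> D ^ k" "c < r" by auto
    have "p * r + c < (p + 1) * r" using pc by simp
    also have "\<dots> \<le> D ^ k * r" using pc by (intro mult_right_mono) auto
    finally have lt: "p * r + c < D ^ k * r" .
    have dm: "(p * r + c) mod r = c" "(p * r + c) div r = p" using pc by simp_all
    show "tensor_op k (re_entry (superblock m \<xi> s V)) (\<beta> i) (\<beta> (p * r + c)) * u (\<beta> (p * r + c))
      = (if c = i mod r then tensor_op k (re_entry V) (digits k D (i div r)) (digits k D p) * u (\<beta> (p * r + i mod r)) else 0)"
      unfolding T[OF lt] dm by simp
  qed
  also have "\<dots> = (\<Sum>p<D ^ k. tensor_op k (re_entry V) (digits k D (i div r)) (digits k D p) * u (\<beta> (p * r + i mod r)))"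
    using r by simp
  finally show ?thesis .
qed

text \<open>The ancilla of the diamond norm holds the qubits outside of the block, for all
  \<open>k\<close> copies together. In the coordinates \<open>\<beta>\<close> the matrix
  \<open>R\<close> is the projection onto the unit vector \<open>u\<close>, and the ampliated
  difference of the twirls maps it to the difference \<open>Z\<close> of the two second-moment
  matrices. So the diamond norm bounds the trace norm of \<open>Z\<close>, and with it the pairing
  with \<open>w\<close>.\<close>

lemma superblock_form_design:
  assumes E: "orthogonal_ensemble D E" and E': "orthogonal_ensemble D E'"
    and diamond: "diamond_norm (D ^ k) (\<lambda>A. twirl D k E A - twirl D k E' A) \<le> ereal \<delta>"
    and s: "s < m" and w: "form_bounded X w" and u: "(\<Sum>x\<in>X. (u x)\<^sup>2) = 1"
  defines "F \<equiv> \<lambda>V. quad_form X w (apply_op k N (re_entry (superblock m \<xi> s V)) u)"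
  shows "\<bar>(\<integral>V. F V \<partial>E) - (\<integral>V. F V \<partial>E')\<bar> \<le> \<delta>"
proof (rule block_reindexing[OF s])
  fix r \<beta>
  assume \<beta>: "bij_betw \<beta> {..<D ^ k * r} X" and r: "r > 0"
    and val: "\<And>i l. i < D ^ k * r \<Longrightarrow> l < k \<Longrightarrow> block_val s (\<beta> i l) = digits k D (i div r) l"
    and out: "\<And>i j. i < D ^ k * r \<Longrightarrow> j < D ^ k * r \<Longrightarrow>
      (\<forall>l<k. agree_on ({..<m * \<xi>} - block_qubits m \<xi> s) (\<beta> i l) (\<beta> j l)) \<longleftrightarrow> i mod r = j mod r"
  define n' where "n' = D ^ k * r"
  define t where "t V = apply_op k N (re_entry (superblock m \<xi> s V)) u" for V
  have X: "\<beta> i \<in> X" if "i < n'" for i using \<beta> that by (auto simp: bij_betw_def n'_def)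
  have t_meas: "(\<lambda>V. t V x) \<in> borel_measurable P" if P: "orthogonal_ensemble D P" and x: "x \<in> X" for x P
  proof -
    have "(\<lambda>V. re_entry (superblock m \<xi> s V) i j) \<in> borel_measurable P" if "i < N" "j < N" for i j
      unfolding re_entry_superblock[OF that]
      using re_entry_measurable[OF P block_val_less block_val_less] by (cases "agree_on ({..<m * \<xi>} - block_qubits m \<xi> s) i j") simp_all
    thus ?thesis
      unfolding t_def apply_op_def tensor_op_def using copies_less x
      by (intro borel_measurable_sum borel_measurable_times borel_measurable_prod borel_measurable_const) auto
  qed
  have t_int: "integrable P (\<lambda>V. t V x * t V y)" if P: "orthogonal_ensemble D P" and xy: "x \<in> X" "y \<in> X" for x y P
  proof (rule prob_integrable_bounded[where B = 1])
    show "prob_space P" using P by (simp add: orthogonal_ensemble_def)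
    show "(\<lambda>V. t V x * t V y) \<in> borel_measurable P"
      using t_meas[OF P xy(1)] t_meas[OF P xy(2)] by (rule borel_measurable_times)
    fix V assume "V \<in> space P"
    hence V: "V \<in> orthogonal_group D" by (simp add: space_ensemble[OF P])
    have "orthonormal_columns N (re_entry (superblock m \<xi> s V))"
      by (rule orthonormal_columns_re_entry[OF superblock_orthogonal[OF m_ge_2 xi_pos s V]])
    hence n: "(\<Sum>x\<in>X. (t V x)\<^sup>2) = 1" unfolding t_def by (simp only: apply_op_norm u)
    have "\<bar>t V z\<bar> \<le> 1" if "z \<in> X" for z
    proof -
      have "(t V z)\<^sup>2 \<le> (\<Sum>x\<in>X. (t V x)\<^sup>2)" using that by (intro member_le_sum) auto
      thus ?thesis by (simp add: n abs_square_le_1)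
    qed
    from this[OF xy(1)] this[OF xy(2)] show "\<bar>t V x * t V y\<bar> \<le> 1" by (simp add: abs_mult mult_le_one)
  qed
  define Z where "Z i j = (\<integral>V. t V (\<beta> i) * t V (\<beta> j) \<partial>E) - (\<integral>V. t V (\<beta> i) * t V (\<beta> j) \<partial>E')" for i j
  define R where "R = mat n' n' (\<lambda>(i, j). complex_of_real (u (\<beta> i) * u (\<beta> j)))"
  define \<Phi> where "\<Phi> A = twirl D k E A - twirl D k E' A" for A
  have "(\<Sum>i<n'. (u (\<beta> i))\<^sup>2) = 1"
    using sum.reindex_bij_betw[OF \<beta>, of "\<lambda>x. (u x)\<^sup>2"] u by (simp add: n'_def)
  hence R: "trace_norm R \<le> 1" "R \<in> carrier_mat (D ^ k * r) (D ^ k * r)"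
    unfolding R_def n'_def[symmetric] by (intro trace_norm_rank_one_le) simp_all
  have ap: "t V (\<beta> i) = (\<Sum>p<D ^ k. tensor_op k (re_entry V) (digits k D (i div r)) (digits k D p) * u (\<beta> (p * r + i mod r)))"
    if "i < D ^ k * r" for V i
    unfolding t_def by (rule apply_superblock_reindexed[OF \<beta> r]) (erule (1) val | erule (1) out | rule that)+
  have "ampliate (D ^ k) r \<Phi> R = mat n' n' (\<lambda>(i, j). complex_of_real (Z i j))"
  proof (rule eq_matI)
    fix i j assume "i < dim_row (mat n' n' (\<lambda>(i, j). complex_of_real (Z i j)))"
      "j < dim_col (mat n' n' (\<lambda>(i, j). complex_of_real (Z i j)))"
    hence ij: "i < D ^ k * r" "j < D ^ k * r" by (simp_all add: n'_def)
    have ab: "i div r < D ^ k" "j div r < D ^ k" using ij by (simp_all add: less_mult_imp_div_less)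
    have lt: "x * r + c mod r < n'" if "x < D ^ k" for x c
    proof -
      have "x * r + c mod r < (x + 1) * r" using r by simp
      also have "\<dots> \<le> D ^ k * r" using that by (intro mult_right_mono) auto
      finally show ?thesis by (simp add: n'_def)
    qed
    have block: "mat (D ^ k) (D ^ k) (\<lambda>(x, y). R $$ (x * r + i mod r, y * r + j mod r))
        = mat (D ^ k) (D ^ k) (\<lambda>(x, y). complex_of_real (u (\<beta> (x * r + i mod r)) * u (\<beta> (y * r + j mod r))))"
      by (rule eq_matI) (simp_all add: R_def lt)
    have tw: "twirl D k P (mat (D ^ k) (D ^ k) (\<lambda>(x, y). R $$ (x * r + i mod r, y * r + j mod r))) $$ (i div r, j div r)
        = complex_of_real (\<integral>V. t V (\<beta> i) * t V (\<beta> j) \<partial>P)" if P: "orthogonal_ensemble D P" for P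
      unfolding block twirl_entry[OF P zero_less_power[OF zero_less_numeral] ab] ap[OF ij(1)] ap[OF ij(2)] ..
    have dim: "dim_row (twirl D k P A) = D ^ k" "dim_col (twirl D k P A) = D ^ k" for P A
      by (simp_all add: twirl_def expect_mat_def)
    have "ampliate (D ^ k) r \<Phi> R $$ (i, j)
        = \<Phi> (mat (D ^ k) (D ^ k) (\<lambda>(x, y). R $$ (x * r + i mod r, y * r + j mod r))) $$ (i div r, j div r)"
      unfolding ampliate_def using ij by simp
    also have "\<dots> = complex_of_real (Z i j)"
      unfolding \<Phi>_def Z_def of_real_diff tw[OF E, symmetric] tw[OF E', symmetric]
      using ab by (intro index_minus_mat(1)) (simp_all add: dim)
    finally show "ampliate (D ^ k) r \<Phi> R $$ (i, j) = mat n' n' (\<lambda>(i, j). complex_of_real (Z i j)) $$ (i, j)"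
      using ij by (simp add: n'_def)
  qed (simp_all add: ampliate_def n'_def)
  hence tn: "trace_norm (mat n' n' (\<lambda>(i, j). complex_of_real (Z i j))) \<le> \<delta>"
    using trace_norm_ampliate_le[OF diamond[folded \<Phi>_def] R(2,1)] by simp
  have "\<bar>\<Sum>i<n'. \<Sum>j<n'. w (\<beta> i) (\<beta> j) * Z i j\<bar> \<le> trace_norm (mat n' n' (\<lambda>(i, j). complex_of_real (Z i j)))"
  proof (rule form_le_trace_norm)
    show "Z i j = Z j i" for i j by (simp add: Z_def mult.commute)
    show "form_bounded {..<n'} (\<lambda>i j. w (\<beta> i) (\<beta> j))" unfolding n'_def by (rule form_bounded_reindex[OF \<beta> w])
  qed
  moreover have "(\<Sum>i<n'. \<Sum>j<n'. w (\<beta> i) (\<beta> j) * Z i j) = (\<integral>V. F V \<partial>E) - (\<integral>V. F V \<partial>E')"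
  proof -
    have int: "(\<integral>V. F V \<partial>P) = (\<Sum>x\<in>X. \<Sum>y\<in>X. w x y * (\<integral>V. t V x * t V y \<partial>P))" if P: "orthogonal_ensemble D P" for P
      unfolding F_def quad_form_tensor t_def[symmetric] by (rule integral_quad_form(1)[OF t_int[OF P]])
    have "(\<Sum>i<n'. \<Sum>j<n'. w (\<beta> i) (\<beta> j) * Z i j)
        = (\<Sum>x\<in>X. \<Sum>y\<in>X. w x y * ((\<integral>V. t V x * t V y \<partial>E) - (\<integral>V. t V x * t V y \<partial>E')))"
      unfolding Z_def n'_def
        sum.reindex_bij_betw[OF \<beta>, of "\<lambda>y. w (\<beta> i) y * ((\<integral>V. t V (\<beta> i) * t V y \<partial>E) - (\<integral>V. t V (\<beta> i) * t V y \<partial>E'))" for i]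
      by (rule sum.reindex_bij_betw[OF \<beta>, of "\<lambda>x. \<Sum>y\<in>X. w x y * ((\<integral>V. t V x * t V y \<partial>E) - (\<integral>V. t V x * t V y \<partial>E'))"])
    thus ?thesis unfolding int[OF E] int[OF E'] by (simp add: right_diff_distrib sum_subtractf)
  qed
  ultimately show ?thesis using tn by linarith
qed

text \<open>What acts before the superblock goes into the input vector \<open>u\<close>, the tensor
  power of column 0 of \<open>B\<close>. What acts after it goes into the observable, which stays
  bounded because \<open>A\<close> is orthogonal.\<close>

lemma brickwork_form_design:
  assumes E: "orthogonal_ensemble D E" and E': "orthogonal_ensemble D E'"
    and diamond: "diamond_norm (D ^ k) (\<lambda>A. twirl D k E A - twirl D k E' A) \<le> ereal \<delta>"
    and s: "s < m" and w: "form_bounded X w" and U: "\<And>t. t < m \<Longrightarrow> U t \<in> orthogonal_group D"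
  shows "\<bar>(\<integral>V. quad_form X w (tensor_vec k (real_state (U(s := V)))) \<partial>E)
    - (\<integral>V. quad_form X w (tensor_vec k (real_state (U(s := V)))) \<partial>E')\<bar> \<le> \<delta>"
proof -
  obtain A B where A: "A \<in> orthogonal_group N" and B: "B \<in> orthogonal_group N"
    and split: "\<And>V. V \<in> orthogonal_group D \<Longrightarrow> brickwork m \<xi> (U(s := V)) = A * superblock m \<xi> s V * B"
    using brickwork_split[of s U, OF s U] by blast
  define u where "u = tensor_vec k (haar_column B)"
  define w' where "w' = conj_form k N (re_entry A) w"
  have u: "(\<Sum>x\<in>X. (u x)\<^sup>2) = 1"
    unfolding u_def by (intro tensor_norm haar_column_norm B) simp
  have w': "form_bounded X w'"
    unfolding w'_def by (rule form_bounded_conj_form[OF orthonormal_columns_re_entry[OF A] w])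
  have tens: "tensor_vec k f x = tensor_vec k g x" if "\<And>i. i < N \<Longrightarrow> f i = g i" "x \<in> X" for f g x
    unfolding tensor_vec_def using copies_less[OF that(2)] that(1) by (intro prod.cong refl) auto
  have qcong: "quad_form X v f = quad_form X v g" if "\<And>x. x \<in> X \<Longrightarrow> f x = g x" for v f g
    unfolding quad_form_def using that by (intro sum.cong refl) simp
  have eq: "quad_form X w (tensor_vec k (real_state (U(s := V))))
      = quad_form X w' (apply_op k N (re_entry (superblock m \<xi> s V)) u)" if V: "V \<in> orthogonal_group D" for V
  proof -
    have UV: "(U(s := V)) t \<in> orthogonal_group D" if "t < m" for t using U[OF that] V by simp
    have S: "superblock m \<xi> s V \<in> orthogonal_group N" by (rule superblock_orthogonal[OF m_ge_2 xi_pos s V])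
    define \<phi> where "\<phi> j = (\<Sum>l<N. re_entry (superblock m \<xi> s V) j l * haar_column B l)" for j
    have "real_state (U(s := V)) i = (\<Sum>j<N. re_entry A i j * \<phi> j)" if i: "i < N" for i
    proof -
      have "real_state (U(s := V)) i = re_entry (A * superblock m \<xi> s V * B) i 0"
        using brickwork_column(2)[of "U(s := V)", OF UV i] by (simp only: split[OF V])
      also have "A * superblock m \<xi> s V * B = A * (superblock m \<xi> s V * B)"
        by (rule assoc_mult_mat[OF orthogonal_group_carrier[OF A] orthogonal_group_carrier[OF S] orthogonal_group_carrier[OF B]])
      also have "re_entry (A * (superblock m \<xi> s V * B)) i 0 = (\<Sum>j<N. re_entry A i j * re_entry (superblock m \<xi> s V * B) j 0)"
        by (rule re_entry_mult[OF A orthogonal_group_mult[OF S B] i]) simp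
      also have "\<dots> = (\<Sum>j<N. re_entry A i j * \<phi> j)"
      proof (rule sum.cong[OF refl])
        fix j assume "j \<in> {..<N}"
        hence "re_entry (superblock m \<xi> s V * B) j 0 = \<phi> j"
          unfolding \<phi>_def by (intro re_entry_mult[OF S B]) simp_all
        thus "re_entry A i j * re_entry (superblock m \<xi> s V * B) j 0 = re_entry A i j * \<phi> j" by simp
      qed
      finally show ?thesis .
    qed
    hence "quad_form X w (tensor_vec k (real_state (U(s := V)))) = quad_form X w (tensor_vec k (\<lambda>i. \<Sum>j<N. re_entry A i j * \<phi> j))"
      by (intro qcong tens)
    also have "\<dots> = quad_form X w (apply_op k N (re_entry A) (tensor_vec k \<phi>))"
      by (intro qcong apply_op_tensor_vec[symmetric])
    also have "\<dots> = quad_form X w' (tensor_vec k \<phi>)" unfolding w'_def by (rule quad_form_apply_op)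
    also have "\<dots> = quad_form X w' (apply_op k N (re_entry (superblock m \<xi> s V)) u)"
      unfolding u_def \<phi>_def by (intro qcong apply_op_tensor_vec[symmetric])
    finally show ?thesis .
  qed
  have int: "(\<integral>V. quad_form X w (tensor_vec k (real_state (U(s := V)))) \<partial>P)
      = (\<integral>V. quad_form X w' (apply_op k N (re_entry (superblock m \<xi> s V)) u) \<partial>P)"
    if P: "orthogonal_ensemble D P" for P
    by (rule Bochner_Integration.integral_cong[OF refl]) (simp add: eq space_ensemble[OF P])
  from superblock_form_design[OF E E' diamond s w' u] show ?thesis
    unfolding int[OF E] int[OF E'] .
qed

end

section \<open>From pairings to the trace distance, and the choice of constants\<close>

lemma expect_tensor_power_real:
  assumes N: "N > 0"
    and T: "\<And>\<omega>. \<omega> \<in> space M \<Longrightarrow> T \<omega> \<in> carrier_mat N N"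
    and entry: "\<And>\<omega> i j. \<omega> \<in> space M \<Longrightarrow> i < N \<Longrightarrow> j < N \<Longrightarrow> T \<omega> $$ (i, j) = complex_of_real (\<phi> \<omega> i * \<phi> \<omega> j)"
  shows "expect_mat (N ^ k) M (\<lambda>\<omega>. tensor_power k (T \<omega>)) = mat (N ^ k) (N ^ k) (\<lambda>(a, b).
    complex_of_real (\<integral>\<omega>. tensor_vec k (\<phi> \<omega>) (digits k N a) * tensor_vec k (\<phi> \<omega>) (digits k N b) \<partial>M))"
proof -
  have op: "tensor_op k (\<lambda>i j. \<phi> \<omega> i * \<phi> \<omega> j) x y = tensor_vec k (\<phi> \<omega>) x * tensor_vec k (\<phi> \<omega>) y" for \<omega> x y
    by (simp only: tensor_op_def tensor_vec_def prod.distrib)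
  have "(\<integral>\<omega>. tensor_power k (T \<omega>) $$ (a, b) \<partial>M)
      = (\<integral>\<omega>. complex_of_real (tensor_vec k (\<phi> \<omega>) (digits k N a) * tensor_vec k (\<phi> \<omega>) (digits k N b)) \<partial>M)"
    if "a < N ^ k" "b < N ^ k" for a b
    by (rule Bochner_Integration.integral_cong[OF refl])
      (simp only: op[symmetric] tensor_power_entry[of "T _" N "\<lambda>i j. \<phi> _ i * \<phi> _ j", OF T entry N that])
  thus ?thesis
    unfolding expect_mat_def by (intro cong_mat refl) (simp only: split_conv integral_complex_of_real)
qed

text \<open>The duality of \<open>trace_norm_le_if_forms_le\<close>, carried over from numbers below
  \<open>N ^ k\<close> to tuples: a bounded form on either index set is one on the other.\<close>

lemma trace_norm_moment_difference_le:
  fixes \<phi> :: "'v \<Rightarrow> nat \<Rightarrow> real" and \<psi> :: "'w \<Rightarrow> nat \<Rightarrow> real"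
  assumes N: "N > 0"
    and int: "\<And>p q. p \<in> copies k N \<Longrightarrow> q \<in> copies k N \<Longrightarrow> integrable P (\<lambda>\<omega>. tensor_vec k (\<phi> \<omega>) p * tensor_vec k (\<phi> \<omega>) q)"
      "\<And>p q. p \<in> copies k N \<Longrightarrow> q \<in> copies k N \<Longrightarrow> integrable Q (\<lambda>\<omega>. tensor_vec k (\<psi> \<omega>) p * tensor_vec k (\<psi> \<omega>) q)"
    and le: "\<And>w. form_bounded (copies k N) w \<Longrightarrow> (\<integral>\<omega>. quad_form (copies k N) w (tensor_vec k (\<phi> \<omega>)) \<partial>P)
      - (\<integral>\<omega>. quad_form (copies k N) w (tensor_vec k (\<psi> \<omega>)) \<partial>Q) \<le> b"
  shows "trace_norm (mat (N ^ k) (N ^ k) (\<lambda>(a, b).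
        complex_of_real (\<integral>\<omega>. tensor_vec k (\<phi> \<omega>) (digits k N a) * tensor_vec k (\<phi> \<omega>) (digits k N b) \<partial>P))
      - mat (N ^ k) (N ^ k) (\<lambda>(a, b).
        complex_of_real (\<integral>\<omega>. tensor_vec k (\<psi> \<omega>) (digits k N a) * tensor_vec k (\<psi> \<omega>) (digits k N b) \<partial>Q))) \<le> b"
proof -
  let ?X = "copies k N" and ?\<beta> = "digits k N"
  define F where "F x y = (\<integral>\<omega>. tensor_vec k (\<phi> \<omega>) x * tensor_vec k (\<phi> \<omega>) y \<partial>P)" for x y
  define G where "G x y = (\<integral>\<omega>. tensor_vec k (\<psi> \<omega>) x * tensor_vec k (\<psi> \<omega>) y \<partial>Q)" for x y
  have "trace_norm (mat (N ^ k) (N ^ k) (\<lambda>(a, b). complex_of_real (F (?\<beta> a) (?\<beta> b) - G (?\<beta> a) (?\<beta> b)))) \<le> b"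
  proof (rule trace_norm_le_if_forms_le)
    show "F (?\<beta> i) (?\<beta> j) - G (?\<beta> i) (?\<beta> j) = F (?\<beta> j) (?\<beta> i) - G (?\<beta> j) (?\<beta> i)" for i j
      by (simp add: F_def G_def mult.commute)
    fix w assume w: "form_bounded {..<N ^ k} w"
    define w' where "w' x y = w (undigits k N x) (undigits k N y)" for x y
    have bij: "bij_betw ?\<beta> {..<N ^ k} ?X" by (rule bij_betw_digits[OF N])
    have w': "form_bounded ?X w'"
      unfolding w'_def undigits_def by (rule form_bounded_reindex[OF bij_betw_inv_into[OF bij] w])
    have pull: "(\<Sum>i<N ^ k. \<Sum>j<N ^ k. w i j * K (?\<beta> i) (?\<beta> j)) = (\<Sum>x\<in>?X. \<Sum>y\<in>?X. w' x y * K x y)" for K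
    proof -
      have "(\<Sum>x\<in>?X. \<Sum>y\<in>?X. w' x y * K x y) = (\<Sum>i<N ^ k. \<Sum>j<N ^ k. w' (?\<beta> i) (?\<beta> j) * K (?\<beta> i) (?\<beta> j))"
        by (simp only: sum.reindex_bij_betw[OF bij, symmetric])
      thus ?thesis using bij_betw_inv_into_left[OF bij] by (simp add: w'_def undigits_def)
    qed
    have "(\<Sum>i<N ^ k. \<Sum>j<N ^ k. w i j * (F (?\<beta> i) (?\<beta> j) - G (?\<beta> i) (?\<beta> j)))
        = (\<Sum>x\<in>?X. \<Sum>y\<in>?X. w' x y * F x y) - (\<Sum>x\<in>?X. \<Sum>y\<in>?X. w' x y * G x y)"
      by (simp only: right_diff_distrib sum_subtractf pull)
    also have "\<dots> = (\<integral>\<omega>. quad_form ?X w' (tensor_vec k (\<phi> \<omega>)) \<partial>P) - (\<integral>\<omega>. quad_form ?X w' (tensor_vec k (\<psi> \<omega>)) \<partial>Q)"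
      unfolding quad_form_def mult.assoc F_def G_def
      by (simp only: integral_quad_form(1)[OF int(1)] integral_quad_form(1)[OF int(2)])
    finally show "(\<Sum>i<N ^ k. \<Sum>j<N ^ k. w i j * (F (?\<beta> i) (?\<beta> j) - G (?\<beta> i) (?\<beta> j))) \<le> b"
      using le[OF w'] by simp
  qed
  moreover have "mat (N ^ k) (N ^ k) (\<lambda>(a, b). complex_of_real (F (?\<beta> a) (?\<beta> b)))
      - mat (N ^ k) (N ^ k) (\<lambda>(a, b). complex_of_real (G (?\<beta> a) (?\<beta> b)))
      = mat (N ^ k) (N ^ k) (\<lambda>(a, b). complex_of_real (F (?\<beta> a) (?\<beta> b) - G (?\<beta> a) (?\<beta> b)))"
    by (rule eq_matI) auto
  ultimately show ?thesis by (simp only: F_def G_def)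
qed

text \<open>With \<open>y = n * k / \<epsilon>\<close> the hypothesis says
  \<open>2 ^ \<xi> \<ge> y ^ 7\<close>. Two of the seven powers absorb
  \<open>k * (k - 1) * m \<le> y ^ 2 * \<epsilon>\<close>; the other five absorb the factor 24,
  because \<open>y \<ge> 2\<close> gives \<open>y ^ 5 \<ge> 32\<close>. For \<open>k = 1\<close>
  there are no pairs and the error is 0.\<close>

lemma gluing_error_le:
  fixes m \<xi> k :: nat and \<epsilon> :: real
  assumes m: "m \<ge> 2" "\<xi> > 0" and k: "k \<ge> 1" and \<epsilon>: "0 < \<epsilon>" "\<epsilon> < 2"
    and \<xi>: "real \<xi> \<ge> 7 * log 2 (real (m * \<xi>) * real k / \<epsilon>)"
  shows "12 * real (k * (k - 1) * m) / 2 ^ \<xi> \<le> \<epsilon> / 2"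
proof (cases "k = 1")
  case True
  thus ?thesis using \<epsilon> by simp
next
  case False
  define n where "n = m * \<xi>"
  define y where "y = real n * real k / \<epsilon>"
  have "m * 1 \<le> m * \<xi>" using m(2) by (intro mult_left_mono) auto
  hence "m \<le> n" by (simp add: n_def)
  hence n: "m \<le> n" "n \<ge> 2" using m by simp_all
  have k2: "k \<ge> 2" using k False by simp
  have "2 * \<epsilon> \<le> real n * real k"
  proof -
    have "2 * 2 \<le> real n * real k" using n(2) k2 by (intro mult_mono) auto
    thus ?thesis using \<epsilon> by linarith
  qed
  hence y2: "y \<ge> 2" using \<epsilon> by (simp add: y_def pos_le_divide_eq)
  have "y ^ 7 = 2 powr (7 * log 2 y)"
  proof -
    have "2 powr (7 * log 2 y) = (2 powr log 2 y) powr 7" by (simp only: powr_powr mult.commute)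
    also have "2 powr log 2 y = y" using y2 by simp
    also have "y powr 7 = y ^ 7" using y2 by (simp only: powr_numeral[of y])
    finally show ?thesis ..
  qed
  also have "\<dots> \<le> 2 powr real \<xi>" using \<xi> by (intro powr_mono) (simp_all add: y_def n_def)
  also have "\<dots> = 2 ^ \<xi>" by (simp add: powr_realpow)
  finally have pow: "y ^ 7 \<le> 2 ^ \<xi>" .
  have "real (k * (k - 1) * m) * \<epsilon> \<le> real (k * (k - 1) * m) * real n"
    using \<epsilon> n(2) by (intro mult_left_mono) auto
  also have "\<dots> = real (k * (k - 1) * m * n)" by simp
  also have "\<dots> \<le> real (k * k * n * n)" using n(1) by (intro of_nat_mono mult_mono) auto
  also have "\<dots> = y\<^sup>2 * \<epsilon> * \<epsilon>" using \<epsilon> by (simp add: y_def power2_eq_square field_simps)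
  finally have "real (k * (k - 1) * m) \<le> y\<^sup>2 * \<epsilon>" using \<epsilon> by (simp only: mult_le_cancel_right_pos)
  moreover have "24 * (y\<^sup>2 * \<epsilon>) \<le> \<epsilon> * y ^ 7"
  proof -
    have "2 ^ 5 \<le> y ^ 5" using y2 by (intro power_mono) auto
    hence "24 * (y\<^sup>2 * \<epsilon>) \<le> y ^ 5 * (y\<^sup>2 * \<epsilon>)" using \<epsilon> by (intro mult_right_mono) auto
    moreover have "y ^ 7 = y ^ 5 * y\<^sup>2" using power_add[of y 5 2] by simp
    ultimately show ?thesis by (simp only: mult_ac)
  qed
  moreover have "\<epsilon> * y ^ 7 \<le> \<epsilon> * 2 ^ \<xi>" using pow \<epsilon> by (intro mult_left_mono) auto
  ultimately have "24 * real (k * (k - 1) * m) \<le> \<epsilon> * 2 ^ \<xi>" by linarith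
  thus ?thesis by (simp add: field_simps)
qed

text \<open>The factor 4 stands for two layers of blocks with \<open>2 * \<xi>\<close> qubits.
  \<open>\<bar>B\<bar> + 1\<close> and \<open>p * p + 1\<close> are nonnegative upper bounds for
  \<open>B\<close> and \<open>p\<close>, whatever their signs. The factor \<open>1 + k\<close>
  removes \<open>k\<close> from the logarithm: \<open>log 2 k \<le> k\<close>, and
  \<open>log 2 (n / \<epsilon>) \<ge> 1\<close> because of \<open>n \<ge> 2\<close> and
  \<open>\<epsilon> \<le> 1\<close>.\<close>

lemma depth_poly_log_le:
  fixes n k d \<xi> :: nat and \<epsilon> B :: real and p :: "real poly"
  defines "L \<equiv> log 2 (real n * real k / \<epsilon>)"
  assumes n: "n \<ge> 2" and k: "k \<ge> 1" and \<epsilon>: "0 < \<epsilon>" "\<epsilon> \<le> 1" and \<xi>: "real \<xi> \<le> B * L"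
    and d: "real d \<le> poly p (real k) * real (2 * \<xi>)"
  shows "real (2 * d) \<le> poly ([:4 * (\<bar>B\<bar> + 1):] * ((p * p + 1) * [:1, 1:])) (real k) * log 2 (real n / \<epsilon>)"
proof -
  define P where "P = poly p (real k)"
  define l where "l = log 2 (real n / \<epsilon>)"
  have q: "2 \<le> real n / \<epsilon>"
  proof -
    have "2 * \<epsilon> \<le> real n" using n \<epsilon> by linarith
    thus ?thesis using \<epsilon> by (simp add: pos_le_divide_eq)
  qed
  have l1: "1 \<le> l" unfolding l_def using q by (subst le_log_iff) auto
  have "L = l + log 2 (real k)"
    unfolding L_def l_def using n k \<epsilon> by (simp add: log_mult log_divide)
  moreover have "log 2 (real k) \<le> real k"
  proof -
    have "real k \<le> 2 powr real k" using less_exp[of k] by (simp add: powr_realpow flip: of_nat_power_less_of_nat_cancel_iff of_nat_le_iff)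
    thus ?thesis using k by (simp add: log_le_iff)
  qed
  moreover have "real k \<le> real k * l" using l1 by (simp add: mult_le_cancel_left1)
  ultimately have L: "L \<le> (1 + real k) * l" by (simp add: algebra_simps)
  have "0 \<le> log 2 (real k)" using k by simp
  hence L0: "0 \<le> L" using \<open>L = _\<close> l1 by linarith
  have "real \<xi> \<le> (\<bar>B\<bar> + 1) * ((1 + real k) * l)"
  proof -
    have "B * L \<le> (\<bar>B\<bar> + 1) * L" using L0 by (intro mult_right_mono) auto
    also have "\<dots> \<le> (\<bar>B\<bar> + 1) * ((1 + real k) * l)" using L by (intro mult_left_mono) auto
    finally show ?thesis using \<xi> by linarith
  qed
  moreover have "P \<le> P * P + 1"
  proof -
    have "0 \<le> (P - 1)\<^sup>2 + P\<^sup>2 + 1" by simp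
    thus ?thesis by (simp add: power2_eq_square algebra_simps)
  qed
  ultimately have "P * real \<xi> \<le> (P * P + 1) * ((\<bar>B\<bar> + 1) * ((1 + real k) * l))"
    by (intro order_trans[OF mult_right_mono[of P "P * P + 1"] mult_left_mono]) auto
  moreover have "real (2 * d) \<le> 4 * (P * real \<xi>)" using d by (simp add: P_def algebra_simps)
  ultimately have "real (2 * d) \<le> 4 * ((P * P + 1) * ((\<bar>B\<bar> + 1) * ((1 + real k) * l)))" by linarith
  also have "\<dots> = poly ([:4 * (\<bar>B\<bar> + 1):] * ((p * p + 1) * [:1, 1:])) (real k) * l"
    by (simp add: P_def algebra_simps)
  finally show ?thesis unfolding l_def .
qed

context superblock_brickwork
begin

lemma brickwork_ensemble:
  assumes E: "\<And>s. s < m \<Longrightarrow> orthogonal_ensemble D (E s)"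
  shows "pure_state_ensemble (m * \<xi>) (Pi\<^sub>M {..<m} E) (\<lambda>U. brickwork m \<xi> U *\<^sub>v zero_state (m * \<xi>))"
  unfolding pure_state_ensemble_def
proof (intro conjI ballI allI impI)
  show "prob_space (Pi\<^sub>M {..<m} E)"
    by (rule prob_space_PiM) (use E in \<open>simp add: orthogonal_ensemble_def\<close>)
  have orth: "U s \<in> orthogonal_group D" if "U \<in> space (Pi\<^sub>M {..<m} E)" "s < m" for U s
    by (rule PiM_orthogonal[OF _ that(1)]) (use E that(2) in auto)
  note col = brickwork_column(1)[OF orth]
  show carr: "brickwork m \<xi> U *\<^sub>v zero_state (m * \<xi>) \<in> carrier_vec N" if U: "U \<in> space (Pi\<^sub>M {..<m} E)" for U
    using orthogonal_group_carrier[OF brickwork_orthogonal[of U, OF orth[OF U]]]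
    by (simp add: zero_state_def)
  show "(brickwork m \<xi> U *\<^sub>v zero_state (m * \<xi>)) \<bullet>c (brickwork m \<xi> U *\<^sub>v zero_state (m * \<xi>)) = 1"
    if U: "U \<in> space (Pi\<^sub>M {..<m} E)" for U
  proof -
    define v where "v = brickwork m \<xi> U *\<^sub>v zero_state (m * \<xi>)"
    have v: "v \<in> carrier_vec N" unfolding v_def by (rule carr[OF U])
    have "v \<bullet>c v = (\<Sum>i<N. v $ i * cnj (v $ i))"
      using carrier_vecD[OF v] by (simp add: scalar_prod_def atLeast0LessThan)
    also have "\<dots> = (\<Sum>i<N. complex_of_real ((real_state U i)\<^sup>2))"
    proof (rule sum.cong[OF refl])
      fix i assume "i \<in> {..<N}"
      hence "v $ i = complex_of_real (real_state U i)" unfolding v_def by (intro col[OF U]) simp_all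
      thus "v $ i * cnj (v $ i) = complex_of_real ((real_state U i)\<^sup>2)" by (simp add: power2_eq_square)
    qed
    also have "\<dots> = 1" by (simp only: of_real_sum[symmetric] real_state_norm[OF orth[OF U]] of_real_1)
    finally show ?thesis unfolding v_def .
  qed
  show "(\<lambda>U. (brickwork m \<xi> U *\<^sub>v zero_state (m * \<xi>)) $ i) \<in> borel_measurable (Pi\<^sub>M {..<m} E)" if i: "i < N" for i
  proof -
    have "(\<lambda>U. complex_of_real (real_state U i)) \<in> borel_measurable (Pi\<^sub>M {..<m} E)"
      by (rule measurable_compose[OF real_state_measurable[of E i, OF E] borel_measurable_of_real])
    thus ?thesis by (subst measurable_cong[OF col[OF _ _ i]])
  qed
qed

end

context haar_brickwork
begin

lemma design_brickwork_close:
  assumes E: "\<And>s. s < m \<Longrightarrow> orthogonal_design Hb D k (\<delta> s) (E s)" and w: "form_bounded X w"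
  shows "\<bar>(\<integral>U. quad_form X w (tensor_vec k (real_state U)) \<partial>Pi\<^sub>M {..<m} E)
      - (\<integral>U. quad_form X w (tensor_vec k (haar_column U)) \<partial>HN)\<bar> \<le> (\<Sum>s<m. \<delta> s) + 12 * real (k * (k - 1) * m) / 2 ^ \<xi>"
proof -
  define f where "f U = quad_form X w (tensor_vec k (real_state U))" for U
  \<comment> \<open>\<open>PiM_hybrid\<close> asks for probability measures at all indices, so the
    family is continued by the Haar measure beyond \<open>m\<close>; the product over
    \<open>{..<m}\<close> is the same.\<close>
  define M where "M s = (if s < m then E s else Hb)" for s
  have Es: "orthogonal_ensemble D (E s)" if "s < m" for s using E[OF that] by (simp add: orthogonal_design_def)
  have M: "orthogonal_ensemble D (M s)" for s using Es orthogonal_ensembles(1) by (simp add: M_def)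
  have PM: "Pi\<^sub>M {..<m} M = Pi\<^sub>M {..<m} E" by (intro PiM_cong refl) (simp add: M_def)
  have orth: "U s \<in> orthogonal_group D" if "U \<in> space (Pi\<^sub>M {..<m} M)" "s < m" for U s
    by (rule PiM_orthogonal[OF M that(1)]) (simp add: that(2))
  have "\<bar>(\<integral>U. f U \<partial>Pi\<^sub>M {..<m} M) - (\<integral>U. f U \<partial>Pi\<^sub>M {..<m} (\<lambda>_. Hb))\<bar> \<le> (\<Sum>s<m. \<delta> s)"
  proof (rule PiM_hybrid[where B = 1])
    show "prob_space (M s)" "sets (M s) = sets Hb" for s
      using M[of s] orthogonal_ensembles(1) by (simp_all add: orthogonal_ensemble_def)
    show "prob_space Hb" by (rule prob_Hb)
    show "f \<in> borel_measurable (Pi\<^sub>M {..<m} M)" unfolding f_def[abs_def] by (rule state_form_measurable[OF M])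
    show "\<bar>f U\<bar> \<le> 1" if "U \<in> space (Pi\<^sub>M {..<m} M)" for U
      unfolding f_def by (intro quad_form_le[OF w] tensor_norm real_state_norm orth[OF that])
    fix s U assume s: "s \<in> {..<m}" and U: "U \<in> space (Pi\<^sub>M {..<m} M)"
    have sm: "s < m" using s by simp
    have d: "diamond_norm (D ^ k) (\<lambda>A. twirl D k Hb A - twirl D k (E s) A) \<le> ereal (\<delta> s)"
      using E[OF sm] by (simp add: orthogonal_design_def)
    have "M s = E s" using sm by (simp add: M_def)
    with brickwork_form_design[OF orthogonal_ensembles(1) Es[OF sm] d sm w, of U, OF orth[OF U]]
    show "\<bar>(\<integral>v. f (U(s := v)) \<partial>M s) - (\<integral>v. f (U(s := v)) \<partial>Hb)\<bar> \<le> \<delta> s"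
      unfolding f_def by (simp only: abs_minus_commute)
  qed simp
  with haar_brickwork_close[OF w] show ?thesis unfolding PM f_def by linarith
qed

lemma brickwork_state_design:
  assumes E: "\<And>s. s < m \<Longrightarrow> orthogonal_design Hb D k (\<delta> s) (E s)" and k: "k \<ge> 1" and \<epsilon>: "\<epsilon> > 0"
    and \<xi>: "real \<xi> \<ge> 7 * log 2 (real (m * \<xi>) * real k / \<epsilon>)" and \<delta>: "(\<Sum>s<m. \<delta> s) \<le> \<epsilon> / 2"
  shows "orthogonal_state_design HN (m * \<xi>) k \<epsilon> (Pi\<^sub>M {..<m} E) (\<lambda>U. brickwork m \<xi> U *\<^sub>v zero_state (m * \<xi>))"
  unfolding orthogonal_state_design_def
proof
  have Es: "orthogonal_ensemble D (E s)" if "s < m" for s using E[OF that] by (simp add: orthogonal_design_def)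
  show ensemble: "pure_state_ensemble (m * \<xi>) (Pi\<^sub>M {..<m} E) (\<lambda>U. brickwork m \<xi> U *\<^sub>v zero_state (m * \<xi>))"
    by (rule brickwork_ensemble[OF Es])
  have prob: "prob_space (Pi\<^sub>M {..<m} E)" using ensemble by (simp add: pure_state_ensemble_def)
  have orth: "U s \<in> orthogonal_group D" if "U \<in> space (Pi\<^sub>M {..<m} E)" "s < m" for U s
    by (rule PiM_orthogonal[OF _ that(1)]) (use Es that(2) in auto)
  note col = brickwork_column(1)[OF orth]
  have N: "N > 0" by simp
  have 1: "expect_mat (N ^ k) HN (\<lambda>U. tensor_power k (U * rank_one (zero_state (m * \<xi>)) * transpose_mat U))
      = mat (N ^ k) (N ^ k) (\<lambda>(a, b). complex_of_real (\<integral>U. tensor_vec k (haar_column U) (digits k N a) * tensor_vec k (haar_column U) (digits k N b) \<partial>HN))"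
  proof (rule expect_tensor_power_real[OF N])
    fix U assume "U \<in> space HN"
    hence U: "U \<in> orthogonal_group N" by (simp add: space_ensemble[OF orthogonal_ensembles(2)])
    note carr = orthogonal_group_carrier[OF U]
    have R: "rank_one (zero_state (m * \<xi>)) \<in> carrier_mat N N" by (simp add: rank_one_def zero_state_def)
    show "U * rank_one (zero_state (m * \<xi>)) * transpose_mat U \<in> carrier_mat N N"
      using carr R by simp
    fix i j assume ij: "i < N" "j < N"
    have UR: "(U * rank_one (zero_state (m * \<xi>))) $$ (i, l) = U $$ (i, 0) * of_bool (l = 0)" if l: "l < N" for l
    proof -
      have "(U * rank_one (zero_state (m * \<xi>))) $$ (i, l) = (\<Sum>p<N. U $$ (i, p) * rank_one (zero_state (m * \<xi>)) $$ (p, l))"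
        using ij l carrier_matD[OF carr] carrier_matD[OF R] by (simp add: scalar_prod_def atLeast0LessThan)
      also have "\<dots> = (\<Sum>p<N. if p = 0 then U $$ (i, 0) * of_bool (l = 0) else 0)"
        using l by (intro sum.cong refl) (auto simp: rank_one_def zero_state_def)
      finally show ?thesis by simp
    qed
    have "(V * transpose_mat U) $$ (i, j) = (\<Sum>l<N. V $$ (i, l) * U $$ (j, l))" if "V \<in> carrier_mat N N" for V
      using that ij carrier_matD[OF carr] by (simp add: scalar_prod_def atLeast0LessThan)
    from this[OF mult_carrier_mat[OF carr R]]
    have "(U * rank_one (zero_state (m * \<xi>)) * transpose_mat U) $$ (i, j)
        = (\<Sum>l<N. (U * rank_one (zero_state (m * \<xi>))) $$ (i, l) * U $$ (j, l))" .
    also have "\<dots> = (\<Sum>l<N. if l = 0 then U $$ (i, 0) * U $$ (j, 0) else 0)"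
      by (intro sum.cong refl) (simp add: UR)
    also have "\<dots> = U $$ (i, 0) * U $$ (j, 0)" by simp
    also have "\<dots> = complex_of_real (haar_column U i * haar_column U j)"
      by (simp only: orthogonal_entry[OF U ij(1) N] orthogonal_entry[OF U ij(2) N] of_real_mult)
    finally show "(U * rank_one (zero_state (m * \<xi>)) * transpose_mat U) $$ (i, j) = complex_of_real (haar_column U i * haar_column U j)" .
  qed
  have 2: "expect_mat (N ^ k) (Pi\<^sub>M {..<m} E) (\<lambda>U. tensor_power k (rank_one (brickwork m \<xi> U *\<^sub>v zero_state (m * \<xi>))))
      = mat (N ^ k) (N ^ k) (\<lambda>(a, b). complex_of_real (\<integral>U. tensor_vec k (real_state U) (digits k N a) * tensor_vec k (real_state U) (digits k N b) \<partial>Pi\<^sub>M {..<m} E))"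
  proof (rule expect_tensor_power_real[OF N])
    fix U assume U: "U \<in> space (Pi\<^sub>M {..<m} E)"
    have dim: "dim_vec (brickwork m \<xi> U *\<^sub>v zero_state (m * \<xi>)) = N"
      using ensemble U by (simp only: pure_state_ensemble_def carrier_vec_def mem_Collect_eq)
    thus "rank_one (brickwork m \<xi> U *\<^sub>v zero_state (m * \<xi>)) \<in> carrier_mat N N" by (simp add: rank_one_def)
    fix i j assume ij: "i < N" "j < N"
    show "rank_one (brickwork m \<xi> U *\<^sub>v zero_state (m * \<xi>)) $$ (i, j) = complex_of_real (real_state U i * real_state U j)"
      unfolding rank_one_def dim index_mat(1)[OF ij] split_conv
      by (simp only: col[OF U _ ij(1)] col[OF U _ ij(2)] complex_cnj_complex_of_real of_real_mult)
  qed
  show "trace_norm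
       (expect_mat (N ^ k) HN (\<lambda>U. tensor_power k (U * rank_one (zero_state (m * \<xi>)) * transpose_mat U))
        - expect_mat (N ^ k) (Pi\<^sub>M {..<m} E) (\<lambda>U. tensor_power k (rank_one (brickwork m \<xi> U *\<^sub>v zero_state (m * \<xi>))))) \<le> \<epsilon>"
    unfolding 1 2
  proof (rule trace_norm_moment_difference_le[OF N haar_pair_integrable])
    show "integrable (Pi\<^sub>M {..<m} E) (\<lambda>U. tensor_vec k (real_state U) p * tensor_vec k (real_state U) q)"
      if pq: "p \<in> X" "q \<in> X" for p q
    proof (rule tensor_pair_integrable[OF prob _ _ pq])
      show "(\<Sum>i<N. (real_state U i)\<^sup>2) = 1" if "U \<in> space (Pi\<^sub>M {..<m} E)" for U
        by (rule real_state_norm[of U, OF orth[OF that]])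
      show "(\<lambda>U. real_state U i) \<in> borel_measurable (Pi\<^sub>M {..<m} E)" for i
        by (rule real_state_measurable[of E, OF Es])
    qed
    fix w assume w: "form_bounded X w"
    define a where "a = (\<integral>U. quad_form X w (tensor_vec k (haar_column U)) \<partial>HN)"
    define b where "b = (\<integral>U. quad_form X w (tensor_vec k (real_state U)) \<partial>Pi\<^sub>M {..<m} E)"
    have "a - b \<le> \<epsilon>"
    \<comment> \<open>For \<open>\<epsilon> \<ge> 2\<close> the claim is trivial, as both
      expectations lie between -1 and 1. The remaining case has the bound on
      \<open>\<epsilon>\<close> that \<open>gluing_error_le\<close> requires.\<close>
    proof (cases "\<epsilon> < 2")
      case True
      have "12 * real (k * (k - 1) * m) / 2 ^ \<xi> \<le> \<epsilon> / 2"
        by (rule gluing_error_le[OF m_ge_2 xi_pos k \<epsilon> True \<xi>])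
      moreover have "\<bar>b - a\<bar> \<le> (\<Sum>s<m. \<delta> s) + 12 * real (k * (k - 1) * m) / 2 ^ \<xi>"
        unfolding a_def b_def by (rule design_brickwork_close[OF E w])
      ultimately show ?thesis using \<delta> by linarith
    next
      case False
      have "\<bar>a\<bar> \<le> 1" unfolding a_def
      proof (rule prob_integral_le_const[OF prob_HN])
        fix U assume "U \<in> space HN"
        hence "U \<in> orthogonal_group N" by (simp add: space_ensemble[OF orthogonal_ensembles(2)])
        thus "\<bar>quad_form X w (tensor_vec k (haar_column U))\<bar> \<le> 1"
          by (intro quad_form_le[OF w] tensor_norm haar_column_norm) simp_all
      qed simp
      moreover have "\<bar>b\<bar> \<le> 1" unfolding b_def
      proof (rule prob_integral_le_const[OF prob])
        fix U assume U: "U \<in> space (Pi\<^sub>M {..<m} E)"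
        show "\<bar>quad_form X w (tensor_vec k (real_state U))\<bar> \<le> 1"
          by (intro quad_form_le[OF w] tensor_norm real_state_norm orth[OF U])
      qed simp
      ultimately show ?thesis using False by linarith
    qed
    thus "(\<integral>U. quad_form X w (tensor_vec k (haar_column U)) \<partial>HN) - (\<integral>U. quad_form X w (tensor_vec k (real_state U)) \<partial>Pi\<^sub>M {..<m} E) \<le> \<epsilon>"
      unfolding a_def b_def .
  qed
qed

end

theorem corollaryS19:
  fixes H :: "nat \<Rightarrow> complex mat measure"
  assumes haar: "\<And>D. haar_orthogonal D (H D)"
  shows "\<exists>c>0. \<exists>C>0. \<forall>(p :: real poly) (B :: real). \<exists>q :: real poly.
    \<forall>(n :: nat) (m :: nat) (\<xi> :: nat) (k :: nat) (\<epsilon> :: real)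
     (\<delta> :: nat \<Rightarrow> real) (E :: nat \<Rightarrow> complex mat measure).
      even m \<longrightarrow> m > 0 \<longrightarrow> \<xi> > 0 \<longrightarrow> n = m * \<xi> \<longrightarrow> k \<ge> 1 \<longrightarrow> \<epsilon> > 0 \<longrightarrow>
      real \<xi> \<ge> C * log 2 (real n * real k / \<epsilon>) \<longrightarrow>
      (\<forall>s<m. orthogonal_design (H (2 ^ (2 * \<xi>))) (2 ^ (2 * \<xi>)) k (\<delta> s) (E s)) \<longrightarrow>
      (\<Sum>s<m. \<delta> s) \<le> c * \<epsilon> \<longrightarrow>
        orthogonal_state_design (H (2 ^ n)) n k \<epsilon>
          (Pi\<^sub>M {..<m} E) (\<lambda>U. brickwork m \<xi> U *\<^sub>v zero_state n) \<and>
        (\<epsilon> \<le> 1 \<longrightarrow> real \<xi> \<le> B * log 2 (real n * real k / \<epsilon>) \<longrightarrow>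
          (\<forall>d :: nat. real d \<le> poly p (real k) * real (2 * \<xi>) \<longrightarrow>
            (\<forall>s<m. AE V in E s. line_circuit (2 * \<xi>) d V) \<longrightarrow>
            (\<exists>d' :: nat. real d' \<le> poly q (real k) * log 2 (real n / \<epsilon>) \<and>
              (AE U in Pi\<^sub>M {..<m} E. ring_circuit n d' (brickwork m \<xi> U)))))"
\<comment> \<open>The error budget is halved: the design errors get \<open>\<epsilon> / 2\<close>,
  whence \<open>c = 1 / 2\<close>, and the gluing of Haar blocks gets the other half, which
  \<open>C = 7\<close> suffices for. The polynomial \<open>q\<close> is the one of
  \<open>depth_poly_log_le\<close>, which depends on \<open>p\<close> and \<open>B\<close>
  only.\<close>
proof (rule exI[of _ "1 / 2"], rule conjI[OF _ exI[of _ 7]], simp, rule conjI, simp, intro allI,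
    rule exI[of _ "[:4 * (\<bar>B\<bar> + 1):] * ((p * p + 1) * [:1, 1:])" for B p], intro allI impI)
  fix p :: "real poly" and B :: real and n m \<xi> k :: nat and \<epsilon> :: real
    and \<delta> :: "nat \<Rightarrow> real" and E :: "nat \<Rightarrow> complex mat measure"
  assume m: "even m" "m > 0" and \<xi>: "\<xi> > 0" and n: "n = m * \<xi>" and k: "k \<ge> 1" and \<epsilon>: "\<epsilon> > 0"
    and \<xi>C: "real \<xi> \<ge> 7 * log 2 (real n * real k / \<epsilon>)"
    and E: "\<forall>s<m. orthogonal_design (H (2 ^ (2 * \<xi>))) (2 ^ (2 * \<xi>)) k (\<delta> s) (E s)"
    and \<delta>: "(\<Sum>s<m. \<delta> s) \<le> 1 / 2 * \<epsilon>"
  interpret haar_brickwork m \<xi> k "H (2 ^ (2 * \<xi>))" "H (2 ^ (m * \<xi>))"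
    using m \<xi> haar by unfold_locales simp_all
  have "orthogonal_state_design (H (2 ^ n)) n k \<epsilon> (Pi\<^sub>M {..<m} E) (\<lambda>U. brickwork m \<xi> U *\<^sub>v zero_state n)"
    unfolding n by (rule brickwork_state_design) (use E k \<epsilon> \<xi>C \<delta> n in simp_all)
  moreover have "\<exists>d' :: nat. real d' \<le> poly ([:4 * (\<bar>B\<bar> + 1):] * ((p * p + 1) * [:1, 1:])) (real k) * log 2 (real n / \<epsilon>) \<and>
      (AE U in Pi\<^sub>M {..<m} E. ring_circuit n d' (brickwork m \<xi> U))"
    if \<epsilon>1: "\<epsilon> \<le> 1" and \<xi>B: "real \<xi> \<le> B * log 2 (real n * real k / \<epsilon>)"
      and d: "real d \<le> poly p (real k) * real (2 * \<xi>)" and circ: "\<forall>s<m. AE V in E s. line_circuit (2 * \<xi>) d V"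
    for d :: nat
  \<comment> \<open>The two layers run one after the other, each in depth \<open>d\<close>.\<close>
  proof (intro exI[of _ "2 * d"] conjI)
    have "2 * 1 \<le> m * \<xi>" using m_ge_2 \<xi> by (intro mult_mono) auto
    hence "n \<ge> 2" by (simp add: n)
    thus "real (2 * d) \<le> poly ([:4 * (\<bar>B\<bar> + 1):] * ((p * p + 1) * [:1, 1:])) (real k) * log 2 (real n / \<epsilon>)"
      by (rule depth_poly_log_le[OF _ k \<epsilon> \<epsilon>1 \<xi>B d])
    have "AE U in Pi\<^sub>M {..<m} E. line_circuit (2 * \<xi>) d (U s)" if s: "s \<in> {..<m}" for s
    proof (rule AE_PiM_component[OF _ s])
      show "prob_space (E i)" if "i \<in> {..<m}" for i
        using E that by (simp add: orthogonal_design_def orthogonal_ensemble_def)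
      show "AE V in E s. line_circuit (2 * \<xi>) d V" using circ s by simp
    qed
    hence "AE U in Pi\<^sub>M {..<m} E. \<forall>s\<in>{..<m}. line_circuit (2 * \<xi>) d (U s)"
      by (intro AE_finite_allI) simp_all
    thus "AE U in Pi\<^sub>M {..<m} E. ring_circuit n (2 * d) (brickwork m \<xi> U)"
    proof (rule AE_mp, intro AE_I2 impI)
      fix U assume U: "\<forall>s\<in>{..<m}. line_circuit (2 * \<xi>) d (U s)"
      show "ring_circuit n (2 * d) (brickwork m \<xi> U)"
        unfolding n by (rule brickwork_depth[OF m(1) \<xi>]) (use U in simp)
    qed
  qed
  ultimately show "orthogonal_state_design (H (2 ^ n)) n k \<epsilon> (Pi\<^sub>M {..<m} E) (\<lambda>U. brickwork m \<xi> U *\<^sub>v zero_state n) \<and>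
      (\<epsilon> \<le> 1 \<longrightarrow> real \<xi> \<le> B * log 2 (real n * real k / \<epsilon>) \<longrightarrow>
        (\<forall>d :: nat. real d \<le> poly p (real k) * real (2 * \<xi>) \<longrightarrow>
          (\<forall>s<m. AE V in E s. line_circuit (2 * \<xi>) d V) \<longrightarrow>
          (\<exists>d' :: nat. real d' \<le> poly ([:4 * (\<bar>B\<bar> + 1):] * ((p * p + 1) * [:1, 1:])) (real k) * log 2 (real n / \<epsilon>) \<and>
            (AE U in Pi\<^sub>M {..<m} E. ring_circuit n d' (brickwork m \<xi> U)))))"
    by (intro conjI impI allI)
qed

end
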